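(* Let $T>0$, $n\ge 1$, and let $$ \mathcal{L}u=\partial_t u+\sum_{i,j=1}^n a_{i,j}(t)\,\partial_{x_i}\partial_{x_j}u+\sum_{j=1}^n b_j(t)\,\partial_{x_j}u+c(t)\,u $$ be a backward parabolic operator on the strip $[0,T]\times\mathbb{R}^n$ whose coefficients depend only on $t$. Suppose that $a_{i,j}(t)=a_{j,i}(t)$ for all $i,j=1,\ldots,n$ and all $t\in[0,T]$, and that $a_{i,j},b_j,c\in L^\infty([0,T])$ for all $i,j=1,\ldots,n$. Let $\mu$ be a modulus of continuity satisfying the Osgood condition, and suppose that the $a_{i,j}$ are $\mathscr{C}^\mu$-continuous, i.e., for all $i,j=1,\ldots,n$, $$ \sup_{0<|\tau|<1}\frac{|a_{i,j}(t+\tau)-a_{i,j}(t)|}{\mu(|\tau|)}<+\infty , $$ where the supremum is over $t$ and $\tau$ with $t,\,t+\tau\in[0,T]$. Then for all $T'\in\,]0,T[$ and for all $D>0$ there exist $\rho>0$ and an increasing continuous function $\Psi:[0,+\infty)\to[0,+\infty)$ with $\Psi(0)=0$ such that, if $u\in\mathcal{H}_0$ is a solution of $\mathcal{L}u=0$ on $[0,T]$ with $\|u(t,\cdot)\|_{L^2}\le D$ on $[0,T]$ and $\|u(0,\cdot)\|_{L^2}\le\rho$, then $$ \sup_{t\in[0,T']}\|u(t,\cdot)\|_{L^2}\le\Psi\left(\|u(0,\cdot)\|_{L^2}\right). $$ The constant $\rho$ and the function $\Psi$ depend only on $T'$, on $D$, on the ellipticity constant of $\mathcal{L}$, on the $L^\infty$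 norms of the coefficients $a_{i,j}$ and of their spatial first derivatives, and on the Osgood constant of the coefficients $a_{i,j}$.
   Context: Here $L^2=L^2(\mathbb{R}^n)$ and $H^1=H^1(\mathbb{R}^n)$, and $$ \mathcal{H}_0=C([0,T],L^2)\cap C([0,T[,H^1)\cap C^1([0,T[,L^2). $$ Backward parabolic: there exists $k_A\in\,]0,1[$ (the ellipticity constant of $\mathcal{L}$) such that, for all $(t,\xi)\in[0,T]\times\mathbb{R}^n$, $$ k_A|\xi|^2\le\sum_{i,j=1}^n a_{i,j}(t)\xi_i\xi_j\le k_A^{-1}|\xi|^2 . $$ A modulus of continuity is a function $\mu:[0,1]\to[0,1]$ which is continuous, increasing, concave and such that $\mu(0)=0$. It satisfies the Osgood condition if $\int_0^1\frac{1}{\mu(s)}\,ds=+\infty$. The Osgood constant of the coefficients $a_{i,j}$ is the bound on the suprema of the quotients $|a_{i,j}(t+\tau)-a_{i,j}(t)|/\mu(|\tau|)$ appearing in the $\mathscr{C}^\mu$-continuity hypothesis. Since the coefficients depend only on $t$, their spatial derivatives are zero.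
   Formalization: ρ and Ψ may also depend on an upper bound for the L^∞ norms of b_j and c (and on the fixed T, n, μ); independence of c as literally claimed is false, e.g. a = Id, b = 0, c near −N on [0,T'] with N → ∞. *)

theory Defs
  imports "HOL-Probability.Essential_Supremum"
begin

text \<open>
  Elements of \<open>L\<^sup>2(\<real>\<^sup>n)\<close> are represented by square-integrable Borel functions (every class has such a
  representative). Two functions represent the same element iff they agree almost everywhere;
  no definition below distinguishes such functions.
\<close>

definition L2 :: "(real^'n \<Rightarrow> complex) set" where
  "L2 = {f \<in> borel_measurable lborel. integrable lborel (\<lambda>x. (norm (f x))\<^sup>2)}"

definition L2_norm :: "(real^'n \<Rightarrow> complex) \<Rightarrow> real" where
  "L2_norm f = sqrt (\<integral>x. (norm (f x))\<^sup>2 \<partial>lborel)"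

definition partial :: "'n \<Rightarrow> (real^'n \<Rightarrow> complex) \<Rightarrow> real^'n \<Rightarrow> complex" where
  "partial j \<phi> x = frechet_derivative \<phi> (at x) (axis j 1)"

text \<open>Smooth compactly supported functions: all iterated partial derivatives are (Frechet)
  differentiable everywhere, hence all of them are continuous.\<close>

definition test_functions :: "(real^'n \<Rightarrow> complex) set" where
  "test_functions = {\<phi>. (\<forall>js x. foldr partial js \<phi> differentiable (at x)) \<and>
                        compact (closure {x. \<phi> x \<noteq> 0})}"

text \<open>Distributions are functionals on test functions; only their values on
  \<^const>\<open>test_functions\<close> matter.\<close>

definition distr_of :: "(real^'n \<Rightarrow> complex) \<Rightarrow> (real^'n \<Rightarrow> complex) \<Rightarrow> complex" where
  "distr_of f \<phi> = (\<integral>x. f x * \<phi> x \<partial>lborel)"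

definition distr_partial ::
  "'n \<Rightarrow> ((real^'n \<Rightarrow> complex) \<Rightarrow> complex) \<Rightarrow> (real^'n \<Rightarrow> complex) \<Rightarrow> complex" where
  "distr_partial j \<Lambda> \<phi> = - \<Lambda> (partial j \<phi>)"

definition weak_partial :: "'n \<Rightarrow> (real^'n \<Rightarrow> complex) \<Rightarrow> (real^'n \<Rightarrow> complex) \<Rightarrow> bool" where
  "weak_partial j f g \<longleftrightarrow>
     g \<in> L2 \<and> (\<forall>\<phi>\<in>test_functions. distr_partial j (distr_of f) \<phi> = distr_of g \<phi>)"

definition H1 :: "(real^'n \<Rightarrow> complex) set" where
  "H1 = {f \<in> L2. \<forall>j. \<exists>g. weak_partial j f g}"

text \<open>The weak derivative is unique up to null sets, so the choice does not affect the norm.\<close>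

definition H1_norm :: "(real^'n \<Rightarrow> complex) \<Rightarrow> real" where
  "H1_norm f = sqrt ((L2_norm f)\<^sup>2 + (\<Sum>j\<in>UNIV. (L2_norm (SOME g. weak_partial j f g))\<^sup>2))"

definition continuous_into ::
  "('b \<Rightarrow> complex) set \<Rightarrow> (('b \<Rightarrow> complex) \<Rightarrow> real) \<Rightarrow> real set \<Rightarrow> (real \<Rightarrow> 'b \<Rightarrow> complex) \<Rightarrow> bool" where
  "continuous_into X N S w \<longleftrightarrow>
     (\<forall>t\<in>S. w t \<in> X) \<and>
     (\<forall>t\<in>S. ((\<lambda>s. N (\<lambda>x. w s x - w t x)) \<longlongrightarrow> 0) (at t within S))"

text \<open>\<open>v\<close> is the derivative of \<open>w\<close> on \<open>S\<close>, difference quotients converging in \<open>L\<^sup>2\<close>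
  (one-sided at end points of \<open>S\<close>).\<close>

definition has_L2_derivative_on ::
  "(real \<Rightarrow> real^'n \<Rightarrow> complex) \<Rightarrow> (real \<Rightarrow> real^'n \<Rightarrow> complex) \<Rightarrow> real set \<Rightarrow> bool" where
  "has_L2_derivative_on w v S \<longleftrightarrow>
     (\<forall>t\<in>S. w t \<in> L2 \<and> v t \<in> L2 \<and>
        ((\<lambda>s. L2_norm (\<lambda>x. (w s x - w t x) / complex_of_real (s - t) - v t x)) \<longlongrightarrow> 0)
          (at t within S))"

definition H0_space :: "real \<Rightarrow> (real \<Rightarrow> real^'n \<Rightarrow> complex) set" where
  "H0_space T = {u. continuous_into L2 L2_norm {0..T} u \<and>
                    continuous_into H1 H1_norm {0..<T} u \<and>
                    (\<exists>v. has_L2_derivative_on u v {0..<T} \<and>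
                         continuous_into L2 L2_norm {0..<T} v)}"

definition Linfty_norm :: "real \<Rightarrow> (real \<Rightarrow> 'a::real_normed_vector) \<Rightarrow> ereal" where
  "Linfty_norm T f = esssup (lebesgue_on {0..T}) (\<lambda>t. ereal (norm (f t)))"

definition Linfty :: "real \<Rightarrow> (real \<Rightarrow> 'a::real_normed_vector) set" where
  "Linfty T = {f \<in> borel_measurable (lebesgue_on {0..T}). Linfty_norm T f < \<infinity>}"

definition modulus_of_continuity :: "(real \<Rightarrow> real) \<Rightarrow> bool" where
  "modulus_of_continuity \<mu> \<longleftrightarrow>
     \<mu> ` {0..1} \<subseteq> {0..1} \<and> continuous_on {0..1} \<mu> \<and> mono_on {0..1} \<mu> \<and>
     concave_on {0..1} \<mu> \<and> \<mu> 0 = 0"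

definition osgood_condition :: "(real \<Rightarrow> real) \<Rightarrow> bool" where
  "osgood_condition \<mu> \<longleftrightarrow> (\<integral>\<^sup>+s\<in>{0..1}. 1 / ennreal (\<mu> s) \<partial>lborel) = \<infinity>"

text \<open>The quotient is taken in \<^typ>\<open>ennreal\<close>, where \<open>c / 0 = \<infinity>\<close> for \<open>c > 0\<close>, so a vanishing
  denominator does not make the supremum finite by accident.\<close>

definition osgood_constant :: "real \<Rightarrow> (real \<Rightarrow> real) \<Rightarrow> (real \<Rightarrow> real) \<Rightarrow> ennreal" where
  "osgood_constant T \<mu> f =
     (SUP (t, \<tau>)\<in>{(t, \<tau>). t \<in> {0..T} \<and> t + \<tau> \<in> {0..T} \<and> 0 < \<bar>\<tau>\<bar> \<and> \<bar>\<tau>\<bar> < 1}.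
        ennreal \<bar>f (t + \<tau>) - f t\<bar> / ennreal (\<mu> \<bar>\<tau>\<bar>))"

definition backward_parabolic :: "real \<Rightarrow> real \<Rightarrow> ('n::finite \<Rightarrow> 'n \<Rightarrow> real \<Rightarrow> real) \<Rightarrow> bool" where
  "backward_parabolic T k a \<longleftrightarrow>
     (\<forall>t\<in>{0..T}. \<forall>\<xi>::real^'n.
        k * (norm \<xi>)\<^sup>2 \<le> (\<Sum>i\<in>UNIV. \<Sum>j\<in>UNIV. a i j t * (\<xi> $ i) * (\<xi> $ j)) \<and>
        (\<Sum>i\<in>UNIV. \<Sum>j\<in>UNIV. a i j t * (\<xi> $ i) * (\<xi> $ j)) \<le> inverse k * (norm \<xi>)\<^sup>2)"

text \<open>The distribution \<open>(\<L> u)(t)\<close> on \<open>\<real>\<^sup>n\<close>, given \<open>w = u(t)\<close> and \<open>w' = \<partial>\<^sub>t u(t)\<close>; the spatial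
  derivatives are taken in the sense of distributions, since \<open>u(t)\<close> is only in \<open>H\<^sup>1\<close>.\<close>

definition L_op ::
  "('n::finite \<Rightarrow> 'n \<Rightarrow> real \<Rightarrow> real) \<Rightarrow> ('n \<Rightarrow> real \<Rightarrow> complex) \<Rightarrow> (real \<Rightarrow> complex) \<Rightarrow> real \<Rightarrow>
   (real^'n \<Rightarrow> complex) \<Rightarrow> (real^'n \<Rightarrow> complex) \<Rightarrow> (real^'n \<Rightarrow> complex) \<Rightarrow> complex" where
  "L_op a b c t w w' \<phi> =
     distr_of w' \<phi>
     + (\<Sum>i\<in>UNIV. \<Sum>j\<in>UNIV.
          complex_of_real (a i j t) * distr_partial i (distr_partial j (distr_of w)) \<phi>)
     + (\<Sum>j\<in>UNIV. b j t * distr_partial j (distr_of w) \<phi>)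
     + c t * distr_of w \<phi>"

text \<open>\<open>\<L> u = 0\<close>, for \<open>u\<close> in \<^const>\<open>H0_space\<close>: equality of distributions for almost every \<open>t\<close>
  (\<open>b\<close> and \<open>c\<close> are only determined up to null sets of times).\<close>

definition is_solution ::
  "real \<Rightarrow> ('n::finite \<Rightarrow> 'n \<Rightarrow> real \<Rightarrow> real) \<Rightarrow> ('n \<Rightarrow> real \<Rightarrow> complex) \<Rightarrow> (real \<Rightarrow> complex) \<Rightarrow>
   (real \<Rightarrow> real^'n \<Rightarrow> complex) \<Rightarrow> bool" where
  "is_solution T a b c u \<longleftrightarrow>
     (\<exists>v. has_L2_derivative_on u v {0..<T} \<and>
          (AE t in lebesgue_on {0..<T}. \<forall>\<phi>\<in>test_functions. L_op a b c t (u t) (v t) \<phi> = 0))"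

end

theory Submission
  imports Defs
    "HOL-Probability.Distributions"
    "HOL-Real_Asymp.Real_Asymp"
    "HOL-Computational_Algebra.Polynomial"
begin

text \<open>
  The coefficients do not depend on \<open>x\<close>, so the equation commutes with the isotropic heat semigroup
  \<open>S\<^sub>r\<close> (convolution with a Gaussian). Along a curve \<open>s \<mapsto> S\<^bsub>\<sigma>(s)\<^esub> u(s)\<close> the energy identity reads
  \<open>d/ds \<parallel>S\<^bsub>\<sigma>\<^esub> u\<parallel>\<^sup>2 = 2 (Q - \<sigma>' \<parallel>\<nabla>S\<^bsub>\<sigma>\<^esub> u\<parallel>\<^sup>2) + lower order terms\<close>, where the quadratic form \<open>Q\<close> of the
  coefficients is comparable to \<open>\<parallel>\<nabla>S\<^bsub>\<sigma>\<^esub> u\<parallel>\<^sup>2\<close>. Smoothing faster than the equation sharpens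
  (\<open>\<sigma>' = 2/k\<close>) bounds \<open>S\<^sub>R u(T\<^sub>1)\<close> by \<open>u(0)\<close> for large \<open>R\<close>; smoothing slower (\<open>\<sigma>' = k/2\<close>) bounds \<open>u(t)\<close> by
  \<open>S\<^sub>r u(T\<^sub>1)\<close> for some small \<open>r > 0\<close>, provided \<open>t \<le> T' < T\<^sub>1 < T\<close>. Log-convexity of the semigroup,
  \<open>\<parallel>S\<^sub>r f\<parallel>\<^sup>2 \<le> \<parallel>f\<parallel> \<parallel>S\<^bsub>2r\<^esub> f\<parallel>\<close>, interpolates between the two and yields Hoelder stability,
  with \<open>\<Psi>(s)\<close> a multiple of \<open>s\<^bsup>1/N\<^esup>\<close>.
\<close>

section \<open>Square-integrable functions and convolution\<close>

text \<open>The equation runs towards roughness: \<open>u\<close> at a later time is in general less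
  regular than \<open>u 0\<close>, so \<open>u 0\<close> can control it only after smoothing. The
  gap between the slopes \<open>2 / k\<close> and \<open>k / 2\<close> is the price of knowing the
  quadratic form only up to the factors \<open>k\<close> and \<open>inverse k\<close>; passing to
  \<open>k / 2\<close> and \<open>2 / k\<close> leaves room to absorb the first-order terms. Closing
  the gap costs \<open>m\<close> doublings of the smoothing time, enough that
  \<open>2 ^ m * (k / 2 * (T1 - T'))\<close> exceeds \<open>2 / k * T1\<close>; hence
  \<open>N = 2 ^ m\<close>.

  Two obstacles shape the rest. The equation holds in the sense of distributions and may be tested
  only against compactly supported functions, so Gaussians are reached as limits of Gaussians times
  cutoffs, and all spatial derivatives are then carried by the kernel. Moreover the equation and the
  bounds on \<open>b\<close> and \<open>c\<close> hold only at almost every time, whereas Gronwall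
  is applied to a differential inequality at every time. The resulting energy inequality contains no
  coefficient functions, only constants, and therefore extends to all times by continuity.\<close>

lemma L2_iff: "f \<in> L2 \<longleftrightarrow> f \<in> borel_measurable lborel \<and> integrable lborel (\<lambda>x. (norm (f x))\<^sup>2)"
  by (simp add: L2_def)

lemma L2_measurable [measurable_dest]: "f \<in> L2 \<Longrightarrow> f \<in> borel_measurable borel"
  by (simp add: L2_def)

lemma L2_integrable: "f \<in> L2 \<Longrightarrow> integrable lborel (\<lambda>x. (norm (f x))\<^sup>2)"
  by (simp add: L2_def)

lemma L2_dominated:
  assumes "g \<in> borel_measurable lborel" "integrable lborel h" "\<And>x. (norm (g x))\<^sup>2 \<le> h x"
  shows "g \<in> L2"
  unfolding L2_iff
proof
  show "integrable lborel (\<lambda>x. (norm (g x))\<^sup>2)"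
    by (rule Bochner_Integration.integrable_bound[OF assms(2)])
       (use assms in \<open>auto intro: order_trans[OF _ abs_ge_self]\<close>)
qed (use assms in auto)

lemma norm_add_sq_le: "(norm (a + b))\<^sup>2 \<le> 2 * (norm a)\<^sup>2 + 2 * (norm (b::'a::real_normed_vector))\<^sup>2"
proof -
  have "(norm (a + b))\<^sup>2 \<le> (norm a + norm b)\<^sup>2"
    by (intro power_mono norm_triangle_ineq) auto
  also have "\<dots> \<le> 2 * (norm a)\<^sup>2 + 2 * (norm b)\<^sup>2"
    using sum_squares_bound[of "norm a" "norm b"] by (simp add: power2_sum)
  finally show ?thesis .
qed

lemma L2_add: assumes "f \<in> L2" "g \<in> L2" shows "(\<lambda>x. f x + g x) \<in> L2"
  by (rule L2_dominated[where h="\<lambda>x. 2 * (norm (f x))\<^sup>2 + 2 * (norm (g x))\<^sup>2"])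
     (use assms[THEN L2_measurable] assms in \<open>auto simp: L2_integrable norm_add_sq_le\<close>)

lemma L2_cmult: assumes "f \<in> L2" shows "(\<lambda>x. c * f x) \<in> L2"
  using assms by (auto simp: L2_iff norm_mult power_mult_distrib)

lemma L2_diff: assumes "f \<in> L2" "g \<in> L2" shows "(\<lambda>x. f x - g x) \<in> L2"
  using L2_add[OF assms(1) L2_cmult[OF assms(2), of "-1"]] by simp

lemma L2_zero: "(\<lambda>x. 0) \<in> L2"
  by (simp add: L2_iff)

lemma L2_sum: "(\<And>i. i \<in> I \<Longrightarrow> f i \<in> L2) \<Longrightarrow> (\<lambda>x. \<Sum>i\<in>I. f i x) \<in> L2"
  by (induction I rule: infinite_finite_induct) (auto simp: L2_zero intro: L2_add)

definition ip :: "(real^'n \<Rightarrow> complex) \<Rightarrow> (real^'n \<Rightarrow> complex) \<Rightarrow> complex" where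
  "ip f g = (\<integral>x. f x * cnj (g x) \<partial>lborel)"

lemma L2_mult_integrable:
  assumes "f \<in> L2" "g \<in> L2" shows "integrable lborel (\<lambda>x. f x * g x)"
proof (rule Bochner_Integration.integrable_bound)
  show "integrable lborel (\<lambda>x. (norm (f x))\<^sup>2 + (norm (g x))\<^sup>2)"
    using assms by (auto simp: L2_integrable)
  have "norm (f x * g x) \<le> (norm (f x))\<^sup>2 + (norm (g x))\<^sup>2" for x
    using sum_squares_bound[of "norm (f x)" "norm (g x)"] mult_nonneg_nonneg[OF norm_ge_zero[of "f x"] norm_ge_zero[of "g x"]]
    unfolding norm_mult by linarith
  then show "AE x in lborel. norm (f x * g x) \<le> norm ((norm (f x))\<^sup>2 + (norm (g x))\<^sup>2)"
    by auto
qed (use assms in measurable)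

lemma L2_cnj: "f \<in> L2 \<Longrightarrow> (\<lambda>x. cnj (f x)) \<in> L2"
  using borel_measurable_continuous_onI[of cnj] unfolding L2_iff
  by (auto intro!: measurable_compose[of f _ _ cnj] continuous_intros)

lemma ip_integrable:
  assumes "f \<in> L2" "g \<in> L2" shows "integrable lborel (\<lambda>x. f x * cnj (g x))"
  using L2_mult_integrable[OF assms(1) L2_cnj[OF assms(2)]] .

lemma ip_add_left: "f \<in> L2 \<Longrightarrow> g \<in> L2 \<Longrightarrow> h \<in> L2 \<Longrightarrow> ip (\<lambda>x. f x + g x) h = ip f h + ip g h"
  unfolding ip_def by (simp add: distrib_right ip_integrable)

lemma ip_diff_left: "f \<in> L2 \<Longrightarrow> g \<in> L2 \<Longrightarrow> h \<in> L2 \<Longrightarrow> ip (\<lambda>x. f x - g x) h = ip f h - ip g h"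
  unfolding ip_def by (simp add: left_diff_distrib ip_integrable)

lemma ip_cmult_left: "ip (\<lambda>x. c * f x) h = c * ip f h"
  unfolding ip_def by (simp add: mult.assoc)

lemma ip_commute: "ip g f = cnj (ip f g)"
  unfolding ip_def by (simp add: mult.commute flip: Bochner_Integration.integral_cnj)

lemma ip_add_right: "f \<in> L2 \<Longrightarrow> g \<in> L2 \<Longrightarrow> h \<in> L2 \<Longrightarrow> ip h (\<lambda>x. f x + g x) = ip h f + ip h g"
  unfolding ip_def by (simp add: distrib_left ip_integrable)

lemma ip_diff_right: "f \<in> L2 \<Longrightarrow> g \<in> L2 \<Longrightarrow> h \<in> L2 \<Longrightarrow> ip h (\<lambda>x. f x - g x) = ip h f - ip h g"
  unfolding ip_def by (simp add: right_diff_distrib ip_integrable)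

lemma ip_cmult_right: "ip h (\<lambda>x. c * f x) = cnj c * ip h f"
  unfolding ip_def by (simp add: mult.left_commute)

lemma ip_sum_right:
  "(\<And>i. i \<in> I \<Longrightarrow> f i \<in> L2) \<Longrightarrow> h \<in> L2 \<Longrightarrow> ip h (\<lambda>x. \<Sum>i\<in>I. f i x) = (\<Sum>i\<in>I. ip h (f i))"
  unfolding ip_def by (simp add: sum_distrib_left ip_integrable)

lemma L2_norm_nonneg [simp]: "0 \<le> L2_norm f"
  by (simp add: L2_norm_def)

lemma L2_norm_sq: "(L2_norm f)\<^sup>2 = (\<integral>x. (norm (f x))\<^sup>2 \<partial>lborel)"
  by (simp add: L2_norm_def)

lemma ip_self: "ip f f = of_real ((L2_norm f)\<^sup>2)"
  unfolding ip_def L2_norm_sq by (subst integral_complex_of_real[symmetric]) (simp only: complex_norm_square)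

lemma L2_norm_cmult: "L2_norm (\<lambda>x. c * f x) = norm c * L2_norm f"
  unfolding L2_norm_def by (simp add: norm_mult power_mult_distrib real_sqrt_mult)

lemma L2_norm_minus_commute: "L2_norm (\<lambda>x. f x - g x) = L2_norm (\<lambda>x. g x - f x)"
  unfolding L2_norm_def by (simp add: norm_minus_commute)

text \<open>The integral of the square of \<open>s * f x + t * g x\<close> is a nonnegative
  quadratic form in \<open>s\<close> and \<open>t\<close>, so its discriminant has a sign. The
  degenerate case \<open>A = 0\<close> is separated to avoid dividing by \<open>A\<close>.\<close>

lemma Cauchy_Schwarz_integral:
  fixes f g :: "'a \<Rightarrow> real"
  assumes [measurable]: "f \<in> borel_measurable M" "g \<in> borel_measurable M"
    and f: "integrable M (\<lambda>x. (f x)\<^sup>2)" and g: "integrable M (\<lambda>x. (g x)\<^sup>2)"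
  shows "(\<integral>x. f x * g x \<partial>M)\<^sup>2 \<le> (\<integral>x. (f x)\<^sup>2 \<partial>M) * (\<integral>x. (g x)\<^sup>2 \<partial>M)"
proof -
  have fg: "integrable M (\<lambda>x. f x * g x)"
  proof (rule Bochner_Integration.integrable_bound)
    show "integrable M (\<lambda>x. (f x)\<^sup>2 + (g x)\<^sup>2)" using f g by auto
    have "\<bar>f x * g x\<bar> \<le> (f x)\<^sup>2 + (g x)\<^sup>2" for x
      using sum_squares_bound[of "\<bar>f x\<bar>" "\<bar>g x\<bar>"] mult_nonneg_nonneg[OF abs_ge_zero[of "f x"] abs_ge_zero[of "g x"]]
      unfolding abs_mult power2_abs by linarith
    then show "AE x in M. norm (f x * g x) \<le> norm ((f x)\<^sup>2 + (g x)\<^sup>2)" by auto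
  qed auto
  define A B C where "A = (\<integral>x. (f x)\<^sup>2 \<partial>M)" and "B = (\<integral>x. f x * g x \<partial>M)" and "C = (\<integral>x. (g x)\<^sup>2 \<partial>M)"
  have q: "0 \<le> A * s\<^sup>2 + 2 * B * s * t + C * t\<^sup>2" for s t
  proof -
    have "0 \<le> (\<integral>x. (s * f x + t * g x)\<^sup>2 \<partial>M)" by (rule integral_nonneg_AE) auto
    also have "(\<lambda>x. (s * f x + t * g x)\<^sup>2) = (\<lambda>x. s\<^sup>2 * (f x)\<^sup>2 + 2 * s * t * (f x * g x) + t\<^sup>2 * (g x)\<^sup>2)"
      by (auto simp: power2_eq_square algebra_simps)
    also have "(\<integral>x. \<dots> x \<partial>M) = A * s\<^sup>2 + 2 * B * s * t + C * t\<^sup>2"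
      using f g fg by (simp add: A_def B_def C_def)
    finally show ?thesis .
  qed
  have "0 \<le> A" "0 \<le> C" unfolding A_def C_def by (auto intro!: integral_nonneg_AE)
  have "B\<^sup>2 \<le> A * C"
  proof (cases "A = 0")
    case True
    have "B = 0"
    proof (rule ccontr)
      assume "B \<noteq> 0"
      \<comment> \<open>For \<open>A = 0\<close> and \<open>t = 1\<close> the form is the affine
        function \<open>2 * B * s + C\<close>; this \<open>s\<close> gives it the value -1.\<close>
      with q[of "-(C+1) / (2*B)" 1] True show False by simp
    qed
    with True show ?thesis by simp
  next
    case False
    with \<open>0 \<le> A\<close> have "A > 0" by simp
    \<comment> \<open>The minimising ratio \<open>s / t = - B / A\<close>, with the denominator
      cleared.\<close>
    have "0 \<le> A * (-B)\<^sup>2 + 2 * B * (-B) * A + C * A\<^sup>2" by (rule q)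
    then have "0 \<le> A * (A * C - B\<^sup>2)" by (simp add: power2_eq_square algebra_simps)
    with \<open>A > 0\<close> show ?thesis by (simp add: zero_le_mult_iff)
  qed
  then show ?thesis by (simp add: A_def B_def C_def)
qed

lemma L2_Cauchy_Schwarz:
  assumes "f \<in> L2" "g \<in> L2"
  shows "norm (ip f g) \<le> L2_norm f * L2_norm g"
proof -
  have "norm (ip f g) \<le> (\<integral>x. norm (f x) * norm (g x) \<partial>lborel)"
    unfolding ip_def using integral_norm_bound[of lborel "\<lambda>x. f x * cnj (g x)"] by (simp add: norm_mult)
  moreover have "(\<integral>x. norm (f x) * norm (g x) \<partial>lborel)\<^sup>2 \<le> (L2_norm f)\<^sup>2 * (L2_norm g)\<^sup>2"
    unfolding L2_norm_sq by (rule Cauchy_Schwarz_integral) (use assms in \<open>auto simp: L2_iff\<close>)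
  then have "(\<integral>x. norm (f x) * norm (g x) \<partial>lborel) \<le> L2_norm f * L2_norm g"
    unfolding power_mult_distrib[symmetric] by (rule power2_le_imp_le) simp
  ultimately show ?thesis by simp
qed

lemma L2_norm_sq_add:
  assumes "f \<in> L2" "g \<in> L2"
  shows "(L2_norm (\<lambda>x. f x + g x))\<^sup>2 = (L2_norm f)\<^sup>2 + 2 * Re (ip f g) + (L2_norm g)\<^sup>2"
proof -
  have "complex_of_real ((L2_norm (\<lambda>x. f x + g x))\<^sup>2) = ip f f + ip f g + (ip g f + ip g g)"
    unfolding ip_self[symmetric] using assms by (simp add: ip_add_left ip_add_right L2_add)
  then have "Re (complex_of_real ((L2_norm (\<lambda>x. f x + g x))\<^sup>2)) = Re (ip f f + ip f g + (ip g f + ip g g))"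
    by simp
  then show ?thesis by (simp add: ip_self ip_commute[of g f])
qed

lemma L2_triangle:
  assumes "f \<in> L2" "g \<in> L2"
  shows "L2_norm (\<lambda>x. f x + g x) \<le> L2_norm f + L2_norm g"
proof (rule power2_le_imp_le)
  show "(L2_norm (\<lambda>x. f x + g x))\<^sup>2 \<le> (L2_norm f + L2_norm g)\<^sup>2"
    unfolding L2_norm_sq_add[OF assms] power2_sum
    using L2_Cauchy_Schwarz[OF assms] complex_Re_le_cmod[of "ip f g"] by simp
qed simp

lemma L2_triangle_diff:
  assumes "f \<in> L2" "g \<in> L2"
  shows "\<bar>L2_norm f - L2_norm g\<bar> \<le> L2_norm (\<lambda>x. f x - g x)"
proof -
  have "L2_norm f \<le> L2_norm (\<lambda>x. f x - g x) + L2_norm g"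
    using L2_triangle[OF L2_diff[OF assms] assms(2)] by simp
  moreover have "L2_norm g \<le> L2_norm (\<lambda>x. f x - g x) + L2_norm f"
    using L2_triangle[OF L2_diff[OF assms(2,1)] assms(1)] by (simp add: L2_norm_minus_commute[of f g])
  ultimately show ?thesis by linarith
qed

section \<open>Convolution of square-integrable functions with bounded integrable kernels\<close>

lemma distr_lborel_reflect: "distr lborel borel (\<lambda>y::'a::euclidean_space. x - y) = lborel"
proof -
  have "lborel = density (distr lborel borel (\<lambda>y::'a. x + (-1) *\<^sub>R y)) (\<lambda>_. \<bar>-1::real\<bar>^DIM('a))"
    by (rule lborel_affine) simp
  then show ?thesis by (simp add: density_1)
qed

lemma nn_integral_translate:
  fixes f :: "'a::euclidean_space \<Rightarrow> ennreal"
  assumes "f \<in> borel_measurable borel"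
  shows "(\<integral>\<^sup>+y. f (y - x) \<partial>lborel) = (\<integral>\<^sup>+y. f y \<partial>lborel)"
  by (subst (2) lborel_distr_plus[of "-x", symmetric]) (use assms in \<open>simp add: nn_integral_distr\<close>)

lemma integral_reflect:
  fixes f :: "'a::euclidean_space \<Rightarrow> 'b::{banach, second_countable_topology}"
  assumes "f \<in> borel_measurable borel"
  shows "(\<integral>y. f (x - y) \<partial>lborel) = (\<integral>y. f y \<partial>lborel)"
  by (subst (2) distr_lborel_reflect[of x, symmetric]) (use assms in \<open>simp add: integral_distr\<close>)

lemma integrable_reflect:
  fixes f :: "'a::euclidean_space \<Rightarrow> 'b::{banach, second_countable_topology}"
  assumes "integrable lborel f"
  shows "integrable lborel (\<lambda>y. f (x - y))"
  by (rule integrable_distr[of "\<lambda>y. x - y" _ borel]) (use assms distr_lborel_reflect[of x] in auto)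

text \<open>Integrability gives Young's inequality on \<open>L2\<close>. Boundedness in addition
  puts the kernel itself into \<open>L2\<close>, so the convolution integral converges absolutely at
  every point and the algebraic identities below hold pointwise, not merely almost
  everywhere.\<close>

definition conv_kernel :: "(real^'n \<Rightarrow> real) \<Rightarrow> bool" where
  "conv_kernel k \<longleftrightarrow> integrable lborel k \<and> bounded (range k)"

definition conv :: "(real^'n \<Rightarrow> real) \<Rightarrow> (real^'n \<Rightarrow> complex) \<Rightarrow> real^'n \<Rightarrow> complex" where
  "conv k f x = (\<integral>y. k (x - y) *\<^sub>R f y \<partial>lborel)"

lemma kernel_measurable [measurable_dest]: "conv_kernel k \<Longrightarrow> k \<in> borel_measurable borel"
  unfolding conv_kernel_def by auto

lemma kernel_reflect: assumes "conv_kernel k" shows "conv_kernel (\<lambda>y. k (x - y))"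
proof -
  have "bounded (range (\<lambda>y. k (x - y)))"
    by (rule bounded_subset[of "range k"]) (use assms in \<open>auto simp: conv_kernel_def\<close>)
  then show ?thesis using integrable_reflect[of k x] assms by (simp add: conv_kernel_def)
qed

lemma kernel_abs: assumes "conv_kernel k" shows "conv_kernel (\<lambda>y. \<bar>k y\<bar>)"
  using assms by (auto simp: conv_kernel_def bounded_iff)

lemma kernel_add: assumes "conv_kernel k" "conv_kernel l" shows "conv_kernel (\<lambda>x. k x + l x)"
  using assms by (auto simp: conv_kernel_def bounded_plus_comp)

lemma kernel_cmult: assumes "conv_kernel k" shows "conv_kernel (\<lambda>x. c * k x)"
  using assms bounded_scaling[of "range k" c] by (auto simp: conv_kernel_def image_image)

lemma kernel_diff: assumes "conv_kernel k" "conv_kernel l" shows "conv_kernel (\<lambda>x. k x - l x)"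
  using kernel_add[OF assms(1) kernel_cmult[OF assms(2), of "-1"]] by simp

lemma kernel_zero: "conv_kernel (\<lambda>x. 0)"
  by (auto simp: conv_kernel_def)

lemma kernel_sum: "(\<And>i. i \<in> I \<Longrightarrow> conv_kernel (k i)) \<Longrightarrow> conv_kernel (\<lambda>x. \<Sum>i\<in>I. k i x)"
  by (induction I rule: infinite_finite_induct) (auto intro: kernel_add kernel_zero)

lemma kernel_mult_integrable:
  fixes h :: "real^'n \<Rightarrow> 'b::{banach, second_countable_topology}"
  assumes "conv_kernel k" "integrable lborel h"
  shows "integrable lborel (\<lambda>y. k y *\<^sub>R h y)"
proof -
  obtain B where B: "\<And>x. \<bar>k x\<bar> \<le> B" using assms(1) by (auto simp: conv_kernel_def bounded_iff)
  show ?thesis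
  proof (rule Bochner_Integration.integrable_bound)
    show "integrable lborel (\<lambda>y. B *\<^sub>R h y)" using assms(2) by simp
    have "norm (k y *\<^sub>R h y) \<le> norm (B *\<^sub>R h y)" for y
      using B[of y] by (auto intro!: mult_right_mono)
    then show "AE x in lborel. norm (k x *\<^sub>R h x) \<le> norm (B *\<^sub>R h x)" by simp
  qed (use assms in measurable)
qed

lemma kernel_L2: assumes "conv_kernel k" shows "(\<lambda>x. complex_of_real (k x)) \<in> L2"
proof -
  have "integrable lborel (\<lambda>y. k y *\<^sub>R k y)"
    by (rule kernel_mult_integrable[OF assms]) (use assms in \<open>simp add: conv_kernel_def\<close>)
  then show ?thesis using assms by (simp add: L2_iff power2_eq_square kernel_measurable)
qed

lemma conv_integrable:
  assumes "conv_kernel k" "f \<in> L2" shows "integrable lborel (\<lambda>y. k (x - y) *\<^sub>R f y)"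
  using L2_mult_integrable[OF kernel_L2[OF kernel_reflect[OF assms(1), of x]] assms(2)]
  by (simp add: scaleR_conv_of_real)

lemma conv_measurable:
  assumes [measurable]: "k \<in> borel_measurable borel" "f \<in> borel_measurable lborel"
  shows "conv k f \<in> borel_measurable lborel"
  unfolding conv_def[abs_def] by measurable

text \<open>Cauchy-Schwarz after splitting the modulus of the kernel into two square roots, only one
  of which stays with \<open>f\<close>. Integrating this pointwise bound over \<open>x\<close> gives
  Young's inequality.\<close>

lemma conv_norm_sq_le:
  assumes k: "conv_kernel k" and f: "f \<in> L2"
  shows "(norm (conv k f x))\<^sup>2 \<le> (\<integral>y. \<bar>k y\<bar> \<partial>lborel) * (\<integral>y. \<bar>k (x - y)\<bar> * (norm (f y))\<^sup>2 \<partial>lborel)"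
proof -
  note [measurable] = kernel_measurable[OF k] L2_measurable[OF f]
  have k': "conv_kernel (\<lambda>y. \<bar>k (x - y)\<bar>)" by (rule kernel_abs[OF kernel_reflect[OF k]])
  have "norm (conv k f x) \<le> (\<integral>y. norm (k (x - y) *\<^sub>R f y) \<partial>lborel)"
    unfolding conv_def by (rule integral_norm_bound)
  also have "\<dots> = (\<integral>y. sqrt \<bar>k (x - y)\<bar> * (sqrt \<bar>k (x - y)\<bar> * norm (f y)) \<partial>lborel)"
    by (simp add: mult.assoc[symmetric])
  finally have "(norm (conv k f x))\<^sup>2 \<le> (\<integral>y. sqrt \<bar>k (x - y)\<bar> * (sqrt \<bar>k (x - y)\<bar> * norm (f y)) \<partial>lborel)\<^sup>2"
    by (intro power_mono) auto
  also have "\<dots> \<le> (\<integral>y. (sqrt \<bar>k (x - y)\<bar>)\<^sup>2 \<partial>lborel) * (\<integral>y. (sqrt \<bar>k (x - y)\<bar> * norm (f y))\<^sup>2 \<partial>lborel)"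
  proof (rule Cauchy_Schwarz_integral)
    show "integrable lborel (\<lambda>y. (sqrt \<bar>k (x - y)\<bar>)\<^sup>2)" using k' by (simp add: conv_kernel_def)
    show "integrable lborel (\<lambda>y. (sqrt \<bar>k (x - y)\<bar> * norm (f y))\<^sup>2)"
      using kernel_mult_integrable[OF k' L2_integrable[OF f]] by (simp add: power_mult_distrib)
  qed measurable
  also have "\<dots> = (\<integral>y. \<bar>k (x - y)\<bar> \<partial>lborel) * (\<integral>y. \<bar>k (x - y)\<bar> * (norm (f y))\<^sup>2 \<partial>lborel)"
    by (simp add: power_mult_distrib)
  also have "(\<integral>y. \<bar>k (x - y)\<bar> \<partial>lborel) = (\<integral>y. \<bar>k y\<bar> \<partial>lborel)"
    by (rule integral_reflect) measurable
  finally show ?thesis .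
qed

text \<open>Tonelli and translation invariance. The computation uses nonnegative extended integrals,
  so that integrability and the value of the integral come out together.\<close>

lemma kernel_abs_conv_integral:
  assumes k: "conv_kernel k" and h: "integrable lborel h" "\<And>x. 0 \<le> h x"
  shows "integrable lborel (\<lambda>x. \<integral>y. \<bar>k (x - y)\<bar> * h y \<partial>lborel)"
    and "(\<integral>x. (\<integral>y. \<bar>k (x - y)\<bar> * h y \<partial>lborel) \<partial>lborel) = (\<integral>y. \<bar>k y\<bar> \<partial>lborel) * (\<integral>y. h y \<partial>lborel)"
proof -
  note [measurable] = kernel_measurable[OF k] borel_measurable_integrable[OF h(1)]
  have h_int: "(\<integral>\<^sup>+y. ennreal (h y) \<partial>lborel) = ennreal (\<integral>y. h y \<partial>lborel)"
    by (rule nn_integral_eq_integral) (use h in auto)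
  have k_int: "(\<integral>\<^sup>+y. ennreal \<bar>k y\<bar> \<partial>lborel) = ennreal (\<integral>y. \<bar>k y\<bar> \<partial>lborel)"
    by (rule nn_integral_eq_integral) (use k in \<open>auto simp: conv_kernel_def\<close>)
  have "integrable lborel (\<lambda>y. \<bar>k (x - y)\<bar> * h y)" for x
    using kernel_mult_integrable[OF kernel_abs[OF kernel_reflect[OF k, of x]] h(1)] by simp
  then have "ennreal (\<integral>y. \<bar>k (x - y)\<bar> * h y \<partial>lborel) = (\<integral>\<^sup>+y. ennreal (\<bar>k (x - y)\<bar> * h y) \<partial>lborel)" for x
    by (subst nn_integral_eq_integral) (use h in auto)
  then have "(\<integral>\<^sup>+x. ennreal (\<integral>y. \<bar>k (x - y)\<bar> * h y \<partial>lborel) \<partial>lborel)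
      = (\<integral>\<^sup>+x. (\<integral>\<^sup>+y. ennreal (\<bar>k (x - y)\<bar> * h y) \<partial>lborel) \<partial>lborel)" by simp
  also have "\<dots> = (\<integral>\<^sup>+y. (\<integral>\<^sup>+x. ennreal (\<bar>k (x - y)\<bar> * h y) \<partial>lborel) \<partial>lborel)"
    by (rule lborel_pair.Fubini') measurable
  also have "\<dots> = (\<integral>\<^sup>+y. (\<integral>\<^sup>+x. ennreal \<bar>k (x - y)\<bar> \<partial>lborel) * ennreal (h y) \<partial>lborel)"
    by (intro nn_integral_cong) (simp add: ennreal_mult' ennreal_mult h nn_integral_multc)
  also have "\<dots> = (\<integral>\<^sup>+y. ennreal (\<integral>y. \<bar>k y\<bar> \<partial>lborel) * ennreal (h y) \<partial>lborel)"
    by (subst nn_integral_translate[where f="\<lambda>x. ennreal \<bar>k x\<bar>"]) (simp_all add: k_int)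
  also have "\<dots> = ennreal (\<integral>y. \<bar>k y\<bar> \<partial>lborel) * ennreal (\<integral>y. h y \<partial>lborel)"
    by (subst nn_integral_cmult) (simp_all add: h_int)
  finally have *: "(\<integral>\<^sup>+x. ennreal (\<integral>y. \<bar>k (x - y)\<bar> * h y \<partial>lborel) \<partial>lborel)
      = ennreal ((\<integral>y. \<bar>k y\<bar> \<partial>lborel) * (\<integral>y. h y \<partial>lborel))"
    by (simp add: ennreal_mult' h integral_nonneg_AE)
  have "integrable lborel (\<lambda>x. \<integral>y. \<bar>k (x - y)\<bar> * h y \<partial>lborel) \<and>
      (\<integral>x. (\<integral>y. \<bar>k (x - y)\<bar> * h y \<partial>lborel) \<partial>lborel) = (\<integral>y. \<bar>k y\<bar> \<partial>lborel) * (\<integral>y. h y \<partial>lborel)"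
    by (subst nn_integral_eq_integrable[symmetric]) (use h * in \<open>auto intro!: integral_nonneg_AE mult_nonneg_nonneg\<close>)
  then show "integrable lborel (\<lambda>x. \<integral>y. \<bar>k (x - y)\<bar> * h y \<partial>lborel)"
    and "(\<integral>x. (\<integral>y. \<bar>k (x - y)\<bar> * h y \<partial>lborel) \<partial>lborel) = (\<integral>y. \<bar>k y\<bar> \<partial>lborel) * (\<integral>y. h y \<partial>lborel)"
    by auto
qed

lemma conv_L2: assumes "conv_kernel k" "f \<in> L2" shows "conv k f \<in> L2"
proof (rule L2_dominated)
  show "integrable lborel (\<lambda>x. (\<integral>y. \<bar>k y\<bar> \<partial>lborel) * (\<integral>y. \<bar>k (x - y)\<bar> * (norm (f y))\<^sup>2 \<partial>lborel))"
    using kernel_abs_conv_integral(1)[OF assms(1) L2_integrable[OF assms(2)]] by simp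
qed (use assms conv_norm_sq_le conv_measurable[of k f] in \<open>auto simp: L2_measurable kernel_measurable\<close>)

lemma conv_L2_norm_le:
  assumes "conv_kernel k" "f \<in> L2"
  shows "L2_norm (conv k f) \<le> (\<integral>y. \<bar>k y\<bar> \<partial>lborel) * L2_norm f"
proof (rule power2_le_imp_le)
  have "(L2_norm (conv k f))\<^sup>2 \<le> (\<integral>x. (\<integral>y. \<bar>k y\<bar> \<partial>lborel) * (\<integral>y. \<bar>k (x - y)\<bar> * (norm (f y))\<^sup>2 \<partial>lborel) \<partial>lborel)"
    unfolding L2_norm_sq
  proof (rule integral_mono)
    show "integrable lborel (\<lambda>x. (norm (conv k f x))\<^sup>2)" using L2_integrable[OF conv_L2[OF assms]] .
    show "integrable lborel (\<lambda>x. (\<integral>y. \<bar>k y\<bar> \<partial>lborel) * (\<integral>y. \<bar>k (x - y)\<bar> * (norm (f y))\<^sup>2 \<partial>lborel))"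
      using kernel_abs_conv_integral(1)[OF assms(1) L2_integrable[OF assms(2)]] by simp
  qed (rule conv_norm_sq_le[OF assms])
  also have "\<dots> = ((\<integral>y. \<bar>k y\<bar> \<partial>lborel) * L2_norm f)\<^sup>2"
    using kernel_abs_conv_integral(2)[OF assms(1) L2_integrable[OF assms(2)]]
    by (simp add: power_mult_distrib L2_norm_sq) (simp add: power2_eq_square)
  finally show "(L2_norm (conv k f))\<^sup>2 \<le> ((\<integral>y. \<bar>k y\<bar> \<partial>lborel) * L2_norm f)\<^sup>2" .
qed (auto intro!: mult_nonneg_nonneg integral_nonneg_AE)

lemma conv_add_right: "conv_kernel k \<Longrightarrow> f \<in> L2 \<Longrightarrow> g \<in> L2 \<Longrightarrow> conv k (\<lambda>x. f x + g x) x = conv k f x + conv k g x"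
  unfolding conv_def by (simp add: scaleR_add_right conv_integrable)

lemma conv_diff_right: "conv_kernel k \<Longrightarrow> f \<in> L2 \<Longrightarrow> g \<in> L2 \<Longrightarrow> conv k (\<lambda>x. f x - g x) x = conv k f x - conv k g x"
  unfolding conv_def by (simp add: scaleR_diff_right conv_integrable)

lemma conv_cmult_right: "conv k (\<lambda>x. c * f x) x = c * conv k f x"
  unfolding conv_def by (subst integral_mult_right_zero[symmetric]) (simp add: scaleR_conv_of_real mult.left_commute)

lemma conv_add_left: "conv_kernel k \<Longrightarrow> conv_kernel l \<Longrightarrow> f \<in> L2 \<Longrightarrow> conv (\<lambda>x. k x + l x) f x = conv k f x + conv l f x"
  unfolding conv_def by (simp add: scaleR_add_left conv_integrable)

lemma conv_cmult_left: "conv (\<lambda>x. c * k x) f x = of_real c * conv k f x"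
  unfolding conv_def by (simp add: scaleR_scaleR[symmetric] del: scaleR_scaleR) (simp add: scaleR_conv_of_real)

lemma conv_sum_left:
  "(\<And>i. i \<in> I \<Longrightarrow> conv_kernel (k i)) \<Longrightarrow> f \<in> L2 \<Longrightarrow> conv (\<lambda>x. \<Sum>i\<in>I. k i x) f x = (\<Sum>i\<in>I. conv (k i) f x)"
  unfolding conv_def by (simp add: scaleR_left.sum conv_integrable)

section \<open>Adjoints, compositions and tensor products of kernels\<close>

lemma L2_norm_fun: "f \<in> L2 \<Longrightarrow> (\<lambda>x. complex_of_real (norm (f x))) \<in> L2"
  by (auto simp: L2_iff)

lemma conv_abs_norm:
  "conv (\<lambda>y. \<bar>k y\<bar>) (\<lambda>x. complex_of_real (norm (f x))) x
    = complex_of_real (\<integral>y. norm (k (x - y) *\<^sub>R f y) \<partial>lborel)"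
  unfolding conv_def by (subst integral_complex_of_real[symmetric]) (simp add: scaleR_conv_of_real)

text \<open>The integral of the norm is again a convolution, with nonnegative data, and so lies in
  \<open>L2\<close>. This supplies the absolute integrability required by Fubini in
  \<open>conv_conv\<close> and \<open>ip_conv_left\<close>.\<close>

lemma conv_abs_L2:
  assumes "conv_kernel k" "f \<in> L2"
  shows "(\<lambda>x. complex_of_real (\<integral>y. norm (k (x - y) *\<^sub>R f y) \<partial>lborel)) \<in> L2"
proof -
  have "conv (\<lambda>y. \<bar>k y\<bar>) (\<lambda>x. complex_of_real (norm (f x)))
      = (\<lambda>x. complex_of_real (\<integral>y. norm (k (x - y) *\<^sub>R f y) \<partial>lborel))"
    by (rule ext) (rule conv_abs_norm)
  then show ?thesis
    using conv_L2[OF kernel_abs[OF assms(1)] L2_norm_fun[OF assms(2)]] by simp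
qed

definition kconv :: "(real^'n \<Rightarrow> real) \<Rightarrow> (real^'n \<Rightarrow> real) \<Rightarrow> real^'n \<Rightarrow> real" where
  "kconv k l x = (\<integral>y. k (x - y) * l y \<partial>lborel)"

lemma conv_conv:
  assumes k: "conv_kernel k" and l: "conv_kernel l" and f: "f \<in> L2"
  shows "conv k (conv l f) x = conv (kconv k l) f x"
proof -
  note [measurable] = kernel_measurable[OF k] kernel_measurable[OF l] L2_measurable[OF f]
  have "integrable (lborel \<Otimes>\<^sub>M lborel) (\<lambda>(y, z). k (x - y) *\<^sub>R l (y - z) *\<^sub>R f z)"
  proof (rule lborel_pair.Fubini_integrable)
    have "integrable lborel (\<lambda>y. \<bar>k (x - y)\<bar> *\<^sub>R complex_of_real (\<integral>z. norm (l (y - z) *\<^sub>R f z) \<partial>lborel))"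
      by (rule conv_integrable[OF kernel_abs[OF k] conv_abs_L2[OF l f]])
    from integrable_norm[OF this]
    show "integrable lborel (\<lambda>y. \<integral>z. norm (case (y, z) of (y, z) \<Rightarrow> k (x - y) *\<^sub>R l (y - z) *\<^sub>R f z) \<partial>lborel)"
      by (simp add: integral_nonneg_AE abs_mult mult.assoc)
    show "AE y in lborel. integrable lborel (\<lambda>z. case (y, z) of (y, z) \<Rightarrow> k (x - y) *\<^sub>R l (y - z) *\<^sub>R f z)"
      by (auto simp only: prod.case intro!: AE_I2 integrable_scaleR_right conv_integrable[OF l f])
  qed measurable
  from lborel_pair.Fubini_integral[OF this]
  have "(\<integral>y. (\<integral>z. k (x - y) *\<^sub>R l (y - z) *\<^sub>R f z \<partial>lborel) \<partial>lborel)
      = (\<integral>z. (\<integral>y. k (x - y) *\<^sub>R l (y - z) *\<^sub>R f z \<partial>lborel) \<partial>lborel)" by simp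
  moreover have "(\<integral>y. k (x - y) *\<^sub>R l (y - z) *\<^sub>R f z \<partial>lborel) = kconv k l (x - z) *\<^sub>R f z" for z
  proof -
    have "integrable lborel (\<lambda>y. k (x - z - y) * l y)"
      using kernel_mult_integrable[OF kernel_reflect[OF k, of "x - z"], of l] l by (simp add: conv_kernel_def)
    then have i: "integrable lborel (\<lambda>y. k (x - y) * l (y - z))"
      by (subst (asm) lborel_distr_plus[of "-z", symmetric]) (simp add: integrable_distr_eq algebra_simps)
    have "kconv k l (x - z) = (\<integral>y. k (x - y) * l (y - z) \<partial>lborel)"
      unfolding kconv_def by (subst lborel_distr_plus[of "-z", symmetric]) (simp add: integral_distr algebra_simps)
    then show ?thesis using i by simp
  qed
  moreover have "conv k (conv l f) x = (\<integral>y. (\<integral>z. k (x - y) *\<^sub>R l (y - z) *\<^sub>R f z \<partial>lborel) \<partial>lborel)"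
    by (simp only: conv_def integral_scaleR_right conv_integrable[OF l f])
  ultimately show ?thesis by (simp only: conv_def)
qed

text \<open>Fubini moves the kernel to the other side, where its argument changes sign; kernels are
  real, so no conjugate appears. Combined with \<open>conv_conv\<close>, an inner product of two
  smoothed functions becomes one with a single composed kernel, and identities between kernels are
  then all that has to be checked.\<close>

lemma ip_conv_left:
  assumes k: "conv_kernel k" and f: "f \<in> L2" and g: "g \<in> L2"
  shows "ip (conv k f) g = ip f (conv (\<lambda>x. k (- x)) g)"
proof -
  note [measurable] = kernel_measurable[OF k] L2_measurable[OF f] L2_measurable[OF g]
  have "integrable (lborel \<Otimes>\<^sub>M lborel) (\<lambda>(x, y). k (x - y) *\<^sub>R f y * cnj (g x))"
  proof (rule lborel_pair.Fubini_integrable)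
    have "norm (complex_of_real (\<integral>y. norm (k (x - y) *\<^sub>R f y) \<partial>lborel) * g x)
        = (\<integral>y. norm (k (x - y) *\<^sub>R f y * cnj (g x)) \<partial>lborel)" for x
      by (simp add: norm_mult integral_nonneg_AE mult.assoc[symmetric])
    with integrable_norm[OF L2_mult_integrable[OF conv_abs_L2[OF k f] g]]
    show "integrable lborel (\<lambda>x. \<integral>y. norm (case (x, y) of (x, y) \<Rightarrow> k (x - y) *\<^sub>R f y * cnj (g x)) \<partial>lborel)"
      by simp
    show "AE x in lborel. integrable lborel (\<lambda>y. case (x, y) of (x, y) \<Rightarrow> k (x - y) *\<^sub>R f y * cnj (g x))"
      by (auto simp only: prod.case intro!: AE_I2 integrable_mult_left conv_integrable[OF k f])
  qed (use borel_measurable_continuous_onI[of cnj] in \<open>measurable\<close>)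
  from lborel_pair.Fubini_integral[OF this]
  have "ip (conv k f) g = (\<integral>y. (\<integral>x. k (x - y) *\<^sub>R f y * cnj (g x) \<partial>lborel) \<partial>lborel)"
    by (simp only: ip_def conv_def integral_mult_left_zero)
  also have "\<dots> = (\<integral>y. f y * cnj (\<integral>x. k (- (y - x)) *\<^sub>R g x \<partial>lborel) \<partial>lborel)"
    by (simp add: scaleR_conv_of_real mult.left_commute mult.assoc flip: Bochner_Integration.integral_cnj integral_mult_right_zero)
  finally show ?thesis by (simp add: ip_def conv_def)
qed

lemma ip_conv_conv:
  assumes "conv_kernel k" "conv_kernel l" "f \<in> L2" "g \<in> L2"
  shows "ip (conv k f) (conv l g) = ip f (conv (kconv (\<lambda>x. k (- x)) l) g)"
proof -
  have k: "conv_kernel (\<lambda>x. k (- x))" using kernel_reflect[OF assms(1), of 0] by simp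
  have "conv (\<lambda>x. k (- x)) (conv l g) = conv (kconv (\<lambda>x. k (- x)) l) g"
    by (rule ext) (rule conv_conv[OF k assms(2,4)])
  then show ?thesis using assms by (simp add: ip_conv_left conv_L2)
qed

section \<open>Kernels that are products of one-variable functions\<close>

definition tensor :: "('n::finite \<Rightarrow> real \<Rightarrow> real) \<Rightarrow> real^'n \<Rightarrow> real" where
  "tensor h x = (\<Prod>i\<in>UNIV. h i (x $ i))"

text \<open>\<open>lborel\<close> is the image of a product measure indexed by \<open>Basis\<close>,
  while \<open>tensor\<close> is indexed by the coordinate type; \<open>ax\<close> translates
  between the two index sets.\<close>

lemma tensor_integral:
  fixes h :: "'n::finite \<Rightarrow> real \<Rightarrow> real"
  assumes h: "\<And>i. integrable lborel (h i)"
  shows integrable_tensor: "integrable lborel (tensor h)"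
    and integral_tensor: "(\<integral>x. tensor h x \<partial>lborel) = (\<Prod>i\<in>UNIV. \<integral>t. h i t \<partial>lborel)"
proof -
  define ax :: "'n \<Rightarrow> real^'n" where "ax i = axis i 1" for i
  define g where "g b = h (the_inv ax b)" for b
  have Basis: "(Basis::(real^'n) set) = range ax" by (auto simp: Basis_vec_def ax_def)
  have inj: "inj ax" by (auto simp: inj_on_def axis_eq_axis ax_def)
  have g_ax: "g (ax i) = h i" for i by (simp add: g_def the_inv_f_f[OF inj])
  have prod_ax: "(\<Prod>b\<in>Basis. F b) = (\<Prod>i\<in>UNIV. F (ax i))" for F :: "real^'n \<Rightarrow> real"
    unfolding Basis by (simp add: prod.reindex[OF inj])
  have tensor: "tensor h x = (\<Prod>b\<in>Basis. g b (x \<bullet> b))" for x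
    unfolding tensor_def prod_ax g_ax by (simp add: ax_def inner_axis)
  have g: "integrable lborel (g b)" for b unfolding g_def by (rule h)
  interpret product_sigma_finite "\<lambda>_::real^'n. lborel :: real measure" ..
  have [measurable]: "tensor h \<in> borel_measurable borel"
    using borel_measurable_integrable[OF g] unfolding tensor[abs_def] by measurable
  have distr: "tensor h (\<Sum>b\<in>Basis. f b *\<^sub>R b) = (\<Prod>b\<in>Basis. g b (f b))" for f
    unfolding tensor by (intro prod.cong refl) simp
  show "integrable lborel (tensor h)"
    by (subst lborel_eq) (simp add: integrable_distr_eq distr product_integrable_prod g)
  show "(\<integral>x. tensor h x \<partial>lborel) = (\<Prod>i\<in>UNIV. \<integral>t. h i t \<partial>lborel)"
    by (subst lborel_eq) (simp add: integral_distr distr product_integral_prod g, simp add: prod_ax g_ax)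
qed

lemma kernel_tensor:
  fixes h :: "'n::finite \<Rightarrow> real \<Rightarrow> real"
  assumes "\<And>i. integrable lborel (h i)" "\<And>i t. \<bar>h i t\<bar> \<le> B"
  shows "conv_kernel (tensor h)"
proof -
  have "(\<Prod>i\<in>UNIV. \<bar>h i (x $ i)\<bar>) \<le> (\<Prod>i\<in>(UNIV::'n set). B)" for x
    using assms(2) by (intro prod_mono) auto
  then have "\<bar>tensor h x\<bar> \<le> B ^ CARD('n)" for x
    by (simp add: tensor_def abs_prod)
  then have "bounded (range (tensor h))" unfolding bounded_iff by (intro exI[of _ "B ^ CARD('n)"]) simp
  then show ?thesis using integrable_tensor[of h] assms(1) by (simp add: conv_kernel_def)
qed

lemma kconv_tensor:
  fixes h g :: "'n::finite \<Rightarrow> real \<Rightarrow> real"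
  assumes "\<And>i t. integrable lborel (\<lambda>s. h i (t - s) * g i s)"
  shows "kconv (tensor h) (tensor g) = tensor (\<lambda>i t. \<integral>s. h i (t - s) * g i s \<partial>lborel)"
proof
  fix x :: "real^'n"
  have "tensor h (x - y) * tensor g y = tensor (\<lambda>i s. h i (x $ i - s) * g i s) y" for y
    by (simp add: tensor_def prod.distrib)
  then show "kconv (tensor h) (tensor g) x = tensor (\<lambda>i t. \<integral>s. h i (t - s) * g i s \<partial>lborel) x"
    unfolding kconv_def by (simp only: integral_tensor[OF assms]) (simp add: tensor_def)
qed

lemma has_derivative_tensor:
  fixes h :: "'n::finite \<Rightarrow> real \<Rightarrow> real"
  assumes "\<And>i t. (h i has_real_derivative h' i t) (at t)"
  shows "(tensor h has_derivative (\<lambda>y. \<Sum>i\<in>UNIV. h' i (x $ i) * (y $ i) * (\<Prod>j\<in>UNIV - {i}. h j (x $ j)))) (at x)"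
  unfolding tensor_def[abs_def]
proof (rule has_derivative_prod)
  fix i :: 'n
  have "((\<lambda>x::real^'n. x $ i) has_derivative (\<lambda>y. y $ i)) (at x)"
    by (rule bounded_linear_imp_has_derivative[OF bounded_linear_vec_nth])
  from has_derivative_compose[OF this assms[of i, unfolded has_field_derivative_def]]
  show "((\<lambda>x. h i (x $ i)) has_derivative (\<lambda>y. h' i (x $ i) * (y $ i))) (at x)" .
qed

section \<open>One-dimensional Gaussians\<close>

text \<open>The heat kernel at time \<open>r\<close>, normalised for the equation without a factor
  1/2 (variance \<open>2 * r\<close>), together with its first two derivatives in \<open>t\<close>.
  The order is a parameter so that multi-indices can select it coordinatewise; every
  \<open>p\<close> above 2 falls back on the formula for the second derivative.\<close>

definition gauss :: "real \<Rightarrow> nat \<Rightarrow> real \<Rightarrow> real" where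
  "gauss r p t = (if p = 0 then 1 else if p = 1 then - t / (2 * r) else t\<^sup>2 / (4 * r\<^sup>2) - 1 / (2 * r)) *
     (exp (- t\<^sup>2 / (4 * r)) / sqrt (4 * pi * r))"

lemma gauss_normal_density: "r > 0 \<Longrightarrow> gauss r 0 t = normal_density 0 (sqrt (2 * r)) t"
  by (simp add: gauss_def normal_density_def)

lemma gauss_pos: "r > 0 \<Longrightarrow> 0 < gauss r 0 t"
  by (simp add: gauss_def)

lemma gauss_measurable [measurable]: "gauss r p \<in> borel_measurable borel"
  unfolding gauss_def[abs_def] by measurable

lemma continuous_gauss: "r > 0 \<Longrightarrow> continuous_on A (gauss r p)"
  unfolding gauss_def[abs_def] by (cases "p = 0"; cases "p = 1") (auto intro!: continuous_intros)

lemma gauss_reflect: "p \<le> 2 \<Longrightarrow> gauss r p (- t) = (-1) ^ p * gauss r p t"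
  by (auto simp: gauss_def numeral_2_eq_2 le_Suc_eq)

lemma gauss_1: "gauss r 1 t = - t / (2 * r) * gauss r 0 t"
  and gauss_2: "gauss r 2 t = (t\<^sup>2 / (4 * r\<^sup>2) - 1 / (2 * r)) * gauss r 0 t"
  by (simp_all add: gauss_def)

lemma DERIV_gauss_0:
  assumes "r > 0" shows "(gauss r 0 has_real_derivative gauss r 1 t) (at t)"
proof -
  have "((\<lambda>t. exp (- t\<^sup>2 / (4 * r)) / sqrt (4 * pi * r)) has_real_derivative
      (exp (- t\<^sup>2 / (4 * r)) * (- (2 * t) / (4 * r))) / sqrt (4 * pi * r)) (at t)"
    using assms by (intro DERIV_cdivide DERIV_fun_exp) (auto intro!: derivative_eq_intros)
  then show ?thesis unfolding gauss_1 unfolding gauss_def[abs_def] by (simp add: mult.commute)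
qed

lemma DERIV_gauss:
  assumes "r > 0" "p \<le> 1"
  shows "(gauss r p has_real_derivative gauss r (Suc p) t) (at t)"
proof (cases "p = 0")
  case True
  then show ?thesis using DERIV_gauss_0[OF assms(1), of t] by simp
next
  case False
  then have p: "p = 1" "Suc p = 2" using assms(2) by auto
  have "((\<lambda>t. - t / (2 * r) * gauss r 0 t) has_real_derivative
      (- 1 / (2 * r)) * gauss r 0 t + gauss r 1 t * (- t / (2 * r))) (at t)"
    using assms(1) by (intro DERIV_mult DERIV_gauss_0) (auto intro!: derivative_eq_intros)
  moreover have "(- 1 / (2 * r)) * gauss r 0 t + gauss r 1 t * (- t / (2 * r)) = gauss r 2 t"
    unfolding gauss_1 gauss_2 by (simp add: power2_eq_square algebra_simps)
  ultimately show ?thesis unfolding p(2) unfolding p(1) gauss_1[abs_def] by (simp only:)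
qed

text \<open>The one-dimensional heat equation: the time derivative is the second spatial
  derivative.\<close>

lemma DERIV_gauss_time:
  assumes "r > 0"
  shows "((\<lambda>r. gauss r 0 t) has_real_derivative gauss r 2 t) (at r)"
proof -
  define E S where "E = exp (- t\<^sup>2 / (4 * r))" and "S = sqrt (4 * pi * r)"
  have S: "S > 0" "S * S = 4 * pi * r" using assms by (auto simp: S_def)
  have "((\<lambda>r. - t\<^sup>2 / (4 * r)) has_real_derivative t\<^sup>2 / (4 * r\<^sup>2)) (at r)"
    using assms by (auto intro!: derivative_eq_intros simp: power2_eq_square)
  then have "((\<lambda>r. exp (- t\<^sup>2 / (4 * r))) has_real_derivative E * (t\<^sup>2 / (4 * r\<^sup>2))) (at r)"
    unfolding E_def by (rule DERIV_fun_exp)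
  moreover have "((\<lambda>r. 4 * pi * r) has_real_derivative 4 * pi) (at r)"
    by (auto intro!: derivative_eq_intros)
  then have "((\<lambda>r. sqrt (4 * pi * r)) has_real_derivative (inverse S / 2) * (4 * pi)) (at r)"
    unfolding S_def by (rule DERIV_chain2[OF DERIV_real_sqrt, rotated]) (use assms in simp)
  ultimately have "((\<lambda>r. exp (- t\<^sup>2 / (4 * r)) / sqrt (4 * pi * r)) has_real_derivative
      (E * (t\<^sup>2 / (4 * r\<^sup>2)) * S - E * ((inverse S / 2) * (4 * pi))) / (S * S)) (at r)"
    using S(1) unfolding E_def S_def by (intro DERIV_divide) auto
  moreover have "(E * (t\<^sup>2 / (4 * r\<^sup>2)) * S - E * ((inverse S / 2) * (4 * pi))) / (S * S)
      = E / S * (t\<^sup>2 / (4 * r\<^sup>2)) - E / S * (2 * pi / (S * S))"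
    using S(1) by (simp add: divide_simps)
  moreover have "2 * pi / (S * S) = 1 / (2 * r)" unfolding S using assms by (simp add: field_simps)
  moreover have "gauss r 2 t = E / S * (t\<^sup>2 / (4 * r\<^sup>2)) - E / S * (1 / (2 * r))"
  proof -
    have "gauss r 0 t = E / S" by (simp add: gauss_def E_def S_def)
    then show ?thesis unfolding gauss_2 by (simp add: algebra_simps)
  qed
  moreover have "(\<lambda>r. gauss r 0 t) = (\<lambda>r. exp (- t\<^sup>2 / (4 * r)) / sqrt (4 * pi * r))"
    by (simp add: gauss_def)
  ultimately show ?thesis by (simp only:)
qed

lemma integrable_gauss_0: "r > 0 \<Longrightarrow> integrable lborel (gauss r 0)"
  and integral_gauss_0: "r > 0 \<Longrightarrow> (\<integral>t. gauss r 0 t \<partial>lborel) = 1"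
  using integrable_normal_density[of "sqrt (2 * r)" 0] integral_normal_density[of "sqrt (2 * r)" 0]
  by (simp_all cong: integral_cong Bochner_Integration.integrable_cong add: gauss_normal_density)

text \<open>The polynomial factors are absorbed by widening the Gaussian.\<close>

lemma gauss_bound:
  assumes r0: "r0 > 0"
  obtains C where "C > 0" "\<And>r p t. r0 / 2 \<le> r \<Longrightarrow> r \<le> 2 * r0 \<Longrightarrow> \<bar>gauss r p t\<bar> \<le> C * gauss (4 * r0) 0 t"
proof
  \<comment> \<open>The sum 17 + 17 / \<open>r0\<close> adds \<open>1 + 1 / r0\<close> and
    \<open>16 + 16 / r0\<close> from the polynomial factor. The first square root is the
    normalisation at the smallest admissible time \<open>r0 / 2\<close>, the second that of
    \<open>gauss (4 * r0)\<close>.\<close>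
  define C where "C = (17 + 17 / r0) / sqrt (2 * pi * r0) * sqrt (16 * pi * r0)"
  show "C > 0" using r0 by (simp add: C_def add_pos_pos)
  fix r :: real and p :: nat and t :: real assume r: "r0 / 2 \<le> r" "r \<le> 2 * r0"
  then have "r > 0" using r0 by linarith
  \<comment> \<open>\<open>exp (- y)\<close> is the exponential of \<open>gauss (4 * r0)\<close>.
    For \<open>r \<le> 2 * r0\<close> the Gaussian decays at least like
    \<open>exp (- 2 * y)\<close>; one factor \<open>exp (- y)\<close> pays for the polynomial, the
    other remains.\<close>
  define y where "y = t\<^sup>2 / (16 * r0)"
  have y: "0 \<le> y" "y \<le> exp y" "1 \<le> exp y" "t\<^sup>2 = 16 * r0 * y"
    using r0 exp_ge_add_one_self[of y] by (auto simp: y_def intro: order_trans[OF _ exp_ge_add_one_self])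
  have "\<bar>if p = 0 then 1 else if p = 1 then - t / (2 * r) else t\<^sup>2 / (4 * r\<^sup>2) - 1 / (2 * r)\<bar>
      \<le> 1 + 1 / r0 + t\<^sup>2 * (1 / r0 + 1 / r0\<^sup>2)" (is "\<bar>?q\<bar> \<le> ?P")
  proof -
    have a: "1 / (2 * r) \<le> 1 / r0" using r r0 by (intro divide_left_mono) auto
    have "r0\<^sup>2 \<le> (2 * r)\<^sup>2" by (rule power_mono) (use r r0 in auto)
    then have b: "t\<^sup>2 / (4 * r\<^sup>2) \<le> t\<^sup>2 / r0\<^sup>2"
      using r0 \<open>r > 0\<close> by (intro divide_left_mono) (auto simp: power_mult_distrib)
    have "2 * \<bar>t\<bar> \<le> 1 + t\<^sup>2" using sum_squares_bound[of 1 "\<bar>t\<bar>"] by simp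
    then have "\<bar>t\<bar> \<le> 1 + t\<^sup>2" by linarith
    then have c: "\<bar>t\<bar> * (1 / (2 * r)) \<le> (1 + t\<^sup>2) * (1 / r0)"
      using a \<open>r > 0\<close> by (intro mult_mono) auto
    have d: "0 \<le> t\<^sup>2 / r0" "0 \<le> t\<^sup>2 / r0\<^sup>2" "0 \<le> 1 / r0" "0 \<le> 1 / (2 * r)" "0 \<le> t\<^sup>2 / (4 * r\<^sup>2)"
      using r0 \<open>r > 0\<close> by auto
    have P: "?P = 1 + 1 / r0 + t\<^sup>2 / r0 + t\<^sup>2 / r0\<^sup>2" by (simp add: algebra_simps)
    consider "p = 0" | "p = 1" | "p \<noteq> 0 \<and> p \<noteq> 1" by blast
    then show ?thesis
    proof cases
      case 1 then show ?thesis unfolding P using d by simp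
    next
      case 2
      have "(1 + t\<^sup>2) * (1 / r0) = 1 / r0 + t\<^sup>2 / r0" by (simp add: algebra_simps add_divide_distrib)
      moreover have "\<bar>t\<bar> / (2 * r) = \<bar>t\<bar> * (1 / (2 * r))" by simp
      ultimately have "\<bar>t\<bar> / (2 * r) \<le> 1 + 1 / r0 + t\<^sup>2 / r0 + t\<^sup>2 / r0\<^sup>2" using c d by linarith
      moreover have "\<bar>?q\<bar> = \<bar>t\<bar> / (2 * r)" using 2 \<open>r > 0\<close> by simp
      ultimately show ?thesis unfolding P by linarith
    next
      case 3
      then have "?q = t\<^sup>2 / (4 * r\<^sup>2) - 1 / (2 * r)" by simp
      then show ?thesis unfolding P using a b d by linarith
    qed
  qed
  also have "?P = 1 + 1 / r0 + (16 + 16 / r0) * y"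
    unfolding y(4) using r0 by (simp add: power2_eq_square field_simps)
  also have "\<dots> \<le> (1 + 1 / r0) * exp y + (16 + 16 / r0) * exp y"
    using r0 mult_left_mono[OF y(3), of "1 + 1 / r0"] mult_left_mono[OF y(2), of "16 + 16 / r0"] by simp
  also have "\<dots> = (17 + 17 / r0) * exp y" by (simp add: algebra_simps)
  finally have q: "\<bar>?q\<bar> \<le> (17 + 17 / r0) * exp y" .
  have "t\<^sup>2 / (8 * r0) \<le> t\<^sup>2 / (4 * r)"
    using r \<open>r > 0\<close> by (intro divide_left_mono) auto
  then have e: "exp (- t\<^sup>2 / (4 * r)) \<le> exp (- 2 * y)" by (simp add: y_def)
  have s: "exp (- t\<^sup>2 / (4 * r)) / sqrt (4 * pi * r) \<le> exp (- 2 * y) / sqrt (2 * pi * r0)"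
    using r r0 by (intro frac_le e) auto
  have "\<bar>gauss r p t\<bar> = \<bar>?q\<bar> * (exp (- t\<^sup>2 / (4 * r)) / sqrt (4 * pi * r))"
    unfolding gauss_def abs_mult using \<open>r > 0\<close> by simp
  also have "\<dots> \<le> ((17 + 17 / r0) * exp y) * (exp (- 2 * y) / sqrt (2 * pi * r0))"
    by (intro mult_mono q s) (use r0 \<open>r > 0\<close> in auto)
  also have "\<dots> = (17 + 17 / r0) / sqrt (2 * pi * r0) * (exp y * exp (- 2 * y))" by simp
  also have "exp y * exp (- 2 * y) = exp (- y)" by (simp flip: exp_add)
  also have "(17 + 17 / r0) / sqrt (2 * pi * r0) * exp (- y) = C * gauss (4 * r0) 0 t"
  proof -
    have "gauss (4 * r0) 0 t = exp (- y) / sqrt (16 * pi * r0)"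
      by (simp add: gauss_def y_def mult.assoc mult.left_commute)
    moreover have "sqrt (16 * pi * r0) \<noteq> 0" using r0 by simp
    ultimately show ?thesis by (simp add: C_def)
  qed
  finally show "\<bar>gauss r p t\<bar> \<le> C * gauss (4 * r0) 0 t" .
qed

lemma integrable_gauss: assumes "r > 0" shows "integrable lborel (gauss r p)"
proof -
  obtain C where C: "\<And>r' p t. r / 2 \<le> r' \<Longrightarrow> r' \<le> 2 * r \<Longrightarrow> \<bar>gauss r' p t\<bar> \<le> C * gauss (4 * r) 0 t"
    using gauss_bound[OF assms] by metis
  show ?thesis
  proof (rule Bochner_Integration.integrable_bound)
    show "integrable lborel (\<lambda>t. C * gauss (4 * r) 0 t)" using integrable_gauss_0[of "4 * r"] assms by simp
    show "AE t in lborel. norm (gauss r p t) \<le> norm (C * gauss (4 * r) 0 t)"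
      using C[of r p] assms by (auto intro: order_trans[OF _ abs_ge_self])
  qed simp
qed

lemma gauss_0_le: "r > 0 \<Longrightarrow> gauss r 0 t \<le> 1 / sqrt (4 * pi * r)"
  by (simp add: gauss_def divide_right_mono)

lemma gauss_bounded: assumes "r > 0" obtains B where "\<And>p t. \<bar>gauss r p t\<bar> \<le> B"
proof -
  obtain C where "C > 0" and C: "\<And>r' p t. r / 2 \<le> r' \<Longrightarrow> r' \<le> 2 * r \<Longrightarrow> \<bar>gauss r' p t\<bar> \<le> C * gauss (4 * r) 0 t"
    using gauss_bound[OF assms] by metis
  have "\<bar>gauss r p t\<bar> \<le> C * (1 / sqrt (4 * pi * (4 * r)))" for p t
    using C[of r p t] mult_left_mono[OF gauss_0_le[of "4 * r" t], of C] \<open>C > 0\<close> assms by simp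
  then show ?thesis by (rule that)
qed

lemma gauss_mult_integrable:
  assumes "r > 0" "s > 0" shows "integrable lborel (\<lambda>t. gauss r p (x - t) * gauss s q t)"
proof -
  obtain B where B: "\<And>p t. \<bar>gauss r p t\<bar> \<le> B" using gauss_bounded[OF assms(1)] by metis
  show ?thesis
  proof (rule Bochner_Integration.integrable_bound)
    show "integrable lborel (\<lambda>t. B * gauss s q t)" using integrable_gauss[OF assms(2)] by simp
    have "\<bar>gauss r p (x - t) * gauss s q t\<bar> \<le> \<bar>B * gauss s q t\<bar>" for t
      unfolding abs_mult by (intro mult_right_mono order_trans[OF B abs_ge_self]) auto
    then show "AE t in lborel. norm (gauss r p (x - t) * gauss s q t) \<le> norm (B * gauss s q t)" by simp
  qed simp
qed

lemma integral_derivative_vanishing: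
  fixes F f :: "real \<Rightarrow> real"
  assumes "\<And>x. (F has_real_derivative f x) (at x)" "continuous_on UNIV f" "integrable lborel f"
    "(F \<longlongrightarrow> 0) at_top" "(F \<longlongrightarrow> 0) at_bot"
  shows "(\<integral>x. f x \<partial>lborel) = 0"
proof -
  have "(LBINT x=-\<infinity>..\<infinity>. f x) = 0 - 0"
  proof (rule interval_integral_FTC_integrable)
    show "(F has_vector_derivative f x) (at x)" for x
      using assms(1) by (simp add: has_real_derivative_iff_has_vector_derivative)
    show "isCont f x" for x using assms(2) by (simp add: continuous_on_eq_continuous_at)
    show "set_integrable lborel (einterval (- \<infinity>) \<infinity>) f" using assms(3) by (simp add: set_integrable_def)
    show "((F \<circ> real_of_ereal) \<longlongrightarrow> 0) (at_right (- \<infinity>))" "((F \<circ> real_of_ereal) \<longlongrightarrow> 0) (at_left \<infinity>)"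
      using assms(4,5) by (simp_all add: ereal_tendsto_simps)
  qed simp
  then show ?thesis by (simp add: interval_lebesgue_integral_def set_lebesgue_integral_def)
qed

lemma gauss_0_tendsto:
  assumes "r > 0" shows "(gauss r 0 \<longlongrightarrow> 0) at_top" "(gauss r 0 \<longlongrightarrow> 0) at_bot"
  unfolding gauss_def[abs_def] using assms by simp_all real_asymp+

text \<open>Integration by parts: \<open>f\<close> is the derivative of the product
  \<open>F\<close>, which vanishes at both ends, so the integral of \<open>f\<close> is 0. It moves
  one derivative from one factor of a convolution to the other.\<close>

lemma gauss_conv_shift:
  assumes r: "r > 0" and q: "q \<le> 1"
  shows "(\<integral>t. gauss r 1 (x - t) * gauss r q t \<partial>lborel) = (\<integral>t. gauss r 0 (x - t) * gauss r (Suc q) t \<partial>lborel)"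
proof -
  obtain C where C: "\<And>r' p t. r / 2 \<le> r' \<Longrightarrow> r' \<le> 2 * r \<Longrightarrow> \<bar>gauss r' p t\<bar> \<le> C * gauss (4 * r) 0 t"
    using gauss_bound[OF r] by metis
  define F where "F t = gauss r 0 (x - t) * gauss r q t" for t
  define f where "f t = gauss r 0 (x - t) * gauss r (Suc q) t - gauss r 1 (x - t) * gauss r q t" for t
  have "(\<integral>t. f t \<partial>lborel) = 0"
  proof (rule integral_derivative_vanishing)
    show "(F has_real_derivative f t) (at t)" for t
    proof -
      have "((\<lambda>t. x - t) has_real_derivative - 1) (at t)" by (auto intro!: derivative_eq_intros)
      then have "((\<lambda>t. gauss r 0 (x - t)) has_real_derivative gauss r 1 (x - t) * - 1) (at t)"
        by (rule DERIV_chain2[OF DERIV_gauss_0[OF r]])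
      from DERIV_mult[OF this DERIV_gauss[OF r q, of t]] show ?thesis
        unfolding F_def f_def by (simp add: algebra_simps)
    qed
    show "continuous_on UNIV f"
      unfolding f_def
      by (intro continuous_intros continuous_on_compose2[OF continuous_gauss[OF r, of UNIV]] continuous_gauss r) auto
    show "integrable lborel f"
      unfolding f_def by (intro Bochner_Integration.integrable_diff gauss_mult_integrable r)
    have le: "norm (F t) \<le> 1 / sqrt (4 * pi * r) * C * gauss (4 * r) 0 t" for t
    proof -
      have "\<bar>gauss r 0 (x - t)\<bar> \<le> 1 / sqrt (4 * pi * r)"
        using gauss_0_le[OF r, of "x - t"] gauss_pos[OF r, of "x - t"] by linarith
      moreover have "\<bar>gauss r q t\<bar> \<le> C * gauss (4 * r) 0 t" by (rule C) (use r in auto)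
      ultimately show ?thesis
        unfolding F_def mult.assoc[of "1 / sqrt (4 * pi * r)"] real_norm_def abs_mult by (intro mult_mono) (use r in auto)
    qed
    have lim: "(F \<longlongrightarrow> 0) net" if "(gauss (4 * r) 0 \<longlongrightarrow> 0) net" for net
      by (rule Lim_null_comparison[OF always_eventually[OF allI[OF le]] tendsto_mult_right_zero[OF that]])
    show "(F \<longlongrightarrow> 0) at_top" "(F \<longlongrightarrow> 0) at_bot"
      by (rule lim, rule gauss_0_tendsto, use r in simp)+
  qed
  then show ?thesis unfolding f_def by (simp add: gauss_mult_integrable r)
qed

lemma gauss_conv_gauss:
  assumes "r > 0" "s > 0"
  shows "(\<integral>t. gauss r 0 (x - t) * gauss s 0 t \<partial>lborel) = gauss (r + s) 0 x"
proof -
  have "(\<integral>\<^sup>+t. ennreal (gauss r 0 (x - t) * gauss s 0 t) \<partial>lborel) = ennreal (gauss (r + s) 0 x)"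
    using fun_cong[OF conv_normal_density_zero_mean[of "sqrt (2 * r)" "sqrt (2 * s)"], of x] assms
    by (simp add: gauss_normal_density algebra_simps)
  then show ?thesis
    using assms gauss_pos[of "r + s" x]
    by (subst integral_eq_nn_integral) (auto intro!: AE_I2 mult_nonneg_nonneg less_imp_le[OF gauss_pos])
qed

section \<open>The heat kernel\<close>

text \<open>\<open>\<alpha>\<close> is the multi-index of a spatial derivative of the Gaussian, each
  entry being at most 2 in all uses that rely on this reading.\<close>

definition heat :: "real \<Rightarrow> ('n::finite \<Rightarrow> nat) \<Rightarrow> real^'n \<Rightarrow> real" where
  "heat r \<alpha> = tensor (\<lambda>i. gauss r (\<alpha> i))"

abbreviation ord0 :: "'n \<Rightarrow> nat" where "ord0 \<equiv> \<lambda>_. 0"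

definition ord1 :: "'n \<Rightarrow> 'n \<Rightarrow> nat" where "ord1 j = (\<lambda>i. if i = j then 1 else 0)"

definition ord2 :: "'n \<Rightarrow> 'n \<Rightarrow> 'n \<Rightarrow> nat" where "ord2 i j = (\<lambda>l. ord1 i l + ord1 j l)"

definition heat_lap :: "real \<Rightarrow> real^'n::finite \<Rightarrow> real" where
  "heat_lap r x = (\<Sum>j\<in>UNIV. heat r (ord2 j j) x)"

lemma ord1_le: "ord1 j i \<le> 1" by (simp add: ord1_def)

lemma kernel_heat: assumes "r > 0" shows "conv_kernel (heat r \<alpha>)"
proof -
  obtain B where "\<And>p t. \<bar>gauss r p t\<bar> \<le> B" using gauss_bounded[OF assms] by metis
  then show ?thesis unfolding heat_def by (intro kernel_tensor integrable_gauss assms)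
qed

lemma kernel_heat_lap: "r > 0 \<Longrightarrow> conv_kernel (heat_lap r)"
  unfolding heat_lap_def[abs_def] by (intro kernel_sum kernel_heat)

lemma heat_pos: "r > 0 \<Longrightarrow> 0 < heat r ord0 x"
  unfolding heat_def tensor_def by (intro prod_pos gauss_pos) auto

lemma integral_heat: "r > 0 \<Longrightarrow> (\<integral>x. heat r ord0 x \<partial>lborel) = 1"
  unfolding heat_def by (simp add: integral_tensor integrable_gauss integral_gauss_0)

lemma integral_abs_heat: "r > 0 \<Longrightarrow> (\<integral>x. \<bar>heat r ord0 (x::real^'n::finite)\<bar> \<partial>lborel) = 1"
proof -
  assume r: "r > 0"
  then have "(\<lambda>x::real^'n. \<bar>heat r ord0 x\<bar>) = heat r ord0" by (intro ext abs_of_pos heat_pos)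
  then show ?thesis using integral_heat[OF r] by simp
qed

lemma heat_reflect_0: "heat r ord0 (- x) = heat r ord0 x"
  by (simp add: heat_def tensor_def gauss_reflect)

lemma heat_reflect_1: "heat r (ord1 j) (- x) = - heat r (ord1 j) x"
proof -
  have "gauss r (ord1 j i) (- t) = (if i = j then - 1 else 1) * gauss r (ord1 j i) t" for i t
    by (simp add: ord1_def gauss_reflect)
  then show ?thesis by (simp add: heat_def tensor_def prod.distrib)
qed

lemma kconv_heat: "r > 0 \<Longrightarrow> s > 0 \<Longrightarrow> kconv (heat r ord0) (heat s ord0) = heat (r + s) ord0"
  unfolding heat_def by (simp add: kconv_tensor gauss_mult_integrable gauss_conv_gauss)

text \<open>Only coordinate \<open>i\<close> changes: there \<open>gauss_conv_shift\<close> moves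
  one derivative across the convolution. In all other coordinates the factors on both sides
  coincide.\<close>

lemma kconv_heat_shift:
  assumes "r > 0"
  shows "kconv (heat r ord0) (heat r (ord2 i j)) = kconv (heat r (ord1 i)) (heat r (ord1 j))"
proof -
  have "(\<integral>s. gauss r 0 (t - s) * gauss r (ord2 i j l) s \<partial>lborel)
      = (\<integral>s. gauss r (ord1 i l) (t - s) * gauss r (ord1 j l) s \<partial>lborel)" for l t
    using gauss_conv_shift[OF assms ord1_le, of t j l]
    by (cases "l = i") (simp_all add: ord2_def ord1_def[of i] plus_1_eq_Suc del: One_nat_def)
  then show ?thesis unfolding heat_def by (simp add: kconv_tensor gauss_mult_integrable assms)
qed

lemma heat_bound:
  assumes "r0 > 0"
  obtains C where "C > 0" "\<And>r (\<alpha>::'n::finite \<Rightarrow> nat) x. r0 / 2 \<le> r \<Longrightarrow> r \<le> 2 * r0 \<Longrightarrow> \<bar>heat r \<alpha> x\<bar> \<le> C * heat (4 * r0) ord0 x"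
proof -
  obtain C where C: "C > 0" "\<And>r p t. r0 / 2 \<le> r \<Longrightarrow> r \<le> 2 * r0 \<Longrightarrow> \<bar>gauss r p t\<bar> \<le> C * gauss (4 * r0) 0 t"
    using gauss_bound[OF assms] by metis
  have "\<bar>heat r \<alpha> x\<bar> \<le> C ^ CARD('n) * heat (4 * r0) ord0 x"
    if "r0 / 2 \<le> r" "r \<le> 2 * r0" for r and \<alpha> :: "'n \<Rightarrow> nat" and x
  proof -
    have "\<bar>heat r \<alpha> x\<bar> \<le> (\<Prod>i\<in>UNIV. C * gauss (4 * r0) 0 (x $ i))"
      unfolding heat_def tensor_def abs_prod using C(2)[OF that] by (intro prod_mono) auto
    then show ?thesis by (simp add: heat_def tensor_def prod.distrib)
  qed
  then show ?thesis using C(1) by (intro that[of "C ^ CARD('n)"]) auto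
qed

lemma heat_lap_bound:
  assumes "r0 > 0"
  obtains C where "C > 0" "\<And>r (x::real^'n::finite). r0 / 2 \<le> r \<Longrightarrow> r \<le> 2 * r0 \<Longrightarrow> \<bar>heat_lap r x\<bar> \<le> C * heat (4 * r0) ord0 x"
proof -
  obtain C where C: "C > 0" "\<And>r (\<alpha>::'n \<Rightarrow> nat) x. r0 / 2 \<le> r \<Longrightarrow> r \<le> 2 * r0 \<Longrightarrow> \<bar>heat r \<alpha> x\<bar> \<le> C * heat (4 * r0) ord0 x"
    using heat_bound[OF assms] by metis
  have "\<bar>heat_lap r x\<bar> \<le> (real CARD('n) * C) * heat (4 * r0) ord0 x"
    if "r0 / 2 \<le> r" "r \<le> 2 * r0" for r and x :: "real^'n"
  proof -
    have "\<bar>heat_lap r x\<bar> \<le> (\<Sum>j::'n\<in>UNIV. C * heat (4 * r0) ord0 x)"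
      unfolding heat_lap_def by (intro order_trans[OF sum_abs] sum_mono C that)
    then show ?thesis by simp
  qed
  then show ?thesis using C(1) by (intro that[of "real CARD('n) * C"]) auto
qed

lemma DERIV_heat_time:
  assumes "r > 0"
  shows "((\<lambda>r. heat r ord0 x) has_real_derivative heat_lap r x) (at r)"
proof -
  have "((\<lambda>r. \<Prod>i\<in>UNIV. gauss r 0 (x $ i)) has_derivative
      (\<lambda>h. \<Sum>i\<in>UNIV. gauss r 2 (x $ i) * h * (\<Prod>j\<in>UNIV - {i}. gauss r 0 (x $ j)))) (at r)"
    using DERIV_gauss_time[OF assms] unfolding has_field_derivative_def by (rule has_derivative_prod)
  moreover have "gauss r 2 (x $ i) * h * (\<Prod>j\<in>UNIV - {i}. gauss r 0 (x $ j)) = heat r (ord2 i i) x * h" for i h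
  proof -
    have "heat r (ord2 i i) x = gauss r 2 (x $ i) * (\<Prod>j\<in>UNIV - {i}. gauss r (ord2 i i j) (x $ j))"
      unfolding heat_def tensor_def by (subst prod.remove[of _ i]) (auto simp: ord2_def ord1_def numeral_2_eq_2)
    also have "(\<Prod>j\<in>UNIV - {i}. gauss r (ord2 i i j) (x $ j)) = (\<Prod>j\<in>UNIV - {i}. gauss r 0 (x $ j))"
      by (intro prod.cong) (auto simp: ord2_def ord1_def)
    finally show ?thesis by simp
  qed
  ultimately show ?thesis
    unfolding has_field_derivative_def heat_def[of _ ord0] tensor_def heat_lap_def
    by (simp add: sum_distrib_right[symmetric])
qed

text \<open>Convergence of the kernels in \<open>L1\<close> is the right notion, because
  \<open>conv_L2_norm_le\<close> turns it into convergence of the operators on \<open>L2\<close>.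
  The mean value theorem and \<open>heat_lap_bound\<close> give a majorant for the difference
  quotients, and dominated convergence applies along sequences.\<close>

lemma heat_L1_derivative:
  assumes r: "r > 0"
  shows "((\<lambda>s. \<integral>x. \<bar>(heat s ord0 x - heat r ord0 x) / (s - r) - heat_lap r (x::real^'n::finite)\<bar> \<partial>lborel) \<longlongrightarrow> 0) (at r)"
  unfolding tendsto_at_iff_sequentially comp_def
proof safe
  fix X :: "nat \<Rightarrow> real" assume X: "\<forall>i. X i \<in> UNIV - {r}" "X \<longlonglongrightarrow> r"
  obtain C where C: "C > 0" "\<And>s (x::real^'n). r / 2 \<le> s \<Longrightarrow> s \<le> 2 * r \<Longrightarrow> \<bar>heat_lap s x\<bar> \<le> C * heat (4 * r) ord0 x"
    using heat_lap_bound[OF r] by metis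
  have "eventually (\<lambda>i. X i \<in> {r/2<..<2*r}) sequentially"
    using X(2) by (rule topological_tendstoD) (use r in auto)
  then obtain N where N: "\<And>i. i \<ge> N \<Longrightarrow> r / 2 < X i \<and> X i < 2 * r"
    unfolding eventually_sequentially by auto
  \<comment> \<open>The shift by \<open>N\<close> puts all terms into the window between
    \<open>r / 2\<close> and \<open>2 * r\<close> where the majorant is valid;
    \<open>LIMSEQ_offset\<close> undoes it at the end.\<close>
  define Y where "Y i = X (i + N)" for i
  have Y: "r / 2 \<le> Y i" "Y i \<le> 2 * r" "Y i \<noteq> r" for i using N[of "i + N"] X(1) by (auto simp: Y_def)
  have Y_lim: "Y \<longlonglongrightarrow> r" unfolding Y_def by (rule LIMSEQ_ignore_initial_segment[OF X(2)])
  define q where "q i x = (heat (Y i) ord0 x - heat r ord0 x) / (Y i - r)" for i and x :: "real^'n"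
  have q_bound: "\<bar>q i x\<bar> \<le> C * heat (4 * r) ord0 x" for i x
  proof -
    have mvt: "\<exists>z. r / 2 \<le> z \<and> z \<le> 2 * r \<and> heat b ord0 x - heat a ord0 x = (b - a) * heat_lap z x"
      if "a < b" "r / 2 \<le> a" "b \<le> 2 * r" for a b
    proof -
      have "\<exists>z. a < z \<and> z < b \<and> heat b ord0 x - heat a ord0 x = (b - a) * heat_lap z x"
        by (rule MVT2[OF that(1)], rule DERIV_heat_time) (use that r in linarith)
      then show ?thesis using that by (meson less_eq_real_def order_trans)
    qed
    have "\<exists>z. r / 2 \<le> z \<and> z \<le> 2 * r \<and> q i x = heat_lap z x"
    proof (cases "r < Y i")
      case True
      from mvt[OF True] show ?thesis using Y[of i] r by (auto simp: q_def)
    next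
      case False
      then have "Y i < r" using Y(3)[of i] by linarith
      from mvt[OF this] obtain z where z: "r / 2 \<le> z" "z \<le> 2 * r"
        "heat r ord0 x - heat (Y i) ord0 x = (r - Y i) * heat_lap z x" using Y[of i] r by auto
      then have "heat (Y i) ord0 x - heat r ord0 x = (Y i - r) * heat_lap z x" by (simp add: algebra_simps)
      then have "q i x = heat_lap z x" using Y(3)[of i] by (simp add: q_def)
      then show ?thesis using z by blast
    qed
    then show ?thesis using C(2) by metis
  qed
  have [measurable]: "heat s \<alpha> \<in> borel_measurable borel" for s and \<alpha> :: "'n \<Rightarrow> nat"
    unfolding heat_def tensor_def[abs_def] by measurable
  have [measurable]: "(heat_lap s :: real^'n \<Rightarrow> real) \<in> borel_measurable borel" for s
    unfolding heat_lap_def[abs_def] by measurable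
  have "(\<lambda>i. \<integral>x. \<bar>q i x - heat_lap r x\<bar> \<partial>lborel) \<longlonglongrightarrow> (\<integral>x. 0 \<partial>(lborel :: (real^'n) measure))"
  proof (rule integral_dominated_convergence[where w="\<lambda>x. 2 * (C * heat (4 * r) ord0 x)"])
    show "integrable lborel (\<lambda>x::real^'n. 2 * (C * heat (4 * r) ord0 x))"
      using kernel_heat[of "4 * r" "ord0 :: 'n \<Rightarrow> nat"] r by (simp add: conv_kernel_def)
    show "AE x::real^'n in lborel. norm \<bar>q i x - heat_lap r x\<bar> \<le> 2 * (C * heat (4 * r) ord0 x)" for i
    proof (rule AE_I2)
      fix x :: "real^'n"
      show "norm \<bar>q i x - heat_lap r x\<bar> \<le> 2 * (C * heat (4 * r) ord0 x)"
        using q_bound[of i x] C(2)[of r x] r by simp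
    qed
    show "AE x::real^'n in lborel. (\<lambda>i. \<bar>q i x - heat_lap r x\<bar>) \<longlonglongrightarrow> 0"
    proof (rule AE_I2)
      fix x :: "real^'n"
      have "((\<lambda>s. (heat s ord0 x - heat r ord0 x) / (s - r)) \<longlongrightarrow> heat_lap r x) (at r)"
        using DERIV_heat_time[OF r, of x] by (simp add: has_field_derivative_iff)
      then have "(\<lambda>i. q i x) \<longlonglongrightarrow> heat_lap r x"
        unfolding q_def tendsto_at_iff_sequentially comp_def using Y(3) Y_lim by auto
      then show "(\<lambda>i. \<bar>q i x - heat_lap r x\<bar>) \<longlonglongrightarrow> 0"
        by (intro tendsto_rabs_zero) (simp add: LIM_zero)
    qed
  qed (simp_all add: q_def[abs_def])
  then have "(\<lambda>i. \<integral>x. \<bar>(heat (X (i + N)) ord0 x - heat r ord0 x) / (X (i + N) - r) - heat_lap r (x::real^'n)\<bar> \<partial>lborel) \<longlonglongrightarrow> 0"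
    by (simp add: q_def Y_def)
  then show "(\<lambda>i. \<integral>x. \<bar>(heat (X i) ord0 x - heat r ord0 x) / (X i - r) - heat_lap r (x::real^'n)\<bar> \<partial>lborel) \<longlonglongrightarrow> 0"
    by (rule LIMSEQ_offset)
qed

section \<open>Smoothing along a heat flow\<close>

text \<open>With \<open>q s\<close> the difference quotient, expanding the square of
  \<open>w t + (s - t) * q s\<close> leaves the error
  \<open>2 * Re (ip (\<lambda>x. q s x - w' x) (w t))\<close> plus a term of order
  \<open>s - t\<close>.\<close>

lemma norm_sq_has_derivative:
  assumes t: "t \<in> S" and w: "\<And>s. s \<in> S \<Longrightarrow> w s \<in> L2" and w': "w' \<in> L2"
    and lim: "((\<lambda>s. L2_norm (\<lambda>x. (w s x - w t x) / complex_of_real (s - t) - w' x)) \<longlongrightarrow> 0) (at t within S)"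
  shows "((\<lambda>s. (L2_norm (w s))\<^sup>2) has_real_derivative 2 * Re (ip w' (w t))) (at t within S)"
proof -
  define q where "q s = (\<lambda>x. (w s x - w t x) / complex_of_real (s - t))" for s
  define e where "e s = L2_norm (\<lambda>x. q s x - w' x)" for s
  have e_lim: "(e \<longlongrightarrow> 0) (at t within S)" unfolding e_def q_def by (rule lim)
  have le: "norm (((L2_norm (w s))\<^sup>2 - (L2_norm (w t))\<^sup>2) / (s - t) - 2 * Re (ip w' (w t)))
      \<le> 2 * (e s * L2_norm (w t)) + \<bar>s - t\<bar> * (e s + L2_norm w')\<^sup>2" if s: "s \<in> S" "s \<noteq> t" for s
  proof -
    have d: "(\<lambda>x. w s x - w t x) \<in> L2" using w s t by (intro L2_diff) auto
    have q: "q s \<in> L2" using L2_cmult[OF d, of "inverse (complex_of_real (s - t))"]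
      by (simp add: q_def divide_inverse mult.commute)
    have ws: "w s = (\<lambda>x. w t x + of_real (s - t) * q s x)" using s by (auto simp: q_def)
    have "(L2_norm (w s))\<^sup>2 = (L2_norm (w t))\<^sup>2 + 2 * Re (ip (w t) (\<lambda>x. of_real (s - t) * q s x))
        + (L2_norm (\<lambda>x. of_real (s - t) * q s x))\<^sup>2"
      by (subst ws) (intro L2_norm_sq_add w t L2_cmult q)
    also have "\<dots> = (L2_norm (w t))\<^sup>2 + (s - t) * (2 * Re (ip (q s) (w t)) + (s - t) * (L2_norm (q s))\<^sup>2)"
      unfolding ip_cmult_right L2_norm_cmult ip_commute[of "w t" "q s"] norm_of_real
        complex_cnj_complex_of_real power_mult_distrib power2_abs Re_complex_of_real
      by (simp add: power2_eq_square) (simp add: algebra_simps)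
    finally have "((L2_norm (w s))\<^sup>2 - (L2_norm (w t))\<^sup>2) / (s - t) = 2 * Re (ip (q s) (w t)) + (s - t) * (L2_norm (q s))\<^sup>2"
      using s by simp
    then have "((L2_norm (w s))\<^sup>2 - (L2_norm (w t))\<^sup>2) / (s - t) - 2 * Re (ip w' (w t))
       = 2 * Re (ip (\<lambda>x. q s x - w' x) (w t)) + (s - t) * (L2_norm (q s))\<^sup>2"
      using w[OF t] w' q by (simp add: ip_diff_left)
    also have "norm \<dots> \<le> 2 * norm (ip (\<lambda>x. q s x - w' x) (w t)) + \<bar>s - t\<bar> * (L2_norm (q s))\<^sup>2"
      using abs_Re_le_cmod[of "ip (\<lambda>x. q s x - w' x) (w t)"]
        abs_triangle_ineq[of "2 * Re (ip (\<lambda>x. q s x - w' x) (w t))" "(s - t) * (L2_norm (q s))\<^sup>2"]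
      by (simp add: abs_mult)
    finally have 1: "norm (((L2_norm (w s))\<^sup>2 - (L2_norm (w t))\<^sup>2) / (s - t) - 2 * Re (ip w' (w t)))
      \<le> 2 * norm (ip (\<lambda>x. q s x - w' x) (w t)) + \<bar>s - t\<bar> * (L2_norm (q s))\<^sup>2" .
    have 2: "norm (ip (\<lambda>x. q s x - w' x) (w t)) \<le> e s * L2_norm (w t)"
      unfolding e_def by (intro L2_Cauchy_Schwarz L2_diff q w' w t)
    have "L2_norm (q s) \<le> e s + L2_norm w'"
      using L2_triangle[OF L2_diff[OF q w'] w'] by (simp add: e_def)
    then have 3: "\<bar>s - t\<bar> * (L2_norm (q s))\<^sup>2 \<le> \<bar>s - t\<bar> * (e s + L2_norm w')\<^sup>2"
      by (intro mult_left_mono power_mono) auto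
    from 1 2 3 show ?thesis by linarith
  qed
  have "((\<lambda>s. 2 * (e s * L2_norm (w t)) + \<bar>s - t\<bar> * (e s + L2_norm w')\<^sup>2) \<longlongrightarrow>
      2 * (0 * L2_norm (w t)) + \<bar>t - t\<bar> * (0 + L2_norm w')\<^sup>2) (at t within S)"
    by (intro tendsto_intros e_lim)
  then have "((\<lambda>s. 2 * (e s * L2_norm (w t)) + \<bar>s - t\<bar> * (e s + L2_norm w')\<^sup>2) \<longlongrightarrow> 0) (at t within S)" by simp
  then have "((\<lambda>s. ((L2_norm (w s))\<^sup>2 - (L2_norm (w t))\<^sup>2) / (s - t) - 2 * Re (ip w' (w t))) \<longlongrightarrow> 0) (at t within S)"
    by (rule Lim_null_comparison[rotated])
      (unfold eventually_at_filter, intro always_eventually allI impI, rule le)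
  then show ?thesis
    unfolding has_field_derivative_iff by (simp add: LIM_zero_iff)
qed

text \<open>A product rule for an operator depending on time applied to a function depending on
  time. The smoothing time is affine with nonzero slope, so \<open>\<sigma> s\<close> differs from
  \<open>\<sigma> t\<close> for \<open>s \<noteq> t\<close> and the quotient of kernels
  \<open>k (\<sigma> s)\<close> makes sense; its \<open>L1\<close> norm \<open>d\<close> tends to
  0.\<close>

lemma heat_curve_has_derivative:
  fixes u :: "real \<Rightarrow> real^'n::finite \<Rightarrow> complex"
  assumes t: "t \<in> S" and u: "\<And>s. s \<in> S \<Longrightarrow> u s \<in> L2" and v: "v \<in> L2"
    and lim: "((\<lambda>s. L2_norm (\<lambda>x. (u s x - u t x) / complex_of_real (s - t) - v x)) \<longlongrightarrow> 0) (at t within S)"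
    and \<sigma>: "\<And>s. \<sigma> s = c + m * s" "\<And>s. s \<in> S \<Longrightarrow> \<sigma> s > 0" "m > 0"
  shows "((\<lambda>s. L2_norm (\<lambda>x. (conv (heat (\<sigma> s) ord0) (u s) x - conv (heat (\<sigma> t) ord0) (u t) x) / complex_of_real (s - t)
           - (conv (heat (\<sigma> t) ord0) v x + of_real m * conv (heat_lap (\<sigma> t)) (u t) x))) \<longlongrightarrow> 0) (at t within S)"
proof -
  define r where "r = \<sigma> t"
  have r: "r > 0" using \<sigma>(2)[OF t] by (simp add: r_def)
  define q where "q s = (\<lambda>x. (u s x - u t x) / complex_of_real (s - t))" for s
  define e where "e s = L2_norm (\<lambda>x. q s x - v x)" for s
  have e_lim: "(e \<longlongrightarrow> 0) (at t within S)" unfolding e_def q_def by (rule lim)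
  define k where "k s x = (heat s ord0 x - heat r ord0 x) / (s - r) - heat_lap r x" for s and x :: "real^'n"
  define d where "d s = (\<integral>x. \<bar>k s x\<bar> \<partial>lborel)" for s
  define L where "L = (\<integral>x. \<bar>heat_lap r x\<bar> \<partial>(lborel :: (real^'n) measure))"
  have \<sigma>_lim: "filterlim \<sigma> (at r) (at t within S)"
  proof (rule filterlim_atI)
    have "((\<lambda>s. c + m * s) \<longlongrightarrow> c + m * t) (at t within S)" by (intro tendsto_intros)
    then show "(\<sigma> \<longlongrightarrow> r) (at t within S)" by (simp add: r_def \<sigma>(1)[abs_def])
    show "\<forall>\<^sub>F s in at t within S. \<sigma> s \<noteq> r"
      using \<sigma>(3) by (auto simp: eventually_at_filter r_def \<sigma>(1))
  qed
  have d_lim: "((\<lambda>s. d (\<sigma> s)) \<longlongrightarrow> 0) (at t within S)"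
    using filterlim_compose[OF heat_L1_derivative[OF r] \<sigma>_lim] by (simp add: d_def k_def)
  have kr: "conv_kernel (heat r ord0 :: real^'n \<Rightarrow> real)" "conv_kernel (heat_lap r :: real^'n \<Rightarrow> real)"
    by (intro kernel_heat kernel_heat_lap r)+
  have ker_k: "conv_kernel (k s :: real^'n \<Rightarrow> real)" if "s > 0" for s
    unfolding k_def[abs_def] divide_inverse mult.commute[of _ "inverse (s - r)"]
    by (intro kernel_diff kernel_cmult kernel_heat kernel_heat_lap r that)
  have le: "norm (L2_norm (\<lambda>x. (conv (heat (\<sigma> s) ord0) (u s) x - conv (heat r ord0) (u t) x) / complex_of_real (s - t)
           - (conv (heat r ord0) v x + of_real m * conv (heat_lap r) (u t) x)))
     \<le> e s + (\<bar>m * (s - t)\<bar> * (d (\<sigma> s) + L) * L2_norm v + \<bar>m\<bar> * (d (\<sigma> s) * L2_norm (u t)))"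
    if s: "s \<in> S" "s \<noteq> t" for s
  proof -
    note us = u[OF s(1)] and ut = u[OF t]
    have \<sigma>s: "\<sigma> s > 0" "\<sigma> s - r = m * (s - t)" "\<sigma> s \<noteq> r"
      using \<sigma>(2)[OF s(1)] \<sigma>(3) s(2) by (auto simp: r_def \<sigma>(1)[of s] \<sigma>(1)[of t] right_diff_distrib)
    have ks: "conv_kernel (heat (\<sigma> s) ord0 :: real^'n \<Rightarrow> real)" by (rule kernel_heat[OF \<sigma>s(1)])
    have q: "q s \<in> L2" using L2_cmult[OF L2_diff[OF us ut], of "inverse (complex_of_real (s - t))"]
      by (simp add: q_def divide_inverse mult.commute)
    have us_eq: "u s = (\<lambda>x. u t x + of_real (s - t) * q s x)" using s by (auto simp: q_def)
    have heat_s: "heat (\<sigma> s) ord0 = (\<lambda>x::real^'n. heat r ord0 x + (m * (s - t)) * (k (\<sigma> s) x + heat_lap r x))"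
    proof
      fix x :: "real^'n"
      have "(\<sigma> s - r) * (k (\<sigma> s) x + heat_lap r x) = heat (\<sigma> s) ord0 x - heat r ord0 x"
        using \<sigma>s(3) by (simp add: k_def)
      then show "heat (\<sigma> s) ord0 x = heat r ord0 x + (m * (s - t)) * (k (\<sigma> s) x + heat_lap r x)"
        unfolding \<sigma>s(2) by simp
    qed
    have exp_s: "conv (heat (\<sigma> s) ord0) f x = conv (heat r ord0) f x
        + of_real (m * (s - t)) * (conv (k (\<sigma> s)) f x + conv (heat_lap r) f x)" if "f \<in> L2" for f x
      unfolding heat_s using that kr ker_k[OF \<sigma>s(1)]
      by (simp only: conv_add_left conv_cmult_left kernel_add kernel_cmult)
    \<comment> \<open>The three errors of the product rule: the quotient of \<open>u\<close> against
      \<open>v\<close> under the moved operator (\<open>f1\<close>), the change of operator acting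
      on \<open>v\<close> (\<open>f2\<close>), and the quotient of operators against its derivative
      acting on \<open>u t\<close> (\<open>f3\<close>).\<close>
    define f1 where "f1 = conv (heat (\<sigma> s) ord0) (\<lambda>x. q s x - v x)"
    define f2 where "f2 = (\<lambda>x. of_real (m * (s - t)) * (conv (k (\<sigma> s)) v x + conv (heat_lap r) v x))"
    define f3 where "f3 = (\<lambda>x. of_real m * conv (k (\<sigma> s)) (u t) x)"
    have L2s: "f1 \<in> L2" "f2 \<in> L2" "f3 \<in> L2"
      unfolding f1_def f2_def f3_def
      by (intro conv_L2 L2_cmult L2_add L2_diff ks kr ker_k \<sigma>s q v ut)+
    have "(conv (heat (\<sigma> s) ord0) (u s) x - conv (heat r ord0) (u t) x) / complex_of_real (s - t)
           - (conv (heat r ord0) v x + of_real m * conv (heat_lap r) (u t) x) = f1 x + (f2 x + f3 x)" for x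
    proof -
      have "conv (heat (\<sigma> s) ord0) (u s) x = conv (heat (\<sigma> s) ord0) (u t) x + of_real (s - t) * conv (heat (\<sigma> s) ord0) (q s) x"
        by (subst us_eq) (simp only: conv_add_right conv_cmult_right ks ut L2_cmult q)
      moreover have "conv (heat (\<sigma> s) ord0) (u t) x = conv (heat r ord0) (u t) x
        + of_real (m * (s - t)) * (conv (k (\<sigma> s)) (u t) x + conv (heat_lap r) (u t) x)" by (rule exp_s[OF ut])
      moreover have "f1 x = conv (heat (\<sigma> s) ord0) (q s) x - conv (heat (\<sigma> s) ord0) v x"
        unfolding f1_def by (rule conv_diff_right[OF ks q v])
      moreover have "conv (heat (\<sigma> s) ord0) v x = conv (heat r ord0) v x + f2 x"
        unfolding f2_def by (rule exp_s[OF v])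
      moreover have "complex_of_real (s - t) \<noteq> 0" using s(2) by simp
      ultimately show ?thesis
        unfolding f3_def of_real_mult by (simp add: divide_simps) (simp add: algebra_simps)
    qed
    then have "L2_norm (\<lambda>x. (conv (heat (\<sigma> s) ord0) (u s) x - conv (heat r ord0) (u t) x) / complex_of_real (s - t)
           - (conv (heat r ord0) v x + of_real m * conv (heat_lap r) (u t) x)) = L2_norm (\<lambda>x. f1 x + (f2 x + f3 x))"
      by simp
    also have "\<dots> \<le> L2_norm f1 + (L2_norm f2 + L2_norm f3)"
      using L2_triangle[OF L2s(1) L2_add[OF L2s(2,3)]] L2_triangle[OF L2s(2,3)] by linarith
    also have "L2_norm f1 \<le> e s"
      using conv_L2_norm_le[OF ks L2_diff[OF q v]] integral_abs_heat[OF \<sigma>s(1), where 'n='n] by (simp add: f1_def e_def)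
    also have "L2_norm f2 \<le> \<bar>m * (s - t)\<bar> * ((d (\<sigma> s) + L) * L2_norm v)"
    proof -
      have "L2_norm f2 = \<bar>m * (s - t)\<bar> * L2_norm (\<lambda>x. conv (k (\<sigma> s)) v x + conv (heat_lap r) v x)"
        unfolding f2_def L2_norm_cmult norm_of_real ..
      also have "\<dots> \<le> \<bar>m * (s - t)\<bar> * (d (\<sigma> s) * L2_norm v + L * L2_norm v)"
        unfolding d_def L_def
        by (rule mult_left_mono[OF order_trans[OF L2_triangle add_mono[OF conv_L2_norm_le conv_L2_norm_le]]])
          (intro conv_L2 ker_k kr \<sigma>s v abs_ge_zero)+
      finally show ?thesis by (simp only: distrib_right)
    qed
    also have "L2_norm f3 \<le> \<bar>m\<bar> * (d (\<sigma> s) * L2_norm (u t))"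
      unfolding f3_def L2_norm_cmult d_def
      using conv_L2_norm_le[OF ker_k[OF \<sigma>s(1)] ut] by (simp add: mult_left_mono)
    finally show ?thesis by (simp add: mult.assoc)
  qed
  have "((\<lambda>s. e s + (\<bar>m * (s - t)\<bar> * (d (\<sigma> s) + L) * L2_norm v + \<bar>m\<bar> * (d (\<sigma> s) * L2_norm (u t)))) \<longlongrightarrow>
      0 + (\<bar>m * (t - t)\<bar> * (0 + L) * L2_norm v + \<bar>m\<bar> * (0 * L2_norm (u t)))) (at t within S)"
    by (intro tendsto_intros e_lim d_lim)
  then have "((\<lambda>s. e s + (\<bar>m * (s - t)\<bar> * (d (\<sigma> s) + L) * L2_norm v + \<bar>m\<bar> * (d (\<sigma> s) * L2_norm (u t)))) \<longlongrightarrow> 0) (at t within S)"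
    by simp
  then show ?thesis
    unfolding r_def[symmetric]
    by (rule Lim_null_comparison[rotated])
      (unfold eventually_at_filter, intro always_eventually allI impI, rule le)
qed

text \<open>Integration by parts without differentiating \<open>f\<close>: both sides are rewritten
  as \<open>ip f\<close> of one composed kernel, and \<open>kconv_heat_shift\<close> identifies the
  kernels. The minus sign appears because a first derivative of the even Gaussian is odd.\<close>

lemma ip_heat_parts:
  assumes r: "r > 0" and f: "f \<in> L2"
  shows "ip (conv (heat r ord0) f) (conv (heat r (ord2 i j)) f)
    = - ip (conv (heat r (ord1 i)) f) (conv (heat r (ord1 j)) f)"
proof -
  note k = kernel_heat[OF r]
  have "ip (conv (heat r (ord1 i)) f) (conv (heat r (ord1 j)) f)
      = ip f (conv (kconv (\<lambda>x. - heat r (ord1 i) x) (heat r (ord1 j))) f)"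
    by (subst ip_conv_conv[OF k k f f]) (simp add: heat_reflect_1)
  also have "kconv (\<lambda>x. - heat r (ord1 i) x) (heat r (ord1 j)) = (\<lambda>x. (-1) * kconv (heat r (ord1 i)) (heat r (ord1 j)) x)"
    by (rule ext) (simp add: kconv_def)
  also have "conv \<dots> f = (\<lambda>x. (-1) * conv (kconv (heat r (ord1 i)) (heat r (ord1 j))) f x)"
    by (rule ext) (simp only: conv_cmult_left of_real_minus of_real_1)
  also have "ip f \<dots> = - ip f (conv (kconv (heat r ord0) (heat r (ord2 i j))) f)"
    unfolding kconv_heat_shift[OF r] ip_cmult_right by simp
  also have "ip f (conv (kconv (heat r ord0) (heat r (ord2 i j))) f) = ip (conv (heat r ord0) f) (conv (heat r (ord2 i j)) f)"
    by (subst ip_conv_conv[OF k k f f]) (simp add: heat_reflect_0)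
  finally show ?thesis by simp
qed

lemma ip_heat_lap:
  assumes r: "r > 0" and f: "f \<in> L2"
  shows "Re (ip (conv (heat_lap r) f) (conv (heat r ord0) f)) = - (\<Sum>j\<in>UNIV. (L2_norm (conv (heat r (ord1 j)) f))\<^sup>2)"
proof -
  have "conv (heat_lap r) f = (\<lambda>x. \<Sum>j\<in>UNIV. conv (heat r (ord2 j j)) f x)"
    unfolding heat_lap_def[abs_def] by (rule ext) (intro conv_sum_left kernel_heat r f)
  then have "ip (conv (heat_lap r) f) (conv (heat r ord0) f)
      = cnj (\<Sum>j\<in>UNIV. ip (conv (heat r ord0) f) (conv (heat r (ord2 j j)) f))"
    by (subst ip_commute) (simp add: ip_sum_right conv_L2 kernel_heat r f)
  also have "\<dots> = cnj (\<Sum>j\<in>UNIV. - of_real ((L2_norm (conv (heat r (ord1 j)) f))\<^sup>2))"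
    by (simp only: ip_heat_parts[OF r f] ip_self)
  finally show ?thesis by (simp add: sum_negf)
qed

section \<open>The heat semigroup: contraction, monotonicity and log-convexity\<close>

lemma heat_semigroup:
  assumes "r > 0" "s > 0" "f \<in> L2"
  shows "conv (heat r ord0) (conv (heat s ord0) f) = conv (heat (r + s) ord0) f"
  by (rule ext, rule trans[OF conv_conv[OF kernel_heat[OF assms(1)] kernel_heat[OF assms(2)] assms(3)]])
    (simp add: kconv_heat assms)

lemma heat_contraction:
  fixes f :: "real^'n::finite \<Rightarrow> complex"
  assumes "r > 0" "f \<in> L2" shows "L2_norm (conv (heat r ord0) f) \<le> L2_norm f"
  using conv_L2_norm_le[OF kernel_heat[OF assms(1)] assms(2), of ord0]
  unfolding integral_abs_heat[OF assms(1), where 'n='n] by simp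

lemma heat_antimono:
  assumes "0 < s" "s \<le> r" "f \<in> L2"
  shows "L2_norm (conv (heat r ord0) f) \<le> L2_norm (conv (heat s ord0) f)"
proof (cases "s = r")
  case False
  then have "conv (heat r ord0) f = conv (heat (r - s) ord0) (conv (heat s ord0) f)"
    using assms by (subst heat_semigroup) auto
  then show ?thesis
    using False assms heat_contraction[of "r - s" "conv (heat s ord0) f"] by (simp add: conv_L2 kernel_heat)
qed simp

text \<open>Evenness of the Gaussian makes smoothing self-adjoint, so applying it on both sides of
  the inner product amounts to doubling the time on one side. Cauchy-Schwarz then gives the
  log-convexity in \<open>heat_doubling\<close>.\<close>

lemma heat_norm_sq:
  assumes "r > 0" "f \<in> L2"
  shows "(L2_norm (conv (heat r ord0) f))\<^sup>2 = Re (ip f (conv (heat (2 * r) ord0) f))"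
proof -
  have "complex_of_real ((L2_norm (conv (heat r ord0) f))\<^sup>2) = ip f (conv (heat (2 * r) ord0) f)"
    unfolding ip_self[symmetric]
    by (subst ip_conv_conv[OF kernel_heat[OF assms(1)] kernel_heat[OF assms(1)] assms(2) assms(2)])
      (simp only: heat_reflect_0 kconv_heat[OF assms(1) assms(1)] mult_2)
  from arg_cong[OF this, of Re] show ?thesis by simp
qed

lemma heat_doubling:
  assumes "r > 0" "f \<in> L2"
  shows "(L2_norm (conv (heat r ord0) f))\<^sup>2 \<le> L2_norm f * L2_norm (conv (heat (2 * r) ord0) f)"
  unfolding heat_norm_sq[OF assms]
  using L2_Cauchy_Schwarz[OF assms(2) conv_L2[OF kernel_heat assms(2)], of "2 * r" ord0] assms(1)
    complex_Re_le_cmod[of "ip f (conv (heat (2 * r) ord0) f)"] by simp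

text \<open>Log-convexity of \<open>r \<mapsto> \<parallel>S\<^sub>r f\<parallel>\<close>, iterated along doublings of \<open>r\<close>.\<close>

lemma heat_interpolation:
  assumes "r > 0" "f \<in> L2" "L2_norm f \<le> D"
  shows "(L2_norm (conv (heat r ord0) f)) ^ (2 ^ m) \<le> D ^ (2 ^ m - 1) * L2_norm (conv (heat (2 ^ m * r) ord0) f)"
proof (induction m)
  case (Suc m)
  let ?h = "\<lambda>s. L2_norm (conv (heat s ord0) f)"
  have D: "0 \<le> D" using assms(3) L2_norm_nonneg[of f] by linarith
  have "?h r ^ (2 ^ Suc m) = (?h r ^ (2 ^ m))\<^sup>2" by (simp add: power_mult[symmetric] mult.commute)
  also have "\<dots> \<le> (D ^ (2 ^ m - 1) * ?h (2 ^ m * r))\<^sup>2"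
    by (intro power_mono Suc.IH) simp
  also have "\<dots> \<le> D ^ (2 * (2 ^ m - 1)) * (L2_norm f * ?h (2 * (2 ^ m * r)))"
    unfolding power_mult_distrib using heat_doubling[of "2 ^ m * r" f] assms D
    by (intro mult_mono) (auto simp: power_mult[symmetric] mult.commute)
  also have "\<dots> \<le> D ^ (2 * (2 ^ m - 1)) * (D * ?h (2 * (2 ^ m * r)))"
    using D assms(3) by (intro mult_left_mono mult_right_mono) auto
  also have "\<dots> = D ^ (Suc (2 * (2 ^ m - 1))) * ?h (2 ^ Suc m * r)"
    by (simp add: mult_ac)
  \<comment> \<open>Subtraction is on naturals; that \<open>2 ^ m\<close> is at least 1 keeps it
    from truncating.\<close>
  also have "Suc (2 * (2 ^ m - 1)) = 2 ^ Suc m - (1::nat)"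
    using one_le_power[of "2::nat" m] unfolding power_Suc by linarith
  finally show ?case .
qed simp

section \<open>Smooth functions and test functions\<close>

text \<open>Differentiability is counted by order, so that closure under sums, products and affine
  substitution is a plain induction on the order.\<close>

primrec smooth_upto :: "nat \<Rightarrow> (real \<Rightarrow> real) \<Rightarrow> bool" where
  "smooth_upto 0 f \<longleftrightarrow> True"
| "smooth_upto (Suc n) f \<longleftrightarrow> (\<exists>f'. (\<forall>x. (f has_real_derivative f' x) (at x)) \<and> smooth_upto n f')"

definition smooth :: "(real \<Rightarrow> real) \<Rightarrow> bool" where
  "smooth f \<longleftrightarrow> (\<forall>n. smooth_upto n f)"

lemma smooth_upto_SucD: "smooth_upto (Suc n) f \<Longrightarrow> smooth_upto n f"
proof (induction n arbitrary: f)
  case (Suc n)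
  then obtain f' where "\<forall>x. (f has_real_derivative f' x) (at x)" "smooth_upto (Suc n) f'"
    unfolding smooth_upto.simps(2)[of "Suc n"] by blast
  then show ?case using Suc.IH[of f'] unfolding smooth_upto.simps(2)[of n] by blast
qed simp

lemma smooth_upto_const: "smooth_upto n (\<lambda>x. c)"
  by (induction n arbitrary: c) (auto intro!: exI[of _ "\<lambda>x. 0"])

lemma smooth_upto_add: "smooth_upto n f \<Longrightarrow> smooth_upto n g \<Longrightarrow> smooth_upto n (\<lambda>x. f x + g x)"
proof (induction n arbitrary: f g)
  case (Suc n)
  then obtain f' g' where "\<And>x. (f has_real_derivative f' x) (at x)" "smooth_upto n f'"
    "\<And>x. (g has_real_derivative g' x) (at x)" "smooth_upto n g'" by auto
  note d = this
  have "((\<lambda>x. f x + g x) has_real_derivative f' x + g' x) (at x)" for x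
    by (intro DERIV_add d)
  moreover have "smooth_upto n (\<lambda>x. f' x + g' x)" by (rule Suc.IH[OF d(2,4)])
  ultimately show ?case unfolding smooth_upto.simps by (intro exI conjI allI)
qed simp

lemma smooth_upto_mult: "smooth_upto n f \<Longrightarrow> smooth_upto n g \<Longrightarrow> smooth_upto n (\<lambda>x. f x * g x)"
proof (induction n arbitrary: f g)
  case (Suc n)
  then obtain f' g' where d: "\<And>x. (f has_real_derivative f' x) (at x)" "smooth_upto n f'"
    "\<And>x. (g has_real_derivative g' x) (at x)" "smooth_upto n g'" by auto
  have "smooth_upto n f" "smooth_upto n g" by (rule smooth_upto_SucD[OF Suc.prems(1)], rule smooth_upto_SucD[OF Suc.prems(2)])
  then have "smooth_upto n (\<lambda>x. f' x * g x + g' x * f x)"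
    using d by (intro smooth_upto_add Suc.IH)
  moreover have "((\<lambda>x. f x * g x) has_real_derivative f' x * g x + g' x * f x) (at x)" for x
    by (intro DERIV_mult d)
  ultimately show ?case unfolding smooth_upto.simps by (intro exI conjI allI)
qed simp

lemma smooth_upto_affine: "smooth_upto n f \<Longrightarrow> smooth_upto n (\<lambda>x. f (a * x + b))"
proof (induction n arbitrary: f)
  case (Suc n)
  then obtain f' where d: "\<And>x. (f has_real_derivative f' x) (at x)" "smooth_upto n f'" by auto
  have "smooth_upto n (\<lambda>x. f' (a * x + b) * a)"
    by (rule smooth_upto_mult[OF Suc.IH[OF d(2)] smooth_upto_const])
  moreover have "((\<lambda>x. f (a * x + b)) has_real_derivative f' (a * x + b) * a) (at x)" for x
    by (rule DERIV_chain2[OF d(1)]) (auto intro!: derivative_eq_intros)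
  ultimately show ?case unfolding smooth_upto.simps by (intro exI conjI allI)
qed simp

lemma smooth_mult: "smooth f \<Longrightarrow> smooth g \<Longrightarrow> smooth (\<lambda>x. f x * g x)"
  by (simp add: smooth_def smooth_upto_mult)

lemma smooth_affine: "smooth f \<Longrightarrow> smooth (\<lambda>x. f (a * x + b))"
  by (simp add: smooth_def smooth_upto_affine)

text \<open>Each order \<open>n\<close> comes with its own witness \<open>g\<close> for the
  derivative; uniqueness of derivatives identifies all of them with \<open>f'\<close>.\<close>

lemma smooth_DERIV:
  assumes "smooth f" "\<And>x. (f has_real_derivative f' x) (at x)"
  shows "smooth f'"
  unfolding smooth_def
proof
  fix n
  have "smooth_upto (Suc n) f" using assms(1) unfolding smooth_def by blast
  then obtain g where g: "\<And>x. (f has_real_derivative g x) (at x)" "smooth_upto n g" by auto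
  have "g = f'" using DERIV_unique[OF g(1) assms(2)] by auto
  with g show "smooth_upto n f'" by simp
qed

lemma smoothE:
  assumes "smooth f" obtains f' where "\<And>x. (f has_real_derivative f' x) (at x)" "smooth f'"
proof -
  have "smooth_upto (Suc 0) f" using assms unfolding smooth_def by blast
  then obtain f' where f': "\<And>x. (f has_real_derivative f' x) (at x)" by auto
  show ?thesis by (rule that[OF f' smooth_DERIV[OF assms f']])
qed

lemma smooth_family_derivative:
  assumes "\<And>i. smooth (h i)"
  shows "\<exists>h'. \<forall>i. (\<forall>t. (h i has_real_derivative h' i t) (at t)) \<and> smooth (h' i)"
proof (rule choice, rule allI)
  fix i
  show "\<exists>f'. (\<forall>x. (h i has_real_derivative f' x) (at x)) \<and> smooth f'"
    using smoothE[OF assms[of i]] by metis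
qed

text \<open>Differentiation maps a polynomial times this exponential to another polynomial times the
  same exponential, so the induction runs with the polynomial arbitrary.\<close>

lemma smooth_poly_gauss: "smooth (\<lambda>t. poly p t * exp (c * t\<^sup>2))"
proof -
  have "smooth_upto n (\<lambda>t. poly p t * exp (c * t\<^sup>2))" for n
  proof (induction n arbitrary: p)
    case (Suc n)
    have d: "((\<lambda>t. poly p t * exp (c * t\<^sup>2)) has_real_derivative
        poly (pderiv p + p * [:0, 2 * c:]) t * exp (c * t\<^sup>2)) (at t)" for t
    proof -
      have "((\<lambda>t. c * t\<^sup>2) has_real_derivative c * (2 * t)) (at t)" by (auto intro!: derivative_eq_intros)
      from DERIV_mult[OF poly_DERIV[of p t] DERIV_fun_exp[OF this]]
      show ?thesis by (simp add: algebra_simps)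
    qed
    show ?case unfolding smooth_upto.simps by (intro exI conjI allI, rule d, rule Suc.IH)
  qed simp
  then show ?thesis by (simp add: smooth_def)
qed

lemma smooth_gauss_0: "smooth (gauss r 0)"
proof -
  have "gauss r 0 = (\<lambda>t. poly [:1 / sqrt (4 * pi * r):] t * exp ((- 1 / (4 * r)) * t\<^sup>2))"
    by (auto simp: gauss_def)
  then show ?thesis by (simp only: smooth_poly_gauss)
qed

section \<open>A smooth bump function on the line\<close>

lemma poly_exp_tendsto_0: "((\<lambda>x. poly p x * exp (- x)) \<longlongrightarrow> 0) (at_top :: real filter)"
proof -
  have "((\<lambda>x. \<Sum>i\<le>degree p. coeff p i * (x ^ i / exp x)) \<longlongrightarrow> (\<Sum>i\<le>degree p. coeff p i * 0)) (at_top :: real filter)"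
    by (intro tendsto_intros tendsto_power_div_exp_0)
  then show ?thesis
    by (simp add: poly_altdef sum_distrib_right exp_minus divide_inverse mult.assoc)
qed

text \<open>The classical function exp(-1/t), extended by 0 to the left. The polynomial factor in
  1/t closes the family under differentiation.\<close>

definition flat :: "real poly \<Rightarrow> real \<Rightarrow> real" where
  "flat p t = (if t > 0 then poly p (inverse t) * exp (- inverse t) else 0)"

text \<open>For positive \<open>t\<close> the chain rule produces \<open>p - pderiv p\<close> at
  \<open>inverse t\<close>, and the inner derivative contributes the square of
  \<open>inverse t\<close>, encoded as \<open>[:0, 0, 1:]\<close>. At 0 the exponential beats every
  power of \<open>inverse t\<close>.\<close>

lemma DERIV_flat: "(flat p has_real_derivative flat ((p - pderiv p) * [:0, 0, 1:]) t) (at t)"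
proof -
  consider "t > 0" | "t < 0" | "t = 0" by linarith
  then show ?thesis
  proof cases
    case 1
    have "((\<lambda>t. poly p (inverse t) * exp (- inverse t)) has_real_derivative flat ((p - pderiv p) * [:0, 0, 1:]) t) (at t)"
      using 1 unfolding flat_def
      by (auto intro!: derivative_eq_intros DERIV_chain2[OF poly_DERIV] simp: algebra_simps power2_eq_square)
    then show ?thesis
      by (rule has_field_derivative_transform_within_open[of _ _ _ "{0<..}"]) (use 1 in \<open>auto simp: flat_def\<close>)
  next
    case 2
    have "((\<lambda>t. 0) has_real_derivative flat ((p - pderiv p) * [:0, 0, 1:]) t) (at t)"
      using 2 by (simp add: flat_def)
    then show ?thesis
      by (rule has_field_derivative_transform_within_open[of _ _ _ "{..<0}"]) (use 2 in \<open>auto simp: flat_def\<close>)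
  next
    case 3
    have r: "((\<lambda>h. flat p h / h) \<longlongrightarrow> 0) (at_right 0)"
    proof (rule Lim_transform_eventually)
      \<comment> \<open>The extra factor \<open>[:0, 1:]\<close> is the division by \<open>h\<close>
        in the difference quotient.\<close>
      show "((\<lambda>h. poly (p * [:0, 1:]) (inverse h) * exp (- inverse h)) \<longlongrightarrow> 0) (at_right (0::real))"
        by (rule filterlim_compose[OF poly_exp_tendsto_0 filterlim_inverse_at_top_right])
      show "\<forall>\<^sub>F h in at_right 0. poly (p * [:0, 1:]) (inverse h) * exp (- inverse h) = flat p h / h"
        by (auto simp: eventually_at_filter flat_def divide_inverse)
    qed
    have l: "((\<lambda>h. flat p h / h) \<longlongrightarrow> 0) (at_left 0)"
      by (rule Lim_transform_eventually[OF tendsto_const]) (auto simp: eventually_at_filter flat_def)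
    show ?thesis
      using filterlim_split_at[OF l r] 3 by (simp add: has_field_derivative_iff flat_def)
  qed
qed

lemma smooth_flat: "smooth (flat p)"
proof -
  have "smooth_upto n (flat p)" for n
  proof (induction n arbitrary: p)
    case (Suc n)
    show ?case unfolding smooth_upto.simps by (intro exI conjI allI, rule DERIV_flat, rule Suc.IH)
  qed simp
  then show ?thesis by (simp add: smooth_def)
qed

text \<open>A bump supported in the interval from -1 to 1. It is neither normalised nor constant
  near 0: after rescaling only \<open>cutoff 0\<close> survives in the limit, and this nonzero
  constant is divided out at the end.\<close>

definition cutoff :: "real \<Rightarrow> real" where
  "cutoff t = flat 1 (1 + t) * flat 1 (1 - t)"

lemma smooth_cutoff: "smooth cutoff"
  using smooth_mult[OF smooth_affine[OF smooth_flat, of 1 1 1] smooth_affine[OF smooth_flat, of 1 "-1" 1]]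
  unfolding cutoff_def[abs_def] by (simp add: add.commute)

lemma cutoff_0: "cutoff 0 > 0"
  by (simp add: cutoff_def flat_def)

lemma cutoff_eq_0: "\<bar>t\<bar> \<ge> 1 \<Longrightarrow> cutoff t = 0"
  by (auto simp: cutoff_def flat_def)

lemma bounded_of_support:
  fixes f :: "real \<Rightarrow> real"
  assumes "continuous_on UNIV f" "\<And>t. \<bar>t\<bar> > 1 \<Longrightarrow> f t = 0"
  obtains B where "\<And>t. \<bar>f t\<bar> \<le> B"
proof -
  have "bounded (f ` {-1..1})"
    by (intro compact_imp_bounded compact_continuous_image continuous_on_subset[OF assms(1)]) auto
  then obtain B where B: "\<forall>t\<in>{-1..1}. \<bar>f t\<bar> \<le> B" by (auto simp: bounded_iff)
  have "\<bar>f t\<bar> \<le> max B 0" for t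
  proof (cases "\<bar>t\<bar> > 1")
    case False
    then have "t \<in> {-1..1}" by auto
    then show ?thesis using B by (simp add: le_max_iff_disj)
  qed (simp add: assms(2))
  then show ?thesis by (rule that)
qed

lemma DERIV_eq_0_of_support:
  fixes f :: "real \<Rightarrow> real"
  assumes "\<And>t. (f has_real_derivative f' t) (at t)" "\<And>t. \<bar>t\<bar> > 1 \<Longrightarrow> f t = 0" "\<bar>t\<bar> > 1"
  shows "f' t = 0"
proof -
  have o: "open {t::real. \<bar>t\<bar> > 1}" by (intro open_Collect_less continuous_intros)
  have "(f has_real_derivative 0) (at t)"
    by (rule has_field_derivative_transform_within_open[OF _ o, of "\<lambda>_. 0"]) (use assms in auto)
  with assms(1)[of t] show ?thesis by (metis DERIV_unique)
qed

lemma cutoff_derivatives: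
  obtains \<chi>1 \<chi>2 B where "\<And>t. (cutoff has_real_derivative \<chi>1 t) (at t)" "\<And>t. (\<chi>1 has_real_derivative \<chi>2 t) (at t)"
    "continuous_on UNIV \<chi>2" "\<And>t. \<bar>cutoff t\<bar> \<le> B" "\<And>t. \<bar>\<chi>1 t\<bar> \<le> B" "\<And>t. \<bar>\<chi>2 t\<bar> \<le> B"
proof -
  obtain \<chi>1 where 1: "\<And>t. (cutoff has_real_derivative \<chi>1 t) (at t)" "smooth \<chi>1" using smoothE[OF smooth_cutoff] by metis
  obtain \<chi>2 where 2: "\<And>t. (\<chi>1 has_real_derivative \<chi>2 t) (at t)" "smooth \<chi>2" using smoothE[OF 1(2)] by metis
  \<comment> \<open>The third derivative serves to make \<open>\<chi>2\<close> continuous, hence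
    bounded on its compact support.\<close>
  obtain \<chi>3 where 3: "\<And>t. (\<chi>2 has_real_derivative \<chi>3 t) (at t)" using smoothE[OF 2(2)] by metis
  have z0: "\<bar>t\<bar> > 1 \<Longrightarrow> cutoff t = 0" for t using cutoff_eq_0[of t] by simp
  have z1: "\<bar>t\<bar> > 1 \<Longrightarrow> \<chi>1 t = 0" for t using DERIV_eq_0_of_support[OF 1(1) z0] .
  have z2: "\<bar>t\<bar> > 1 \<Longrightarrow> \<chi>2 t = 0" for t using DERIV_eq_0_of_support[OF 2(1) z1] .
  have cont: "continuous_on UNIV f" if "\<And>t. (f has_real_derivative f' t) (at t)" for f f' :: "real \<Rightarrow> real"
    using that by (meson DERIV_continuous_on UNIV_I has_field_derivative_at_within)
  obtain B0 where B0: "\<And>t. \<bar>cutoff t\<bar> \<le> B0" using bounded_of_support[OF cont[OF 1(1)] z0] by metis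
  obtain B1 where B1: "\<And>t. \<bar>\<chi>1 t\<bar> \<le> B1" using bounded_of_support[OF cont[OF 2(1)] z1] by metis
  obtain B2 where B2: "\<And>t. \<bar>\<chi>2 t\<bar> \<le> B2" using bounded_of_support[OF cont[OF 3] z2] by metis
  show ?thesis
    by (rule that[of \<chi>1 \<chi>2 "max B0 (max B1 B2)", OF 1(1) 2(1) cont[OF 3]])
       (use B0 B1 B2 in \<open>auto simp: le_max_iff_disj\<close>)
qed

section \<open>Tensor products as test functions\<close>

lemma partial_tensor:
  fixes h :: "'n::finite \<Rightarrow> real \<Rightarrow> real"
  assumes h: "\<And>i t. (h i has_real_derivative h' i t) (at t)"
  shows "partial j (\<lambda>x. complex_of_real (tensor h x)) = (\<lambda>x. complex_of_real (tensor (h(j := h' j)) x))"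
    and "(\<lambda>x. complex_of_real (tensor h x)) differentiable (at x)"
proof -
  have d: "((\<lambda>x. complex_of_real (tensor h x)) has_derivative
      (\<lambda>y. complex_of_real (\<Sum>i\<in>UNIV. h' i (x $ i) * (y $ i) * (\<Prod>j\<in>UNIV - {i}. h j (x $ j))))) (at x)" for x
    by (rule has_derivative_compose[OF has_derivative_tensor[OF h] bounded_linear_imp_has_derivative[OF bounded_linear_of_real]])
  show "(\<lambda>x. complex_of_real (tensor h x)) differentiable (at x)"
    using d differentiable_def by blast
  show "partial j (\<lambda>x. complex_of_real (tensor h x)) = (\<lambda>x. complex_of_real (tensor (h(j := h' j)) x))"
  proof
    fix x :: "real^'n"
    have "(\<Sum>i\<in>UNIV. h' i (x $ i) * (axis j 1 $ i) * (\<Prod>j\<in>UNIV - {i}. h j (x $ j)))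
        = (\<Sum>i\<in>UNIV. if i = j then h' i (x $ i) * (\<Prod>j\<in>UNIV - {i}. h j (x $ j)) else 0)"
      by (intro sum.cong) (auto simp: axis_def)
    also have "\<dots> = h' j (x $ j) * (\<Prod>i\<in>UNIV - {j}. h i (x $ i))" by simp
    also have "\<dots> = tensor (h(j := h' j)) x"
      unfolding tensor_def by (subst prod.remove[of UNIV j]) (auto intro!: prod.cong)
    finally show "partial j (\<lambda>x. complex_of_real (tensor h x)) x = complex_of_real (tensor (h(j := h' j)) x)"
      unfolding partial_def frechet_derivative_at[OF d[of x], symmetric] by simp
  qed
qed

text \<open>A partial derivative replaces one factor by its derivative, so every iterated partial
  derivative is again a tensor product of smooth functions, and each of these is
  differentiable.\<close>

lemma tensor_test_function:
  fixes h :: "'n::finite \<Rightarrow> real \<Rightarrow> real"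
  assumes h: "\<And>i. smooth (h i)" and supp: "\<And>i t. \<bar>t\<bar> > R \<Longrightarrow> h i t = 0"
  shows "(\<lambda>x. complex_of_real (tensor h x)) \<in> test_functions"
proof -
  have diff: "(\<lambda>x. complex_of_real (tensor g x)) differentiable (at x)" if g: "\<And>i. smooth (g i)"
    for g :: "'n \<Rightarrow> real \<Rightarrow> real" and x
  proof -
    obtain g' where g': "\<And>i t. (g i has_real_derivative g' i t) (at t)" "\<And>i. smooth (g' i)"
      using smooth_family_derivative[of g, OF g] by auto
    show ?thesis by (rule partial_tensor(2)[OF g'(1)])
  qed
  have ex: "\<exists>g. (\<forall>i. smooth (g i)) \<and> foldr partial js (\<lambda>x. complex_of_real (tensor h x)) = (\<lambda>x. complex_of_real (tensor g x))" for js
  proof (induction js)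
    case Nil then show ?case using h by auto
  next
    case (Cons j js)
    then obtain g where g: "\<And>i. smooth (g i)"
      "foldr partial js (\<lambda>x. complex_of_real (tensor h x)) = (\<lambda>x. complex_of_real (tensor g x))" by auto
    obtain g' where g': "\<And>i t. (g i has_real_derivative g' i t) (at t)" "\<And>i. smooth (g' i)"
      using smooth_family_derivative[of g, OF g(1)] by auto
    have "\<forall>i. smooth ((g(j := g' j)) i)" using g(1) g'(2) by simp
    moreover have "foldr partial (j # js) (\<lambda>x. complex_of_real (tensor h x))
        = (\<lambda>x. complex_of_real (tensor (g(j := g' j)) x))"
      unfolding foldr.simps o_apply g(2) by (rule partial_tensor(1)[OF g'(1)])
    ultimately show ?case by blast
  qed
  have "foldr partial js (\<lambda>x. complex_of_real (tensor h x)) differentiable (at x)" for js x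
    using ex[of js] diff by metis
  moreover have "bounded {x. complex_of_real (tensor h x) \<noteq> 0}"
  proof (rule bounded_subset[OF bounded_cbox])
    show "{x. complex_of_real (tensor h x) \<noteq> 0} \<subseteq> cbox (\<chi> i. - R) (\<chi> i. R)"
    proof
      fix x assume "x \<in> {x. complex_of_real (tensor h x) \<noteq> 0}"
      then have "h i (x $ i) \<noteq> 0" for i by (auto simp: tensor_def)
      then have "\<bar>x $ i\<bar> \<le> R" for i using supp[of "x $ i" i] by (meson not_le)
      then show "x \<in> cbox (\<chi> i. - R) (\<chi> i. R)" by (auto simp: mem_box_cart abs_le_iff minus_le_iff)
    qed
  qed
  ultimately show ?thesis unfolding test_functions_def by (simp add: compact_closure)
qed

section \<open>Gaussians as limits of test functions\<close>

text \<open>For \<open>p\<close> up to 2, \<open>D m p \<xi>\<close> is the \<open>p\<close>-th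
  derivative in \<open>t\<close> of \<open>gauss r 0 (\<xi> - t)\<close> times the cutoff at scale
  \<open>m + 1\<close>. Differentiating in \<open>t\<close> while the Gaussian depends on
  \<open>\<xi> - t\<close> gives the sign \<open>(-1) ^ p\<close>. Every derivative falling on the
  cutoff gains a factor 1/(m+1): such terms vanish in the limit, and the bound is uniform in
  \<open>m\<close>.\<close>

lemma gauss_cutoff_family:
  assumes r: "r > 0"
  obtains D :: "nat \<Rightarrow> nat \<Rightarrow> real \<Rightarrow> real \<Rightarrow> real" and K R
  where "\<And>m \<xi>. smooth (D m 0 \<xi>)"
    "\<And>m \<xi> p t. p \<le> 1 \<Longrightarrow> (D m p \<xi> has_real_derivative D m (Suc p) \<xi> t) (at t)"
    "\<And>m p \<xi>. D m p \<xi> \<in> borel_measurable borel"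
    "\<And>m \<xi> t. \<bar>t\<bar> > R m \<Longrightarrow> D m 0 \<xi> t = 0"
    "\<And>m \<xi> p t. \<bar>D m p \<xi> t\<bar> \<le> K * gauss (4 * r) 0 (\<xi> - t)"
    "\<And>\<xi> p t. p \<le> 2 \<Longrightarrow> (\<lambda>m. D m p \<xi> t) \<longlonglongrightarrow> (-1) ^ p * cutoff 0 * gauss r p (\<xi> - t)"
proof -
  obtain \<chi>1 \<chi>2 B where \<chi>: "\<And>t. (cutoff has_real_derivative \<chi>1 t) (at t)" "\<And>t. (\<chi>1 has_real_derivative \<chi>2 t) (at t)"
    "continuous_on UNIV \<chi>2" "\<And>t. \<bar>cutoff t\<bar> \<le> B" "\<And>t. \<bar>\<chi>1 t\<bar> \<le> B" "\<And>t. \<bar>\<chi>2 t\<bar> \<le> B"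
    using cutoff_derivatives by blast
  obtain C where C: "C > 0" "\<And>r' p t. r / 2 \<le> r' \<Longrightarrow> r' \<le> 2 * r \<Longrightarrow> \<bar>gauss r' p t\<bar> \<le> C * gauss (4 * r) 0 t"
    using gauss_bound[OF r] by metis
  have B: "B \<ge> 0" using \<chi>(4)[of 0] by linarith
  define M where "M m = real (Suc m)" for m
  have M: "M m \<ge> 1" "M m > 0" for m by (auto simp: M_def)
  define a b e where "a m t = cutoff (t / M m)" and "b m t = \<chi>1 (t / M m) / M m" and "e m t = \<chi>2 (t / M m) / M m / M m" for m t
  define g where "g p \<xi> t = gauss r p (\<xi> - t)" for p \<xi> t
  \<comment> \<open>The Leibniz formulas of order 0, 1 and 2, where a derivative of \<open>g\<close>
    in \<open>t\<close> costs a sign.\<close>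
  define D where "D m p \<xi> t = (if p = 0 then g 0 \<xi> t * a m t
      else if p = 1 then g 0 \<xi> t * b m t - g 1 \<xi> t * a m t
      else g 0 \<xi> t * e m t - 2 * (g 1 \<xi> t * b m t) + g 2 \<xi> t * a m t)" for m :: nat and p :: nat and \<xi> t
  have scale: "((\<lambda>t. t / M m) has_real_derivative 1 / M m) (at t)" for m t
    using M(2)[of m] by (auto intro!: derivative_eq_intros)
  have a': "(a m has_real_derivative b m t) (at t)" for m t
    using DERIV_chain2[OF \<chi>(1) scale[of m t]] unfolding a_def[abs_def] b_def by simp
  have b': "(b m has_real_derivative e m t) (at t)" for m t
    using DERIV_cdivide[OF DERIV_chain2[OF \<chi>(2) scale[of m t]], of "M m"] unfolding b_def[abs_def] e_def by simp
  have g': "(g p \<xi> has_real_derivative - g (Suc p) \<xi> t) (at t)" if "p \<le> 1" for p \<xi> t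
  proof -
    have "((\<lambda>t. \<xi> - t) has_real_derivative - 1) (at t)" by (auto intro!: derivative_eq_intros)
    from DERIV_chain2[OF DERIV_gauss[OF r that] this] show ?thesis unfolding g_def[abs_def] by simp
  qed
  have aB: "\<bar>a m t\<bar> \<le> B" for m t unfolding a_def by (rule \<chi>(4))
  have bB: "\<bar>b m t\<bar> \<le> B * inverse (M m)" for m t
    using M(2)[of m] \<chi>(5)[of "t / M m"] unfolding b_def by (simp add: divide_inverse abs_mult)
  have eB: "\<bar>e m t\<bar> \<le> B * inverse (M m) * inverse (M m)" for m t
    using M(2)[of m] \<chi>(6)[of "t / M m"] unfolding e_def by (simp add: divide_inverse abs_mult)
  have invM: "inverse (M m) \<le> 1" "0 \<le> inverse (M m)" for m using M[of m] by (auto simp: inverse_le_1_iff)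
  have bB1: "\<bar>b m t\<bar> \<le> B" for m t
    using bB[of m t] mult_left_mono[OF invM(1) B, of m] by simp
  have eB1: "\<bar>e m t\<bar> \<le> B" for m t
    using eB[of m t] mult_left_mono[OF mult_le_one[OF invM(1)[of m] invM(2)[of m] invM(1)[of m]] B] by (simp add: mult.assoc)
  have gC: "\<bar>g p \<xi> t\<bar> \<le> C * gauss (4 * r) 0 (\<xi> - t)" for p \<xi> t
    unfolding g_def by (rule C(2)) (use r in auto)
  have prod_le: "\<bar>g p \<xi> t * y\<bar> \<le> C * gauss (4 * r) 0 (\<xi> - t) * B" if "\<bar>y\<bar> \<le> B" for p \<xi> t y
    unfolding abs_mult using gC that by (intro mult_mono) (auto intro: order_trans[OF abs_ge_zero])
  show ?thesis
  \<comment> \<open>The factor 4 counts the products in the Leibniz formula with multiplicity, at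
    most 1 + 2 + 1; each is bounded by \<open>B * C\<close> times the wide Gaussian.\<close>
  proof (rule that[of D M "4 * B * C"])
    show "smooth (D m 0 \<xi>)" for m \<xi>
    proof -
      have "smooth (\<lambda>t. gauss r 0 ((- 1) * t + \<xi>) * cutoff (inverse (M m) * t + 0))"
        by (rule smooth_mult[OF smooth_affine[OF smooth_gauss_0] smooth_affine[OF smooth_cutoff]])
      also have "(\<lambda>t. gauss r 0 ((- 1) * t + \<xi>) * cutoff (inverse (M m) * t + 0)) = D m 0 \<xi>"
        by (auto simp: D_def g_def a_def divide_inverse mult.commute)
      finally show ?thesis .
    qed
    show "(D m p \<xi> has_real_derivative D m (Suc p) \<xi> t) (at t)" if "p \<le> 1" for m \<xi> p t
    proof -
      consider "p = 0" | "p = 1" using \<open>p \<le> 1\<close> by linarith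
      then show ?thesis
      proof cases
        case 1
        have "((\<lambda>t. g 0 \<xi> t * a m t) has_real_derivative - g (Suc 0) \<xi> t * a m t + b m t * g 0 \<xi> t) (at t)"
          by (rule DERIV_mult[OF g' a']) simp
        then show ?thesis unfolding 1 D_def[abs_def] by (simp add: algebra_simps)
      next
        case 2
        have "((\<lambda>t. g 0 \<xi> t * b m t - g 1 \<xi> t * a m t) has_real_derivative
            (- g (Suc 0) \<xi> t * b m t + e m t * g 0 \<xi> t) - (- g (Suc 1) \<xi> t * a m t + b m t * g 1 \<xi> t)) (at t)"
          by (intro DERIV_diff DERIV_mult g' a' b') simp_all
        then show ?thesis unfolding 2 D_def[abs_def] by (simp add: algebra_simps numeral_2_eq_2)
      qed
    qed
    show "D m p \<xi> \<in> borel_measurable borel" for m p \<xi>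
    proof -
      have "continuous_on UNIV cutoff" "continuous_on UNIV \<chi>1"
        using \<chi>(1,2) by (meson DERIV_continuous_on UNIV_I has_field_derivative_at_within)+
      then have [measurable]: "cutoff \<in> borel_measurable borel" "\<chi>1 \<in> borel_measurable borel" "\<chi>2 \<in> borel_measurable borel"
        using \<chi>(3) by (auto intro: borel_measurable_continuous_onI)
      show ?thesis unfolding D_def[abs_def] a_def b_def e_def g_def by measurable
    qed
    show "D m 0 \<xi> t = 0" if "\<bar>t\<bar> > M m" for m \<xi> t
      using that M(2)[of m] cutoff_eq_0[of "t / M m"] by (simp add: D_def a_def)
    show "\<bar>D m p \<xi> t\<bar> \<le> 4 * B * C * gauss (4 * r) 0 (\<xi> - t)" for m \<xi> p t
    proof -
      define Q where "Q = C * gauss (4 * r) 0 (\<xi> - t) * B"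
      have Q: "\<bar>g q \<xi> t * a m t\<bar> \<le> Q" "\<bar>g q \<xi> t * b m t\<bar> \<le> Q" "\<bar>g q \<xi> t * e m t\<bar> \<le> Q" "0 \<le> Q" for q
        unfolding Q_def using aB bB1 eB1 prod_le C(1) B gauss_pos[of "4 * r" "\<xi> - t"] r
        by (auto intro!: mult_nonneg_nonneg)
      note Qs = Q(1)[of 0] Q(1)[of 1] Q(1)[of 2] Q(2)[of 0] Q(2)[of 1] Q(3)[of 0] Q(4)
      have "\<bar>D m p \<xi> t\<bar> \<le> 4 * Q"
      proof -
        consider "D m p \<xi> t = g 0 \<xi> t * a m t" | "D m p \<xi> t = g 0 \<xi> t * b m t - g 1 \<xi> t * a m t"
          | "D m p \<xi> t = g 0 \<xi> t * e m t - 2 * (g 1 \<xi> t * b m t) + g 2 \<xi> t * a m t"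
          unfolding D_def by metis
        then show ?thesis by cases (use Qs in linarith)+
      qed
      then show ?thesis by (simp add: Q_def mult_ac)
    qed
    show "(\<lambda>m. D m p \<xi> t) \<longlonglongrightarrow> (-1) ^ p * cutoff 0 * gauss r p (\<xi> - t)" if "p \<le> 2" for \<xi> p t
    proof -
      have inv: "(\<lambda>m. inverse (M m)) \<longlonglongrightarrow> 0" unfolding M_def by (rule LIMSEQ_inverse_real_of_nat)
      have a_lim: "(\<lambda>m. a m t) \<longlonglongrightarrow> cutoff 0"
      proof -
        have "(\<lambda>m. t * inverse (M m)) \<longlonglongrightarrow> t * 0" by (intro tendsto_intros inv)
        then have "(\<lambda>m. t / M m) \<longlonglongrightarrow> 0" by (simp add: divide_inverse)
        then show ?thesis unfolding a_def by (rule isCont_tendsto_compose[OF DERIV_isCont[OF \<chi>(1)]])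
      qed
      have b_lim: "(\<lambda>m. b m t) \<longlonglongrightarrow> 0"
        by (rule Lim_null_comparison[OF always_eventually, of _ "\<lambda>m. B * inverse (M m)"])
          (use bB tendsto_mult_right_zero[OF inv] in auto)
      have "(\<lambda>m. B * inverse (M m) * inverse (M m)) \<longlonglongrightarrow> B * 0 * 0" by (intro tendsto_intros inv)
      then have e0: "(\<lambda>m. B * inverse (M m) * inverse (M m)) \<longlonglongrightarrow> 0" by simp
      have e_lim: "(\<lambda>m. e m t) \<longlonglongrightarrow> 0"
        by (rule Lim_null_comparison[OF _ e0]) (simp add: eB)
      consider "p = 0" | "p = 1" | "p = 2" using \<open>p \<le> 2\<close> by linarith
      then show ?thesis
      proof cases
        case 1
        have "(\<lambda>m. g 0 \<xi> t * a m t) \<longlonglongrightarrow> g 0 \<xi> t * cutoff 0" by (intro tendsto_intros a_lim)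
        then show ?thesis by (simp add: 1 D_def g_def mult.commute)
      next
        case 2
        have "(\<lambda>m. g 0 \<xi> t * b m t - g 1 \<xi> t * a m t) \<longlonglongrightarrow> g 0 \<xi> t * 0 - g 1 \<xi> t * cutoff 0"
          by (intro tendsto_intros a_lim b_lim)
        then show ?thesis by (simp add: 2 D_def g_def mult.commute)
      next
        case 3
        have "(\<lambda>m. g 0 \<xi> t * e m t - 2 * (g 1 \<xi> t * b m t) + g 2 \<xi> t * a m t)
            \<longlonglongrightarrow> g 0 \<xi> t * 0 - 2 * (g 1 \<xi> t * 0) + g 2 \<xi> t * cutoff 0"
          by (intro tendsto_intros a_lim b_lim e_lim)
        then show ?thesis by (simp add: 3 D_def g_def mult.commute)
      qed
    qed
  qed
qed

lemma prod_ord1: "(\<Prod>i\<in>UNIV. (- 1) ^ ord1 (j::'n::finite) i) = (- 1 :: real)"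
proof -
  have "(\<Prod>i\<in>UNIV. (- 1 :: real) ^ ord1 j i) = (\<Prod>i\<in>UNIV. if i = j then - 1 else 1)"
    by (intro prod.cong) (auto simp: ord1_def)
  then show ?thesis by simp
qed

text \<open>The function \<open>y \<mapsto> heat r ord0 (x - y)\<close> is not compactly supported
  and cannot be inserted into the equation directly. Truncated versions can, and testing
  \<open>w\<close> or its distributional derivatives against them converges to convolutions with
  derivatives of the heat kernel. The sequence \<open>\<phi>\<close> does not depend on
  \<open>w\<close>, so one sequence serves all terms of the equation.\<close>

lemma heat_test_functions:
  fixes x :: "real^'n::finite"
  assumes r: "r > 0"
  obtains \<phi> :: "nat \<Rightarrow> real^'n \<Rightarrow> complex" and \<gamma> :: complex
  where "\<gamma> \<noteq> 0" "\<And>m. \<phi> m \<in> test_functions"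
    "\<And>w. w \<in> L2 \<Longrightarrow> (\<lambda>m. distr_of w (\<phi> m)) \<longlonglongrightarrow> \<gamma> * conv (heat r ord0) w x"
    "\<And>w j. w \<in> L2 \<Longrightarrow> (\<lambda>m. distr_partial j (distr_of w) (\<phi> m)) \<longlonglongrightarrow> \<gamma> * conv (heat r (ord1 j)) w x"
    "\<And>w i j. w \<in> L2 \<Longrightarrow>
      (\<lambda>m. distr_partial i (distr_partial j (distr_of w)) (\<phi> m)) \<longlonglongrightarrow> \<gamma> * conv (heat r (ord2 i j)) w x"
proof (rule gauss_cutoff_family[OF r])
  fix D :: "nat \<Rightarrow> nat \<Rightarrow> real \<Rightarrow> real \<Rightarrow> real" and K :: real and R :: "nat \<Rightarrow> real"
  assume
    smooth: "\<And>m \<xi>. smooth (D m 0 \<xi>)" and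
    deriv: "\<And>m \<xi> p t. p \<le> 1 \<Longrightarrow> (D m p \<xi> has_real_derivative D m (Suc p) \<xi> t) (at t)" and
    meas [measurable]: "\<And>m p \<xi>. D m p \<xi> \<in> borel_measurable borel" and
    supp: "\<And>m \<xi> t. \<bar>t\<bar> > R m \<Longrightarrow> D m 0 \<xi> t = 0" and
    bound: "\<And>m \<xi> p t. \<bar>D m p \<xi> t\<bar> \<le> K * gauss (4 * r) 0 (\<xi> - t)" and
    lim: "\<And>\<xi> p t. p \<le> 2 \<Longrightarrow> (\<lambda>m. D m p \<xi> t) \<longlonglongrightarrow> (-1) ^ p * cutoff 0 * gauss r p (\<xi> - t)"
  define T where "T m \<alpha> = tensor (\<lambda>i. D m (\<alpha> i) (x $ i))" for m and \<alpha> :: "'n \<Rightarrow> nat"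
  \<comment> \<open>Each of the coordinates contributes one limiting cutoff value
    \<open>cutoff 0\<close>.\<close>
  define \<gamma> where "\<gamma> = complex_of_real (cutoff 0 ^ CARD('n))"
  have partial_T: "partial j (\<lambda>y. complex_of_real (T m \<alpha> y)) = (\<lambda>y. complex_of_real (T m (\<lambda>i. \<alpha> i + ord1 j i) y))"
    if \<alpha>: "\<And>i. \<alpha> i \<le> 1" for m j \<alpha>
  proof -
    have "partial j (\<lambda>y. complex_of_real (T m \<alpha> y))
        = (\<lambda>y. complex_of_real (tensor ((\<lambda>i. D m (\<alpha> i) (x $ i))(j := D m (Suc (\<alpha> j)) (x $ j))) y))"
      unfolding T_def by (rule partial_tensor(1)[OF deriv[OF \<alpha>]])
    also have "(\<lambda>i. D m (\<alpha> i) (x $ i))(j := D m (Suc (\<alpha> j)) (x $ j)) = (\<lambda>i. D m (\<alpha> i + ord1 j i) (x $ i))"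
      by (auto simp: ord1_def)
    finally show ?thesis unfolding T_def .
  qed
  have limit: "(\<lambda>m. distr_of w (\<lambda>y. complex_of_real (T m \<alpha> y))) \<longlonglongrightarrow>
      of_real (\<Prod>i\<in>UNIV. (- 1) ^ \<alpha> i) * \<gamma> * conv (heat r \<alpha>) w x"
    if w: "w \<in> L2" and \<alpha>: "\<And>i. \<alpha> i \<le> 2" for w \<alpha>
  proof -
    define c where "c = complex_of_real (\<Prod>i\<in>UNIV. (- 1) ^ \<alpha> i) * \<gamma>"
    note [measurable] = L2_measurable[OF w]
    have [measurable]: "heat s \<beta> \<in> borel_measurable borel" for s and \<beta> :: "'n \<Rightarrow> nat"
      unfolding heat_def tensor_def[abs_def] by measurable
    have T_le: "\<bar>T m \<alpha> y\<bar> \<le> K ^ CARD('n) * heat (4 * r) ord0 (x - y)" for m y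
    proof -
      have "(\<Prod>i\<in>UNIV. \<bar>D m (\<alpha> i) (x $ i) (y $ i)\<bar>) \<le> (\<Prod>i\<in>(UNIV::'n set). K * gauss (4 * r) 0 (x $ i - y $ i))"
        by (intro prod_mono) (auto intro: bound)
      then show ?thesis by (simp add: T_def tensor_def abs_prod heat_def prod.distrib)
    qed
    have T_lim: "(\<lambda>m. complex_of_real (T m \<alpha> y)) \<longlonglongrightarrow> c * of_real (heat r \<alpha> (x - y))" for y
    proof -
      have "(\<lambda>m. T m \<alpha> y) \<longlonglongrightarrow> (\<Prod>i\<in>UNIV. (-1) ^ \<alpha> i * cutoff 0 * gauss r (\<alpha> i) (x $ i - y $ i))"
        unfolding T_def tensor_def by (intro tendsto_prod lim \<alpha>)
      then have "(\<lambda>m. complex_of_real (T m \<alpha> y)) \<longlonglongrightarrow>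
          complex_of_real (\<Prod>i\<in>UNIV. (-1) ^ \<alpha> i * cutoff 0 * gauss r (\<alpha> i) (x $ i - y $ i))"
        by (rule tendsto_of_real)
      then show ?thesis
        by (simp add: prod.distrib heat_def tensor_def c_def \<gamma>_def)
    qed
    have T_meas: "T m \<alpha> \<in> borel_measurable borel" for m
      unfolding T_def tensor_def[abs_def] by measurable
    have "(\<lambda>m. \<integral>y. w y * complex_of_real (T m \<alpha> y) \<partial>lborel) \<longlonglongrightarrow> (\<integral>y. w y * (c * of_real (heat r \<alpha> (x - y))) \<partial>lborel)"
    proof (rule integral_dominated_convergence[where w="\<lambda>y. K ^ CARD('n) * norm (heat (4 * r) ord0 (x - y) *\<^sub>R w y)"])
      show "integrable lborel (\<lambda>y. K ^ CARD('n) * norm (heat (4 * r) ord0 (x - y) *\<^sub>R w y))"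
        by (intro integrable_mult_right integrable_norm conv_integrable kernel_heat w) (use r in simp)
      show "AE y in lborel. norm (w y * complex_of_real (T m \<alpha> y)) \<le> K ^ CARD('n) * norm (heat (4 * r) ord0 (x - y) *\<^sub>R w y)" for m
      proof (rule AE_I2)
        fix y
        have "norm (w y * complex_of_real (T m \<alpha> y)) = \<bar>T m \<alpha> y\<bar> * norm (w y)" by (simp add: norm_mult)
        also have "\<dots> \<le> (K ^ CARD('n) * heat (4 * r) ord0 (x - y)) * norm (w y)" by (intro mult_right_mono T_le) simp
        also have "\<dots> = K ^ CARD('n) * norm (heat (4 * r) ord0 (x - y) *\<^sub>R w y)"
          using heat_pos[of "4 * r" "x - y"] r by simp
        finally show "norm (w y * complex_of_real (T m \<alpha> y)) \<le> K ^ CARD('n) * norm (heat (4 * r) ord0 (x - y) *\<^sub>R w y)" .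
      qed
      show "AE y in lborel. (\<lambda>m. w y * complex_of_real (T m \<alpha> y)) \<longlonglongrightarrow> w y * (c * of_real (heat r \<alpha> (x - y)))"
        by (intro AE_I2 tendsto_intros T_lim)
    qed (use T_meas in measurable)
    moreover have "(\<integral>y. w y * (c * of_real (heat r \<alpha> (x - y))) \<partial>lborel) = c * conv (heat r \<alpha>) w x"
      unfolding conv_def by (subst integral_mult_right_zero[symmetric]) (simp add: scaleR_conv_of_real mult_ac)
    ultimately show ?thesis unfolding distr_of_def c_def by simp
  qed
  show thesis
  proof (rule that[of \<gamma> "\<lambda>m y. complex_of_real (T m ord0 y)"])
    show "\<gamma> \<noteq> 0" using cutoff_0 by (simp add: \<gamma>_def)
    show "(\<lambda>y. complex_of_real (T m ord0 y)) \<in> test_functions" for m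
      unfolding T_def by (rule tensor_test_function[of _ "R m"]) (auto intro: smooth supp)
    fix w :: "real^'n \<Rightarrow> complex" and i j assume w: "w \<in> L2"
    show "(\<lambda>m. distr_of w (\<lambda>y. complex_of_real (T m ord0 y))) \<longlonglongrightarrow> \<gamma> * conv (heat r ord0) w x"
      using limit[OF w, of ord0] by simp
    have p1: "partial j (\<lambda>y. complex_of_real (T m ord0 y)) = (\<lambda>y. complex_of_real (T m (ord1 j) y))" for m j
      using partial_T[of ord0 j m] by simp
    have p2: "partial j (\<lambda>y. complex_of_real (T m (ord1 i) y)) = (\<lambda>y. complex_of_real (T m (ord2 i j) y))" for m
      using partial_T[OF ord1_le] by (simp add: ord2_def)
    have le: "ord1 j l \<le> 2" "ord2 i j l \<le> 2" for l
      using ord1_le[of i l] ord1_le[of j l] by (auto simp: ord2_def)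
    \<comment> \<open>The minus sign in \<open>distr_partial\<close> cancels the one from
      differentiating \<open>x - y\<close> in \<open>y\<close>.\<close>
    show "(\<lambda>m. distr_partial j (distr_of w) (\<lambda>y. complex_of_real (T m ord0 y))) \<longlonglongrightarrow> \<gamma> * conv (heat r (ord1 j)) w x"
      using tendsto_minus[OF limit[OF w, of "ord1 j", OF le(1)]] by (simp add: distr_partial_def p1 prod_ord1)
    show "(\<lambda>m. distr_partial i (distr_partial j (distr_of w)) (\<lambda>y. complex_of_real (T m ord0 y)))
        \<longlonglongrightarrow> \<gamma> * conv (heat r (ord2 i j)) w x"
      using limit[OF w, of "ord2 i j", OF le(2)] by (simp add: distr_partial_def p1 p2 ord2_def power_add prod.distrib prod_ord1)
  qed
qed

section \<open>Energy inequality\<close>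

text \<open>The finite sum \<open>L_op\<close> is tested along the approximating sequence, the limit
  is taken term by term, and the common factor \<open>\<gamma>\<close> is cancelled. A
  distributional identity thus becomes a pointwise one between smooth representatives.\<close>

lemma smoothed_equation:
  fixes w w' :: "real^'n::finite \<Rightarrow> complex"
  assumes r: "r > 0" and w: "w \<in> L2" "w' \<in> L2"
    and eq: "\<And>\<phi>. \<phi> \<in> test_functions \<Longrightarrow> L_op a b c t w w' \<phi> = 0"
  shows "conv (heat r ord0) w' x
     + (\<Sum>i\<in>UNIV. \<Sum>j\<in>UNIV. complex_of_real (a i j t) * conv (heat r (ord2 i j)) w x)
     + (\<Sum>j\<in>UNIV. b j t * conv (heat r (ord1 j)) w x) + c t * conv (heat r ord0) w x = 0" (is "?E = 0")
proof (rule heat_test_functions[OF r, of x])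
  fix \<gamma> :: complex and \<phi> :: "nat \<Rightarrow> real^'n \<Rightarrow> complex"
  assume \<gamma>: "\<gamma> \<noteq> 0" and \<phi>: "\<And>m. \<phi> m \<in> test_functions"
    and l0: "\<And>w. w \<in> L2 \<Longrightarrow> (\<lambda>m. distr_of w (\<phi> m)) \<longlonglongrightarrow> \<gamma> * conv (heat r ord0) w x"
    and l1: "\<And>w j. w \<in> L2 \<Longrightarrow> (\<lambda>m. distr_partial j (distr_of w) (\<phi> m)) \<longlonglongrightarrow> \<gamma> * conv (heat r (ord1 j)) w x"
    and l2: "\<And>w i j. w \<in> L2 \<Longrightarrow>
      (\<lambda>m. distr_partial i (distr_partial j (distr_of w)) (\<phi> m)) \<longlonglongrightarrow> \<gamma> * conv (heat r (ord2 i j)) w x"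
  have "(\<lambda>m. L_op a b c t w w' (\<phi> m)) \<longlonglongrightarrow> \<gamma> * conv (heat r ord0) w' x
     + (\<Sum>i\<in>UNIV. \<Sum>j\<in>UNIV. complex_of_real (a i j t) * (\<gamma> * conv (heat r (ord2 i j)) w x))
     + (\<Sum>j\<in>UNIV. b j t * (\<gamma> * conv (heat r (ord1 j)) w x)) + c t * (\<gamma> * conv (heat r ord0) w x)"
    unfolding L_op_def by (intro tendsto_add tendsto_sum tendsto_mult_left l0 l1 l2 w)
  also have "\<gamma> * conv (heat r ord0) w' x
     + (\<Sum>i\<in>UNIV. \<Sum>j\<in>UNIV. complex_of_real (a i j t) * (\<gamma> * conv (heat r (ord2 i j)) w x))
     + (\<Sum>j\<in>UNIV. b j t * (\<gamma> * conv (heat r (ord1 j)) w x)) + c t * (\<gamma> * conv (heat r ord0) w x) = \<gamma> * ?E"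
    by (simp add: distrib_left sum_distrib_left mult.left_commute)
  finally have "(\<lambda>m. 0) \<longlonglongrightarrow> \<gamma> * ?E" by (simp add: eq[OF \<phi>])
  from LIMSEQ_unique[OF this tendsto_const] \<gamma> show "?E = 0" by simp
qed

text \<open>Ellipticity concerns real vectors, the \<open>Z i\<close> are complex. Pointwise,
  \<open>Re (Z i x * cnj (Z j x))\<close> splits into the products of the real parts and of the
  imaginary parts, so the real bounds apply to both vectors separately and are then
  integrated.\<close>

lemma quadratic_form_bounds:
  fixes Z :: "'n::finite \<Rightarrow> real^'n \<Rightarrow> complex" and A :: "'n \<Rightarrow> 'n \<Rightarrow> real"
  assumes Z: "\<And>i. Z i \<in> L2"
    and ell: "\<And>\<xi>::real^'n. k * (norm \<xi>)\<^sup>2 \<le> (\<Sum>i\<in>UNIV. \<Sum>j\<in>UNIV. A i j * (\<xi> $ i) * (\<xi> $ j))"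
      "\<And>\<xi>::real^'n. (\<Sum>i\<in>UNIV. \<Sum>j\<in>UNIV. A i j * (\<xi> $ i) * (\<xi> $ j)) \<le> K * (norm \<xi>)\<^sup>2"
  shows "k * (\<Sum>j\<in>UNIV. (L2_norm (Z j))\<^sup>2) \<le> Re (\<Sum>i\<in>UNIV. \<Sum>j\<in>UNIV. complex_of_real (A i j) * ip (Z i) (Z j))"
    and "Re (\<Sum>i\<in>UNIV. \<Sum>j\<in>UNIV. complex_of_real (A i j) * ip (Z i) (Z j)) \<le> K * (\<Sum>j\<in>UNIV. (L2_norm (Z j))\<^sup>2)"
proof -
  define q where "q x = (\<Sum>i\<in>UNIV. \<Sum>j\<in>UNIV. A i j * Re (Z i x * cnj (Z j x)))" for x
  define n where "n x = (\<Sum>j\<in>UNIV. (norm (Z j x))\<^sup>2)" for x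
  have int: "integrable lborel (\<lambda>x. Re (Z i x * cnj (Z j x)))" for i j
    by (intro integrable_Re ip_integrable Z)
  have re: "(\<integral>x. Re (Z i x * cnj (Z j x)) \<partial>lborel) = Re (ip (Z i) (Z j))" for i j
    unfolding ip_def by (rule integral_Re[OF ip_integrable[OF Z Z]])
  have q: "integrable lborel q" "(\<integral>x. q x \<partial>lborel) = Re (\<Sum>i\<in>UNIV. \<Sum>j\<in>UNIV. complex_of_real (A i j) * ip (Z i) (Z j))"
    unfolding q_def[abs_def] using int by (simp_all add: re del: times_complex.sel, simp)
  have n: "integrable lborel n" "(\<integral>x. n x \<partial>lborel) = (\<Sum>j\<in>UNIV. (L2_norm (Z j))\<^sup>2)"
    unfolding n_def[abs_def] L2_norm_sq using L2_integrable[OF Z] by auto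
  have nsq: "(norm \<xi>)\<^sup>2 = (\<Sum>i\<in>UNIV. (\<xi> $ i)\<^sup>2)" for \<xi> :: "real^'n"
    unfolding power2_norm_eq_inner inner_vec_def by (simp add: power2_eq_square)
  have qn: "k * n x \<le> q x" "q x \<le> K * n x" for x
  proof -
    define \<xi> \<eta> :: "real^'n" where "\<xi> = (\<chi> i. Re (Z i x))" and "\<eta> = (\<chi> i. Im (Z i x))"
    have "q x = (\<Sum>i\<in>UNIV. \<Sum>j\<in>UNIV. A i j * (\<xi> $ i) * (\<xi> $ j)) + (\<Sum>i\<in>UNIV. \<Sum>j\<in>UNIV. A i j * (\<eta> $ i) * (\<eta> $ j))"
      unfolding q_def sum.distrib[symmetric] by (intro sum.cong refl) (simp add: \<xi>_def \<eta>_def algebra_simps)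
    moreover have "n x = (norm \<xi>)\<^sup>2 + (norm \<eta>)\<^sup>2"
      unfolding n_def nsq sum.distrib[symmetric] by (intro sum.cong refl) (simp add: \<xi>_def \<eta>_def cmod_power2)
    ultimately show "k * n x \<le> q x" "q x \<le> K * n x"
      using ell[of \<xi>] ell[of \<eta>] by (auto simp: distrib_left)
  qed
  have "(\<integral>x. k * n x \<partial>lborel) \<le> (\<integral>x. q x \<partial>lborel)" "(\<integral>x. q x \<partial>lborel) \<le> (\<integral>x. K * n x \<partial>lborel)"
    by (intro integral_mono integrable_mult_right q n qn)+
  then show "k * (\<Sum>j\<in>UNIV. (L2_norm (Z j))\<^sup>2) \<le> Re (\<Sum>i\<in>UNIV. \<Sum>j\<in>UNIV. complex_of_real (A i j) * ip (Z i) (Z j))"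
    "Re (\<Sum>i\<in>UNIV. \<Sum>j\<in>UNIV. complex_of_real (A i j) * ip (Z i) (Z j)) \<le> K * (\<Sum>j\<in>UNIV. (L2_norm (Z j))\<^sup>2)"
    using n q by auto
qed

text \<open>The squared \<open>L2\<close> norm of the gradient of the smoothed function, with the
  derivative carried by the kernel.\<close>

definition dirichlet :: "real \<Rightarrow> (real^'n::finite \<Rightarrow> complex) \<Rightarrow> real" where
  "dirichlet r w = (\<Sum>j\<in>UNIV. (L2_norm (conv (heat r (ord1 j)) w))\<^sup>2)"

text \<open>Each of the first-order terms leaves \<open>M\<^sup>2 / (2 * k)\<close> after half of
  the ellipticity has been spent on it, and the zeroth-order term costs \<open>M\<close>. The type
  argument carries the dimension.\<close>

definition growth_const :: "'n::finite itself \<Rightarrow> real \<Rightarrow> real \<Rightarrow> real" where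
  "growth_const _ k M = real CARD('n) * (M\<^sup>2 / (2 * k)) + M"

text \<open>Inserting the smoothed equation for \<open>Y\<close> and integrating by parts gives
  \<open>Re P - Re Rm\<close>. Here \<open>Re P\<close> is the coefficient form, between
  \<open>k\<close> and \<open>inverse k\<close> times the Dirichlet energy, and the lower-order
  remainder \<open>Rm\<close> costs at most \<open>k / 2\<close> of that energy plus a multiple of
  the norm of \<open>X\<close>.\<close>

lemma energy_inequality:
  fixes w w' :: "real^'n::finite \<Rightarrow> complex"
  assumes r: "r > 0" and w: "w \<in> L2" "w' \<in> L2"
    and eq: "\<And>\<phi>. \<phi> \<in> test_functions \<Longrightarrow> L_op a b c t w w' \<phi> = 0"
    and k: "0 < k" "k < 1" and ell: "backward_parabolic T k a" "t \<in> {0..T}"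
    and b: "\<And>j. norm (b j t) \<le> M" and c: "norm (c t) \<le> M"
  shows "k / 2 * dirichlet r w - growth_const TYPE('n) k M * (L2_norm (conv (heat r ord0) w))\<^sup>2
           \<le> Re (ip (conv (heat r ord0) w) (conv (heat r ord0) w'))" (is ?lower)
    and "Re (ip (conv (heat r ord0) w) (conv (heat r ord0) w'))
           \<le> 2 / k * dirichlet r w + growth_const TYPE('n) k M * (L2_norm (conv (heat r ord0) w))\<^sup>2" (is ?upper)
proof -
  define X Y where "X = conv (heat r ord0) w" and "Y = conv (heat r ord0) w'"
  define Z W where "Z j = conv (heat r (ord1 j)) w" and "W i j = conv (heat r (ord2 i j)) w" for i j
  have L2s [simp]: "X \<in> L2" "Y \<in> L2" "Z j \<in> L2" "W i j \<in> L2" for i j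
    unfolding X_def Y_def Z_def W_def by (intro conv_L2 kernel_heat r w)+
  have XW: "ip X (W i j) = - ip (Z i) (Z j)" for i j
    unfolding X_def W_def Z_def by (rule ip_heat_parts[OF r w(1)])
  define P where "P = (\<Sum>i\<in>UNIV. \<Sum>j\<in>UNIV. complex_of_real (a i j t) * ip (Z i) (Z j))"
  define Rm where "Rm = (\<Sum>j\<in>UNIV. cnj (b j t) * ip X (Z j)) + cnj (c t) * ip X X"
  define N where "N = (L2_norm X)\<^sup>2"
  have Y_eq: "Y = (\<lambda>x. (-1) * (((\<Sum>i\<in>UNIV. \<Sum>j\<in>UNIV. complex_of_real (a i j t) * W i j x)
     + (\<Sum>j\<in>UNIV. b j t * Z j x)) + c t * X x))"
  proof
    fix x
    have "Y x + (\<Sum>i\<in>UNIV. \<Sum>j\<in>UNIV. complex_of_real (a i j t) * W i j x)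
     + (\<Sum>j\<in>UNIV. b j t * Z j x) + c t * X x = 0"
      using smoothed_equation[OF r w eq, of x] by (simp add: X_def Y_def Z_def W_def)
    then show "Y x = (-1) * (((\<Sum>i\<in>UNIV. \<Sum>j\<in>UNIV. complex_of_real (a i j t) * W i j x)
     + (\<Sum>j\<in>UNIV. b j t * Z j x)) + c t * X x)" by (simp add: add_eq_0_iff algebra_simps)
  qed
  have "ip X Y = - ((\<Sum>i\<in>UNIV. \<Sum>j\<in>UNIV. complex_of_real (a i j t) * ip X (W i j))
     + (\<Sum>j\<in>UNIV. cnj (b j t) * ip X (Z j)) + cnj (c t) * ip X X)"
    unfolding Y_eq ip_cmult_right
    by (simp only: ip_add_right ip_sum_right ip_cmult_right L2_add L2_sum L2_cmult L2s
      complex_cnj_minus complex_cnj_one complex_cnj_complex_of_real mult_minus1)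
  then have XY: "Re (ip X Y) = Re P - Re Rm"
    by (simp add: XW P_def Rm_def sum_negf)
  have D: "dirichlet r w = (\<Sum>j\<in>UNIV. (L2_norm (Z j))\<^sup>2)" by (simp add: dirichlet_def Z_def)
  have D0: "0 \<le> dirichlet r w" unfolding D by (intro sum_nonneg) simp
  have P: "k * dirichlet r w \<le> Re P" "Re P \<le> inverse k * dirichlet r w"
    unfolding P_def D
    by (rule quadratic_form_bounds; use L2s ell in \<open>auto simp: backward_parabolic_def\<close>)+
  have M: "0 \<le> M" using c norm_ge_zero[of "c t"] by linarith
  have "norm Rm \<le> (\<Sum>j\<in>UNIV. norm (cnj (b j t) * ip X (Z j))) + norm (cnj (c t) * ip X X)"
    unfolding Rm_def by (intro order_trans[OF norm_triangle_ineq] add_right_mono norm_sum)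
  also have "\<dots> \<le> (\<Sum>j::'n\<in>UNIV. k / 2 * (L2_norm (Z j))\<^sup>2 + M\<^sup>2 / (2 * k) * N) + M * N"
  proof (intro add_mono sum_mono)
    fix j
    have "norm (cnj (b j t) * ip X (Z j)) \<le> M * (L2_norm X * L2_norm (Z j))"
      unfolding norm_mult complex_mod_cnj by (intro mult_mono b L2_Cauchy_Schwarz L2s M norm_ge_zero)
    also have "\<dots> \<le> k / 2 * (L2_norm (Z j))\<^sup>2 + M\<^sup>2 / (2 * k) * N"
    proof -
      \<comment> \<open>Young's inequality by completing the square, weighted so that each
        \<open>Z j\<close> costs exactly \<open>k / 2\<close>.\<close>
      have "0 \<le> (k * L2_norm (Z j) - M * L2_norm X)\<^sup>2 / (2 * k)" using k by simp
      also have "\<dots> = k / 2 * (L2_norm (Z j))\<^sup>2 + M\<^sup>2 / (2 * k) * N - M * (L2_norm X * L2_norm (Z j))"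
        using k by (simp add: N_def power2_eq_square field_simps)
      finally show ?thesis by simp
    qed
    finally show "norm (cnj (b j t) * ip X (Z j)) \<le> k / 2 * (L2_norm (Z j))\<^sup>2 + M\<^sup>2 / (2 * k) * N" .
  next
    show "norm (cnj (c t) * ip X X) \<le> M * N"
      unfolding norm_mult complex_mod_cnj ip_self N_def norm_of_real by (intro mult_mono c M) auto
  qed
  also have "\<dots> = k / 2 * dirichlet r w + growth_const TYPE('n) k M * N"
    by (simp add: sum.distrib D growth_const_def sum_distrib_left algebra_simps)
  finally have R: "\<bar>Re Rm\<bar> \<le> k / 2 * dirichlet r w + growth_const TYPE('n) k M * N"
    using abs_Re_le_cmod[of Rm] by linarith
  \<comment> \<open>Because \<open>k < 1\<close>, the total \<open>inverse k + k / 2\<close> fits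
    below \<open>2 / k\<close>; on the lower side \<open>k - k / 2\<close> remains.\<close>
  have "k \<le> inverse k" using one_less_inverse[of k] k by linarith
  then have "k / 2 * dirichlet r w \<le> inverse k * dirichlet r w"
    by (intro mult_right_mono D0) (use k in linarith)
  moreover have "2 / k * dirichlet r w = inverse k * dirichlet r w + inverse k * dirichlet r w"
    by (simp add: divide_inverse)
  moreover have "k / 2 * dirichlet r w + k / 2 * dirichlet r w = k * dirichlet r w" by simp
  ultimately show ?lower ?upper
    using P R unfolding X_def[symmetric] Y_def[symmetric] XY N_def[symmetric] by linarith+
qed

section \<open>Continuity in time, and passage from almost every time to every time\<close>

lemma L2_norm_tendsto:
  assumes f: "\<forall>\<^sub>F s in F. f s \<in> L2" "f0 \<in> L2" and lim: "((\<lambda>s. L2_norm (\<lambda>x. f s x - f0 x)) \<longlongrightarrow> 0) F"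
  shows "((\<lambda>s. L2_norm (f s)) \<longlongrightarrow> L2_norm f0) F"
proof -
  have "((\<lambda>s. L2_norm (f s) - L2_norm f0) \<longlongrightarrow> 0) F"
    by (rule Lim_null_comparison[OF _ lim])
      (use f(1) in \<open>eventually_elim, use L2_triangle_diff[OF _ f(2)] in simp\<close>)
  then show ?thesis by (simp add: LIM_zero_iff)
qed

lemma ip_tendsto:
  assumes f: "\<forall>\<^sub>F s in F. f s \<in> L2" "f0 \<in> L2" "((\<lambda>s. L2_norm (\<lambda>x. f s x - f0 x)) \<longlongrightarrow> 0) F"
    and g: "\<forall>\<^sub>F s in F. g s \<in> L2" "g0 \<in> L2" "((\<lambda>s. L2_norm (\<lambda>x. g s x - g0 x)) \<longlongrightarrow> 0) F"
  shows "((\<lambda>s. ip (f s) (g s)) \<longlongrightarrow> ip f0 g0) F"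
proof -
  have "((\<lambda>s. L2_norm (\<lambda>x. f s x - f0 x) * L2_norm (g s) + L2_norm f0 * L2_norm (\<lambda>x. g s x - g0 x))
      \<longlongrightarrow> 0 * L2_norm g0 + L2_norm f0 * 0) F"
    by (intro tendsto_intros f g L2_norm_tendsto)
  then have lim: "((\<lambda>s. L2_norm (\<lambda>x. f s x - f0 x) * L2_norm (g s) + L2_norm f0 * L2_norm (\<lambda>x. g s x - g0 x)) \<longlongrightarrow> 0) F"
    by simp
  have "((\<lambda>s. ip (f s) (g s) - ip f0 g0) \<longlongrightarrow> 0) F"
  proof (rule Lim_null_comparison[OF _ lim])
    show "\<forall>\<^sub>F s in F. norm (ip (f s) (g s) - ip f0 g0)
      \<le> L2_norm (\<lambda>x. f s x - f0 x) * L2_norm (g s) + L2_norm f0 * L2_norm (\<lambda>x. g s x - g0 x)"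
      using f(1) g(1)
    proof eventually_elim
      case (elim s)
      then have "ip (f s) (g s) - ip f0 g0 = ip (\<lambda>x. f s x - f0 x) (g s) + ip f0 (\<lambda>x. g s x - g0 x)"
        using f(2) g(2) by (simp add: ip_diff_left ip_diff_right)
      then show ?case
        using elim f(2) g(2)
        by (auto intro!: order_trans[OF norm_triangle_ineq] add_mono L2_Cauchy_Schwarz L2_diff)
    qed
  qed
  then show ?thesis by (simp add: LIM_zero_iff)
qed

lemma conv_diff_tendsto:
  assumes k: "conv_kernel k" and f: "\<forall>\<^sub>F s in F. f s \<in> L2" "f0 \<in> L2"
    and lim: "((\<lambda>s. L2_norm (\<lambda>x. f s x - f0 x)) \<longlongrightarrow> 0) F"
  shows "((\<lambda>s. L2_norm (\<lambda>x. conv k (f s) x - conv k f0 x)) \<longlongrightarrow> 0) F"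
proof (rule Lim_null_comparison[OF _ tendsto_mult_right_zero[OF lim, of "\<integral>y. \<bar>k y\<bar> \<partial>lborel"]])
  show "\<forall>\<^sub>F s in F. norm (L2_norm (\<lambda>x. conv k (f s) x - conv k f0 x))
      \<le> (\<integral>y. \<bar>k y\<bar> \<partial>lborel) * L2_norm (\<lambda>x. f s x - f0 x)"
    using f(1)
  proof eventually_elim
    case (elim s)
    have "(\<lambda>x. conv k (f s) x - conv k f0 x) = conv k (\<lambda>x. f s x - f0 x)"
      using conv_diff_right[OF k elim f(2)] by auto
    then show ?case using conv_L2_norm_le[OF k L2_diff[OF elim f(2)]] by simp
  qed
qed

lemma dirichlet_tendsto:
  assumes "r > 0" "\<forall>\<^sub>F s in F. f s \<in> L2" "f0 \<in> L2" "((\<lambda>s. L2_norm (\<lambda>x. f s x - f0 x)) \<longlongrightarrow> 0) F"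
  shows "((\<lambda>s. dirichlet r (f s)) \<longlongrightarrow> dirichlet r f0) F"
  unfolding dirichlet_def
proof (intro tendsto_sum tendsto_power L2_norm_tendsto conv_diff_tendsto kernel_heat assms)
  fix j
  show "\<forall>\<^sub>F s in F. conv (heat r (ord1 j)) (f s) \<in> L2"
    using assms(2) by eventually_elim (intro conv_L2 kernel_heat assms(1))
qed (intro conv_L2 kernel_heat assms)

text \<open>\<open>H0_space\<close> and \<open>is_solution\<close> each assert the existence of some
  time derivative, and the two witnesses have to be identified. As representatives of classes they
  agree only up to a null set, hence the norm of the difference. No point of \<open>{0..<T}\<close>
  is isolated, so the limits are meaningful.\<close>

lemma has_L2_derivative_unique:
  assumes v: "has_L2_derivative_on u v1 {0..<T}" "has_L2_derivative_on u v2 {0..<T}" and t: "t \<in> {0..<T}"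
  shows "L2_norm (\<lambda>x. v1 t x - v2 t x) = 0"
proof -
  define q where "q s = (\<lambda>x. (u s x - u t x) / complex_of_real (s - t))" for s
  have L2: "u s \<in> L2" if "s \<in> {0..<T}" for s using v(1) that by (auto simp: has_L2_derivative_on_def)
  have vL2: "v1 t \<in> L2" "v2 t \<in> L2" using v t by (auto simp: has_L2_derivative_on_def)
  have q: "q s \<in> L2" if "s \<in> {0..<T}" for s
    using L2_cmult[OF L2_diff[OF L2[OF that] L2[OF t]], of "inverse (complex_of_real (s - t))"]
    by (simp add: q_def divide_inverse mult.commute)
  have lim: "((\<lambda>s. L2_norm (\<lambda>x. q s x - v1 t x) + L2_norm (\<lambda>x. q s x - v2 t x)) \<longlongrightarrow> 0) (at t within {0..<T})"
    using v t unfolding has_L2_derivative_on_def q_def by (intro tendsto_add_zero) blast+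
  have "t islimpt {0..<T}"
  proof -
    have "t islimpt {t<..<T}" using t by (intro islimpt_greaterThanLessThan1) auto
    then show ?thesis by (rule islimpt_subset) (use t in auto)
  qed
  then have nb: "at t within {0..<T} \<noteq> bot" by (simp add: trivial_limit_within)
  have "\<forall>\<^sub>F s in at t within {0..<T}. L2_norm (\<lambda>x. v1 t x - v2 t x)
      \<le> L2_norm (\<lambda>x. q s x - v1 t x) + L2_norm (\<lambda>x. q s x - v2 t x)"
    unfolding eventually_at_filter
  proof (intro always_eventually allI impI)
    fix s assume s: "s \<in> {0..<T}"
    show "L2_norm (\<lambda>x. v1 t x - v2 t x) \<le> L2_norm (\<lambda>x. q s x - v1 t x) + L2_norm (\<lambda>x. q s x - v2 t x)"
      using L2_triangle[OF L2_diff[OF vL2(1) q[OF s]] L2_diff[OF q[OF s] vL2(2)]]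
      by (simp add: L2_norm_minus_commute[of "v1 t" "q s"])
  qed
  from tendsto_le[OF nb lim tendsto_const this] show ?thesis using L2_norm_nonneg[of "\<lambda>x. v1 t x - v2 t x"] by linarith
qed

lemma AE_lebesgue_interval_ex:
  fixes a b :: real
  assumes "AE x in lebesgue. P x" "a < b" shows "\<exists>x\<in>{a<..<b}. P x"
proof (rule ccontr)
  assume *: "\<not> (\<exists>x\<in>{a<..<b}. P x)"
  from assms(1) have "AE x in lebesgue. x \<notin> {a<..<b}" by eventually_elim (use * in auto)
  then have "{a<..<b} \<in> null_sets lebesgue" by (subst (asm) AE_iff_null_sets[symmetric]) auto
  then have "emeasure lborel {a<..<b} = 0" by (auto simp: null_sets_def)
  with assms(2) show False by simp
qed

text \<open>A negative value at \<open>t\<close> would persist on an interval to the right of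
  \<open>t\<close>, which has positive measure.\<close>

lemma nonneg_of_AE_nonneg:
  fixes f :: "real \<Rightarrow> real"
  assumes ae: "AE s in lebesgue. s \<in> {0..<T} \<longrightarrow> 0 \<le> f s" and t: "t \<in> {0..<T}"
    and lim: "(f \<longlongrightarrow> f t) (at t within {0..<T})"
  shows "0 \<le> f t"
proof (rule ccontr)
  assume "\<not> 0 \<le> f t"
  then have "\<forall>\<^sub>F s in at t within {0..<T}. f s < 0" using order_tendstoD(2)[OF lim] by simp
  then obtain d where d: "d > 0" "\<And>s. s \<in> {0..<T} \<Longrightarrow> s \<noteq> t \<Longrightarrow> dist s t < d \<Longrightarrow> f s < 0"
    unfolding eventually_at by blast
  have "t < min (t + d) T" using d(1) t by simp
  from AE_lebesgue_interval_ex[OF ae this] obtain s where "t < s" "s < t + d" "s < T" "s \<in> {0..<T} \<longrightarrow> 0 \<le> f s" by auto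
  then show False using d(2)[of s] t by (auto simp: dist_real_def)
qed

text \<open>\<open>M\<close> is an arbitrary real; the absolute value provides the nonnegative
  constant expected by \<open>growth_const\<close>.\<close>

lemma Linfty_norm_AE:
  fixes f :: "real \<Rightarrow> 'a::real_normed_vector"
  assumes "Linfty_norm T f \<le> ereal M"
  shows "AE s in lebesgue. s \<in> {0..<T} \<longrightarrow> norm (f s) \<le> \<bar>M\<bar>"
proof -
  have "AE s in lebesgue_on {0..T}. ereal (norm (f s)) \<le> Linfty_norm T f"
    unfolding Linfty_norm_def by (rule esssup_AE)
  then have "AE s in lebesgue. s \<in> {0..T} \<longrightarrow> ereal (norm (f s)) \<le> Linfty_norm T f"
    by (subst (asm) AE_restrict_space_iff) auto
  then show ?thesis
  proof eventually_elim
    case (elim s)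
    show ?case
    proof
      assume "s \<in> {0..<T}"
      with elim have "ereal (norm (f s)) \<le> Linfty_norm T f" by simp
      also note assms
      finally show "norm (f s) \<le> \<bar>M\<bar>" by simp
    qed
  qed
qed

text \<open>At almost every time the equation and the coefficient bounds hold simultaneously and
  \<open>energy_inequality\<close> applies. Its two sides involve only \<open>u\<close>, the
  continuous derivative \<open>v\<close> and constants, so they are continuous in time and the
  inequality extends to all of \<open>{0..<T}\<close>.\<close>

lemma solution_energy_inequality:
  fixes u :: "real \<Rightarrow> real^'n::finite \<Rightarrow> complex"
  assumes k: "0 < k" "k < 1" and ell: "backward_parabolic T k a"
    and b: "\<And>j. Linfty_norm T (b j) \<le> ereal M" and c: "Linfty_norm T c \<le> ereal M"
    and u: "u \<in> H0_space T" and sol: "is_solution T a b c u"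
  obtains v where "has_L2_derivative_on u v {0..<T}"
    "\<And>t r. t \<in> {0..<T} \<Longrightarrow> r > 0 \<Longrightarrow>
       k / 2 * dirichlet r (u t) - growth_const TYPE('n) k \<bar>M\<bar> * (L2_norm (conv (heat r ord0) (u t)))\<^sup>2
         \<le> Re (ip (conv (heat r ord0) (u t)) (conv (heat r ord0) (v t)))"
    "\<And>t r. t \<in> {0..<T} \<Longrightarrow> r > 0 \<Longrightarrow>
       Re (ip (conv (heat r ord0) (u t)) (conv (heat r ord0) (v t)))
         \<le> 2 / k * dirichlet r (u t) + growth_const TYPE('n) k \<bar>M\<bar> * (L2_norm (conv (heat r ord0) (u t)))\<^sup>2"
proof -
  from u obtain v where v: "has_L2_derivative_on u v {0..<T}" "continuous_into L2 L2_norm {0..<T} v"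
    and uc: "continuous_into L2 L2_norm {0..T} u" by (auto simp: H0_space_def)
  from sol obtain v2 where v2: "has_L2_derivative_on u v2 {0..<T}"
    and eq: "AE t in lebesgue_on {0..<T}. \<forall>\<phi>\<in>test_functions. L_op a b c t (u t) (v2 t) \<phi> = 0"
    by (auto simp: is_solution_def)
  have L2s: "u t \<in> L2" "v t \<in> L2" "v2 t \<in> L2" if "t \<in> {0..<T}" for t
    using v v2 that by (auto simp: has_L2_derivative_on_def)
  \<comment> \<open>\<open>lo\<close> and \<open>up\<close> are the slacks of the two inequalities;
    their continuity in time is what carries nonnegativity over the exceptional null set.\<close>
  define lo where "lo r t = Re (ip (conv (heat r ord0) (u t)) (conv (heat r ord0) (v t)))
      - (k / 2 * dirichlet r (u t) - growth_const TYPE('n) k \<bar>M\<bar> * (L2_norm (conv (heat r ord0) (u t)))\<^sup>2)" for r t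
  define up where "up r t = 2 / k * dirichlet r (u t) + growth_const TYPE('n) k \<bar>M\<bar> * (L2_norm (conv (heat r ord0) (u t)))\<^sup>2
      - Re (ip (conv (heat r ord0) (u t)) (conv (heat r ord0) (v t)))" for r t
  have eq': "AE t in lebesgue. t \<in> {0..<T} \<longrightarrow> (\<forall>\<phi>\<in>test_functions. L_op a b c t (u t) (v2 t) \<phi> = 0)"
    using eq by (subst (asm) AE_restrict_space_iff) auto
  have "AE t in lebesgue. \<forall>j\<in>UNIV. t \<in> {0..<T} \<longrightarrow> norm (b j t) \<le> \<bar>M\<bar>"
    by (rule AE_finite_allI) (simp, rule Linfty_norm_AE[OF b])
  with eq' Linfty_norm_AE[OF c]
  have good: "AE t in lebesgue. t \<in> {0..<T} \<longrightarrow> (\<forall>r>0. 0 \<le> lo r t \<and> 0 \<le> up r t)"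
  proof eventually_elim
    case (elim t)
    show ?case
    proof (intro impI allI)
      fix r :: real assume t: "t \<in> {0..<T}" and r: "r > 0"
      \<comment> \<open>The energy inequality is available for \<open>v2\<close>, continuity for
        \<open>v\<close>. Smoothing is a contraction, so the smoothed versions differ by a function
        of norm 0 and have equal inner products.\<close>
      have "L2_norm (conv (heat r ord0) (\<lambda>x. v t x - v2 t x)) = 0"
        using heat_contraction[OF r L2_diff[OF L2s(2,3)[OF t]]] has_L2_derivative_unique[OF v(1) v2 t]
          L2_norm_nonneg[of "conv (heat r ord0) (\<lambda>x. v t x - v2 t x)"] by linarith
      moreover have "(\<lambda>x. conv (heat r ord0) (v t) x - conv (heat r ord0) (v2 t) x) = conv (heat r ord0) (\<lambda>x. v t x - v2 t x)"
        using conv_diff_right[OF kernel_heat[OF r] L2s(2,3)[OF t]] by auto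
      ultimately have "ip (conv (heat r ord0) (u t)) (\<lambda>x. conv (heat r ord0) (v t) x - conv (heat r ord0) (v2 t) x) = 0"
        using L2_Cauchy_Schwarz[OF conv_L2[OF kernel_heat[OF r] L2s(1)[OF t]]
            conv_L2[OF kernel_heat[OF r] L2_diff[OF L2s(2,3)[OF t]]], of ord0 ord0] by simp
      then have ip: "ip (conv (heat r ord0) (u t)) (conv (heat r ord0) (v t)) = ip (conv (heat r ord0) (u t)) (conv (heat r ord0) (v2 t))"
        using L2s[OF t] by (subst (asm) ip_diff_right) (auto intro: conv_L2 kernel_heat[OF r])
      have t': "t \<in> {0..T}" using t by simp
      show "0 \<le> lo r t \<and> 0 \<le> up r t"
        unfolding lo_def up_def ip
        using energy_inequality[OF r L2s(1,3)[OF t] _ k ell t', of b c "\<bar>M\<bar>"] elim t by simp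
    qed
  qed
  have lims: "(lo r \<longlongrightarrow> lo r t) (at t within {0..<T}) \<and> (up r \<longlongrightarrow> up r t) (at t within {0..<T})"
    if t: "t \<in> {0..<T}" and r: "r > 0" for r t
  proof -
    let ?F = "at t within {0..<T}"
    have ev: "\<forall>\<^sub>F s in ?F. P s" if "\<And>s. s \<in> {0..<T} \<Longrightarrow> P s" for P
      using that by (auto simp: eventually_at_filter)
    have ul: "((\<lambda>s. L2_norm (\<lambda>x. u s x - u t x)) \<longlongrightarrow> 0) ?F"
      by (rule tendsto_within_subset[of _ _ _ "{0..T}"]) (use uc t in \<open>auto simp: continuous_into_def\<close>)
    have vl: "((\<lambda>s. L2_norm (\<lambda>x. v s x - v t x)) \<longlongrightarrow> 0) ?F"
      using v(2) t by (auto simp: continuous_into_def)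
    note cu = conv_diff_tendsto[OF kernel_heat[OF r] ev L2s(1)[OF t] ul, OF L2s(1)]
    note cv = conv_diff_tendsto[OF kernel_heat[OF r] ev L2s(2)[OF t] vl, OF L2s(2)]
    have cL2: "conv (heat r ord0) (u s) \<in> L2" "conv (heat r ord0) (v s) \<in> L2" if "s \<in> {0..<T}" for s
      by (intro conv_L2 kernel_heat r L2s that)+
    show ?thesis
      unfolding lo_def up_def
      by (intro conjI tendsto_intros dirichlet_tendsto ip_tendsto L2_norm_tendsto cu cv ul vl r L2s cL2 ev t; assumption)
  qed
  show ?thesis
  proof (rule that[OF v(1)])
    fix t r :: real assume t: "t \<in> {0..<T}" and r: "r > 0"
    have "AE t in lebesgue. t \<in> {0..<T} \<longrightarrow> 0 \<le> lo r t" "AE t in lebesgue. t \<in> {0..<T} \<longrightarrow> 0 \<le> up r t"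
      using good r by (auto elim!: eventually_mono)
    then have "0 \<le> lo r t" "0 \<le> up r t"
      using nonneg_of_AE_nonneg[OF _ t] lims[OF t r] by auto
    then show "k / 2 * dirichlet r (u t) - growth_const TYPE('n) k \<bar>M\<bar> * (L2_norm (conv (heat r ord0) (u t)))\<^sup>2
         \<le> Re (ip (conv (heat r ord0) (u t)) (conv (heat r ord0) (v t)))"
      "Re (ip (conv (heat r ord0) (u t)) (conv (heat r ord0) (v t)))
         \<le> 2 / k * dirichlet r (u t) + growth_const TYPE('n) k \<bar>M\<bar> * (L2_norm (conv (heat r ord0) (u t)))\<^sup>2"
      unfolding lo_def up_def by simp_all
  qed
qed

section \<open>Approximation of the identity\<close>

definition vanish :: "nat \<Rightarrow> real" where "vanish m = inverse (real (Suc m))"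

lemma vanish_pos [simp]: "vanish m > 0"
  by (simp add: vanish_def)

text \<open>Strong convergence of the semigroup to the identity along one fixed sequence of times.
  One sequence suffices, because the limit is taken in a bound that holds for every positive
  time.\<close>

definition heat_limit :: "(real^'n::finite \<Rightarrow> complex) \<Rightarrow> bool" where
  "heat_limit f \<longleftrightarrow> (\<lambda>m. L2_norm (\<lambda>x. conv (heat (vanish m) ord0) f x - f x)) \<longlonglongrightarrow> 0"

lemma heat_limit_add:
  fixes f g :: "real^'n::finite \<Rightarrow> complex"
  assumes fg: "f \<in> L2" "g \<in> L2" "heat_limit f" "heat_limit g"
  shows "heat_limit (\<lambda>x. f x + g x)"
  unfolding heat_limit_def
proof (rule Lim_null_comparison[OF always_eventually])
  let ?S = "\<lambda>m. conv (heat (vanish m) ord0)"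
  show "(\<lambda>m. L2_norm (\<lambda>x. ?S m f x - f x) + L2_norm (\<lambda>x. ?S m g x - g x)) \<longlonglongrightarrow> 0"
    using fg(3,4) unfolding heat_limit_def by (rule tendsto_add_zero)
  show "\<forall>m. norm (L2_norm (\<lambda>x. ?S m (\<lambda>x. f x + g x) x - (f x + g x)))
      \<le> L2_norm (\<lambda>x. ?S m f x - f x) + L2_norm (\<lambda>x. ?S m g x - g x)"
  proof
    fix m
    have k: "conv_kernel (heat (vanish m) ord0 :: real^'n \<Rightarrow> real)" by (rule kernel_heat) simp
    have "(\<lambda>x. ?S m (\<lambda>x. f x + g x) x - (f x + g x)) = (\<lambda>x. (?S m f x - f x) + (?S m g x - g x))"
      by (simp add: conv_add_right[OF k fg(1,2)] algebra_simps)
    then show "norm (L2_norm (\<lambda>x. ?S m (\<lambda>x. f x + g x) x - (f x + g x)))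
      \<le> L2_norm (\<lambda>x. ?S m f x - f x) + L2_norm (\<lambda>x. ?S m g x - g x)"
      using L2_triangle[OF L2_diff[OF conv_L2[OF k fg(1)] fg(1)] L2_diff[OF conv_L2[OF k fg(2)] fg(2)]] by simp
  qed
qed

lemma heat_limit_cmult:
  assumes "heat_limit f" shows "heat_limit (\<lambda>x. c * f x)"
  using tendsto_mult_right_zero[OF assms[unfolded heat_limit_def], of "norm c"]
  unfolding heat_limit_def conv_cmult_right right_diff_distrib[symmetric] L2_norm_cmult .

text \<open>The operators are contractions uniformly in \<open>m\<close>, so approximation in
  \<open>L2\<close> is preserved by a three-epsilon argument.\<close>

lemma heat_limit_closed:
  assumes f: "f \<in> L2" and ex: "\<And>e. e > 0 \<Longrightarrow> \<exists>g\<in>L2. heat_limit g \<and> L2_norm (\<lambda>x. f x - g x) < e"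
  shows "heat_limit f"
  unfolding heat_limit_def
proof (rule LIMSEQ_I)
  let ?S = "\<lambda>m. conv (heat (vanish m) ord0)"
  fix e :: real assume "e > 0"
  then obtain g where g: "g \<in> L2" "heat_limit g" "L2_norm (\<lambda>x. f x - g x) < e / 3" using ex[of "e / 3"] by auto
  have "\<forall>\<^sub>F m in sequentially. L2_norm (\<lambda>x. ?S m g x - g x) < e / 3"
    using g(2) \<open>e > 0\<close> unfolding heat_limit_def by (intro order_tendstoD) auto
  then obtain N where N: "\<And>m. m \<ge> N \<Longrightarrow> L2_norm (\<lambda>x. ?S m g x - g x) < e / 3"
    unfolding eventually_sequentially by auto
  have "L2_norm (\<lambda>x. ?S m f x - f x) < e" if "m \<ge> N" for m
  proof -
    have r: "vanish m > 0" by simp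
    note k = kernel_heat[OF r, of ord0]
    let ?a = "\<lambda>x. ?S m (\<lambda>x. f x - g x) x" and ?b = "\<lambda>x. ?S m g x - g x" and ?c = "\<lambda>x. g x - f x"
    have L2s: "?a \<in> L2" "?b \<in> L2" "?c \<in> L2" by (intro conv_L2 L2_diff k f g)+
    have "(\<lambda>x. ?S m f x - f x) = (\<lambda>x. ?a x + (?b x + ?c x))"
      by (simp add: conv_diff_right[OF k f g(1)])
    then have "L2_norm (\<lambda>x. ?S m f x - f x) \<le> L2_norm ?a + (L2_norm ?b + L2_norm ?c)"
      using L2_triangle[OF L2s(1) L2_add[OF L2s(2,3)]] L2_triangle[OF L2s(2,3)] by simp
    moreover have "L2_norm ?a \<le> L2_norm (\<lambda>x. f x - g x)"
      by (rule heat_contraction[OF r L2_diff[OF f g(1)]])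
    ultimately show ?thesis using g(3) N[OF that] by (simp add: L2_norm_minus_commute[of g f])
  qed
  then show "\<exists>N. \<forall>m\<ge>N. norm (L2_norm (\<lambda>x. ?S m f x - f x) - 0) < e" by auto
qed

lemma gauss_widen:
  assumes "r > 0" shows "gauss r 0 t = sqrt 2 * exp (- t\<^sup>2 / (8 * r)) * gauss (2 * r) 0 t"
proof -
  have "exp (- t\<^sup>2 / (4 * r)) = exp (- t\<^sup>2 / (8 * r)) * exp (- t\<^sup>2 / (4 * (2 * r)))"
    by (simp flip: exp_add)
  moreover have "sqrt (4 * pi * (2 * r)) = sqrt 2 * sqrt (4 * pi * r)"
    by (simp flip: real_sqrt_mult)
  ultimately show ?thesis using assms by (simp add: gauss_def)
qed

text \<open>Half of the exponent is split off and the rest is a Gaussian of doubled time. The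
  split-off factor is exponentially small away from the origin, and the remaining kernel still has
  total mass 1.\<close>

lemma heat_widen:
  fixes x :: "real^'n::finite"
  assumes "r > 0"
  shows "heat r ord0 x = sqrt 2 ^ CARD('n) * exp (- (norm x)\<^sup>2 / (8 * r)) * heat (2 * r) ord0 x"
proof -
  have "exp (- (norm x)\<^sup>2 / (8 * r)) = (\<Prod>i\<in>UNIV. exp (- (x $ i)\<^sup>2 / (8 * r)))"
  proof -
    have "(norm x)\<^sup>2 = (\<Sum>i\<in>UNIV. (x $ i)\<^sup>2)"
      unfolding power2_norm_eq_inner inner_vec_def by (simp add: power2_eq_square)
    then have "- (norm x)\<^sup>2 / (8 * r) = (\<Sum>i\<in>UNIV. - (x $ i)\<^sup>2 / (8 * r))"
      by (simp add: sum_divide_distrib sum_negf)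
    then show ?thesis by (simp only: exp_sum finite)
  qed
  moreover have "heat r ord0 x = (\<Prod>i\<in>UNIV. sqrt 2 * exp (- (x $ i)\<^sup>2 / (8 * r)) * gauss (2 * r) 0 (x $ i))"
    unfolding heat_def tensor_def using gauss_widen[OF assms] by simp
  ultimately show ?thesis by (simp add: prod.distrib heat_def tensor_def)
qed

text \<open>The mass missing from 1 lies outside a ball of radius \<open>d\<close> around
  \<open>x\<close>. There \<open>heat_widen\<close> bounds the kernel by the small constant
  \<open>c m\<close> times a kernel of mass 1.\<close>

lemma heat_tail:
  fixes x :: "real^'n::finite"
  assumes U: "open U" "x \<in> U"
  shows "(\<lambda>m. \<integral>y. heat (vanish m) ord0 (x - y) * indicat_real U y \<partial>lborel) \<longlonglongrightarrow> 1"
proof -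
  from U obtain d where d: "d > 0" "ball x d \<subseteq> U" using open_contains_ball by blast
  have [measurable]: "U \<in> sets borel" using U by auto
  let ?r = vanish
  let ?q = "exp (- d\<^sup>2 / 8)"
  define c where "c m = sqrt 2 ^ CARD('n) * exp (- d\<^sup>2 / (8 * ?r m))" for m
  have r: "?r m > 0" "2 * ?r m > 0" for m by simp_all
  have bound: "norm ((\<integral>y. heat (?r m) ord0 (x - y) * indicat_real U y \<partial>lborel) - 1) \<le> c m" for m
  proof -
    have int: "integrable lborel (\<lambda>y. heat s ord0 (x - y))" if "s > 0" for s
    proof -
      have "conv_kernel (heat s ord0 :: real^'n \<Rightarrow> real)" by (rule kernel_heat[OF that])
      from kernel_reflect[OF this] show ?thesis by (simp add: conv_kernel_def)
    qed
    have one: "(\<integral>y. heat s ord0 (x - y) \<partial>lborel) = 1" if "s > 0" for s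
      by (subst integral_reflect) (use integral_heat[OF that] kernel_measurable[OF kernel_heat[OF that]] in auto)
    have intU: "integrable lborel (\<lambda>y. heat (?r m) ord0 (x - y) * indicat_real U y)"
      by (rule integrable_real_mult_indicator[OF _ int[OF r(1)]]) simp
    have "(\<integral>y. heat (?r m) ord0 (x - y) * indicat_real U y \<partial>lborel) - 1
        = - (\<integral>y. heat (?r m) ord0 (x - y) * (1 - indicat_real U y) \<partial>lborel)"
      using one[OF r(1), of m] intU int[OF r(1)] by (simp add: right_diff_distrib)
    also have "norm \<dots> = (\<integral>y. heat (?r m) ord0 (x - y) * (1 - indicat_real U y) \<partial>lborel)"
    proof -
      have "0 \<le> (\<integral>y. heat (?r m) ord0 (x - y) * (1 - indicat_real U y) \<partial>lborel)"
        using less_imp_le[OF heat_pos[OF r(1)]]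
        by (intro integral_nonneg_AE AE_I2 mult_nonneg_nonneg) (auto simp: indicator_def)
      then show ?thesis by simp
    qed
    also have "\<dots> \<le> (\<integral>y. c m * heat (2 * ?r m) ord0 (x - y) \<partial>lborel)"
    proof (rule integral_mono)
      show "integrable lborel (\<lambda>y. heat (?r m) ord0 (x - y) * (1 - indicat_real U y))"
        unfolding right_diff_distrib using int[OF r(1)] intU by (intro Bochner_Integration.integrable_diff) auto
      show "integrable lborel (\<lambda>y. c m * heat (2 * ?r m) ord0 (x - y))" using int[OF r(2)] by simp
      fix y
      show "heat (?r m) ord0 (x - y) * (1 - indicat_real U y) \<le> c m * heat (2 * ?r m) ord0 (x - y)"
      proof (cases "y \<in> U")
        case True
        then show ?thesis using heat_pos[OF r(2), of m "x - y"] by (simp add: c_def)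
      next
        case False
        then have "d \<le> norm (x - y)" using d(2) by (auto simp: dist_norm subset_iff not_less)
        then have "d\<^sup>2 \<le> (norm (x - y))\<^sup>2" using d(1) by (intro power_mono) auto
        then have "exp (- (norm (x - y))\<^sup>2 / (8 * ?r m)) \<le> exp (- d\<^sup>2 / (8 * ?r m))"
          by (simp add: divide_right_mono less_imp_le)
        then have "heat (?r m) ord0 (x - y) \<le> c m * heat (2 * ?r m) ord0 (x - y)"
          unfolding heat_widen[OF r(1), of m] c_def using heat_pos[OF r(2), of m "x - y"]
          by (intro mult_right_mono mult_left_mono) auto
        with False show ?thesis by simp
      qed
    qed
    also have "\<dots> = c m" using one[OF r(2)] by simp
    finally show ?thesis .
  qed
  have "norm ?q < 1" using d(1) by simp
  then have "(\<lambda>m. ?q ^ m) \<longlonglongrightarrow> 0" by (rule LIMSEQ_power_zero)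
  from LIMSEQ_Suc[OF this] have "(\<lambda>m. sqrt 2 ^ CARD('n) * ?q ^ (Suc m)) \<longlonglongrightarrow> 0"
    by (rule tendsto_mult_right_zero)
  \<comment> \<open>The reciprocal of \<open>vanish m\<close> is \<open>Suc m\<close>, so the
    exponential is a geometric sequence.\<close>
  moreover have c: "c m = sqrt 2 ^ CARD('n) * ?q ^ (Suc m)" for m
  proof -
    have "- d\<^sup>2 / (8 * v) = 1 / v * (- d\<^sup>2 / 8)" for v :: real by simp
    moreover have "1 / vanish m = real (Suc m)" unfolding vanish_def by (rule inverse_eq_divide[symmetric, THEN trans]) (rule inverse_inverse_eq)
    ultimately have "exp (- d\<^sup>2 / (8 * vanish m)) = exp (real (Suc m) * (- d\<^sup>2 / 8))" by metis
    also have "\<dots> = ?q ^ Suc m" by (rule exp_of_nat_mult)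
    finally show ?thesis unfolding c_def by (rule arg_cong)
  qed
  have "c = (\<lambda>m. sqrt 2 ^ CARD('n) * ?q ^ (Suc m))" by (rule ext) (rule c)
  ultimately have "c \<longlonglongrightarrow> 0" by (simp only:)
  then have "(\<lambda>m. (\<integral>y. heat (?r m) ord0 (x - y) * indicat_real U y \<partial>lborel) - 1) \<longlonglongrightarrow> 0"
    by (rule Lim_null_comparison[OF always_eventually[OF allI[OF bound]]])
  then show ?thesis by (simp add: LIM_zero_iff)
qed

lemma indicator_L2:
  assumes "A \<in> sets lborel" "emeasure lborel A < \<infinity>"
  shows "(\<lambda>x. complex_of_real (indicat_real A x)) \<in> L2"
    and "(L2_norm (\<lambda>x. complex_of_real (indicat_real A x)))\<^sup>2 = measure lborel A"
proof -
  have eq: "(\<lambda>x. (norm (complex_of_real (indicat_real A x)))\<^sup>2) = indicat_real A"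
    by (auto simp: indicator_def)
  show "(\<lambda>x. complex_of_real (indicat_real A x)) \<in> L2"
    unfolding L2_iff eq using assms by (auto simp: integrable_indicator_iff)
  show "(L2_norm (\<lambda>x. complex_of_real (indicat_real A x)))\<^sup>2 = measure lborel A"
    unfolding L2_norm_sq eq using assms by simp
qed

text \<open>By contraction, the squared distance between the smoothed indicator and the indicator is
  at most twice the defect between the measure of \<open>U\<close> and the inner product of the two.
  Hence pointwise convergence is needed only at points of \<open>U\<close>, where
  \<open>heat_tail\<close> provides it, and dominated convergence finishes.\<close>

lemma heat_limit_open:
  fixes U :: "(real^'n::finite) set"
  assumes U: "open U" "emeasure lborel U < \<infinity>"
  shows "heat_limit (\<lambda>x. complex_of_real (indicat_real U x))"
proof -
  let ?f = "\<lambda>x. complex_of_real (indicat_real U x)"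
  let ?r = vanish
  let ?S = "\<lambda>m. conv (heat (?r m) ord0) ?f"
  define p where "p m x = (\<integral>y. heat (?r m) ord0 (x - y) * indicat_real U y \<partial>lborel)" for m x
  have [measurable]: "U \<in> sets borel" using U by auto
  have f: "?f \<in> L2" by (rule indicator_L2(1)) (use U in auto)
  have r: "?r m > 0" for m by simp
  have k: "conv_kernel (heat (?r m) ord0 :: real^'n \<Rightarrow> real)" for m by (rule kernel_heat[OF r])
  note [measurable] = kernel_measurable[OF k]
  have S: "?S m x = complex_of_real (p m x)" for m x
    unfolding conv_def p_def by (subst integral_complex_of_real[symmetric]) (simp add: scaleR_conv_of_real)
  have p_le: "\<bar>p m x\<bar> \<le> 1" for m x
  proof -
    have int: "integrable lborel (\<lambda>y. heat (?r m) ord0 (x - y))"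
      using kernel_reflect[OF k] by (simp add: conv_kernel_def)
    have intU: "integrable lborel (\<lambda>y. heat (?r m) ord0 (x - y) * indicat_real U y)"
      by (rule integrable_real_mult_indicator[OF _ int]) simp
    have "p m x \<le> (\<integral>y. heat (?r m) ord0 (x - y) \<partial>lborel)"
      unfolding p_def by (intro integral_mono intU int) (use less_imp_le[OF heat_pos[OF r]] in \<open>auto simp: indicator_def\<close>)
    also have "\<dots> = 1" by (subst integral_reflect) (use integral_heat[OF r] in auto)
    finally have "p m x \<le> 1" .
    moreover have "0 \<le> p m x" unfolding p_def
      by (intro integral_nonneg_AE AE_I2 mult_nonneg_nonneg) (use less_imp_le[OF heat_pos[OF r]] in \<open>auto simp: indicator_def\<close>)
    ultimately show ?thesis by simp
  qed
  have ip_eq: "ip (?S m) ?f = complex_of_real (\<integral>x. p m x * indicat_real U x \<partial>lborel)" for m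
    unfolding ip_def by (subst integral_complex_of_real[symmetric]) (simp add: S)
  have "(\<lambda>m. \<integral>x. p m x * indicat_real U x \<partial>lborel) \<longlonglongrightarrow> (\<integral>x. indicat_real U x \<partial>lborel)"
  proof (rule integral_dominated_convergence[where w="indicat_real U"])
    show "integrable lborel (indicat_real U)" using U by (auto simp: integrable_indicator_iff)
    show "AE x in lborel. (\<lambda>m. p m x * indicat_real U x) \<longlonglongrightarrow> indicat_real U x"
      using heat_tail[OF U(1)] by (intro AE_I2) (auto simp: indicator_def p_def)
    show "AE x in lborel. norm (p m x * indicat_real U x) \<le> indicat_real U x" for m
      using p_le by (intro AE_I2) (auto simp: indicator_def)
  qed (auto simp: p_def[abs_def])
  then have lim: "(\<lambda>m. \<integral>x. p m x * indicat_real U x \<partial>lborel) \<longlonglongrightarrow> measure lborel U" by simp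
  have norm: "(L2_norm ?f)\<^sup>2 = measure lborel U" by (rule indicator_L2(2)) (use U in auto)
  \<comment> \<open>Expand the square and replace the norm of the smoothed function by that of
    \<open>?f\<close>.\<close>
  have le: "(L2_norm (\<lambda>x. ?S m x - ?f x))\<^sup>2 \<le> 2 * (measure lborel U - (\<integral>x. p m x * indicat_real U x \<partial>lborel))" for m
  proof -
    have "(L2_norm (\<lambda>x. ?S m x + (-1) * ?f x))\<^sup>2 = (L2_norm (?S m))\<^sup>2 + 2 * Re (ip (?S m) (\<lambda>x. (-1) * ?f x)) + (L2_norm (\<lambda>x. (-1) * ?f x))\<^sup>2"
      by (intro L2_norm_sq_add conv_L2 k L2_cmult f)
    also have "\<dots> = (L2_norm (?S m))\<^sup>2 - 2 * (\<integral>x. p m x * indicat_real U x \<partial>lborel) + (L2_norm ?f)\<^sup>2"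
      unfolding L2_norm_cmult ip_cmult_right ip_eq by simp
    finally have "(L2_norm (\<lambda>x. ?S m x - ?f x))\<^sup>2 = (L2_norm (?S m))\<^sup>2 - 2 * (\<integral>x. p m x * indicat_real U x \<partial>lborel) + (L2_norm ?f)\<^sup>2"
      by simp
    moreover have "(L2_norm (?S m))\<^sup>2 \<le> (L2_norm ?f)\<^sup>2" by (intro power_mono heat_contraction r f) simp
    ultimately show ?thesis using norm by simp
  qed
  have "(\<lambda>m. 2 * (measure lborel U - (\<integral>x. p m x * indicat_real U x \<partial>lborel))) \<longlonglongrightarrow> 2 * (measure lborel U - measure lborel U)"
    by (intro tendsto_intros lim)
  then have lim2: "(\<lambda>m. 2 * (measure lborel U - (\<integral>x. p m x * indicat_real U x \<partial>lborel))) \<longlonglongrightarrow> 0" by simp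
  have "(\<lambda>m. (L2_norm (\<lambda>x. ?S m x - ?f x))\<^sup>2) \<longlonglongrightarrow> 0"
    by (rule Lim_null_comparison[OF always_eventually lim2])
      (intro allI, unfold real_norm_def abs_power2, rule le)
  from tendsto_real_sqrt[OF this] show ?thesis unfolding heat_limit_def by simp
qed

text \<open>Outer regularity provides an open \<open>U\<close> containing \<open>A\<close> with a
  small difference set, whose measure is the squared \<open>L2\<close> distance of the
  indicators.\<close>

lemma heat_limit_indicator:
  fixes A :: "(real^'n::finite) set"
  assumes A: "A \<in> sets lborel" "emeasure lborel A < \<infinity>"
  shows "heat_limit (\<lambda>x. complex_of_real (indicat_real A x))"
proof (rule heat_limit_closed)
  show "(\<lambda>x. complex_of_real (indicat_real A x)) \<in> L2" by (rule indicator_L2[OF A])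
  fix e :: real assume e: "e > 0"
  have "A \<in> sets borel" using A(1) by simp
  then obtain U where U: "open U" "A \<subseteq> U" "emeasure lborel (U - A) < ennreal (e\<^sup>2)"
    using outer_regular_lborel[of A "e\<^sup>2"] e by auto
  have UA: "U - A \<in> sets lborel" "emeasure lborel (U - A) < \<infinity>"
    using U A by (auto intro: less_trans[OF U(3)])
  have "emeasure lborel U \<le> emeasure lborel A + emeasure lborel (U - A)"
    using emeasure_subadditive[OF A(1) UA(1)] U(2) by (simp add: Un_absorb1)
  also have "\<dots> < \<infinity>" using A(2) UA(2) by simp
  finally have Uf: "emeasure lborel U < \<infinity>" .
  have "(\<lambda>x. complex_of_real (indicat_real A x) - complex_of_real (indicat_real U x))
      = (\<lambda>x. (-1) * complex_of_real (indicat_real (U - A) x))"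
  proof (rule ext)
    fix x
    show "complex_of_real (indicat_real A x) - complex_of_real (indicat_real U x)
        = (-1) * complex_of_real (indicat_real (U - A) x)"
      using U(2) by (cases "x \<in> A"; cases "x \<in> U") auto
  qed
  then have "(L2_norm (\<lambda>x. complex_of_real (indicat_real A x) - complex_of_real (indicat_real U x)))\<^sup>2 = measure lborel (U - A)"
    by (simp only: L2_norm_cmult power_mult_distrib indicator_L2(2)[OF UA]) simp
  also have "\<dots> < e\<^sup>2"
    using U(3) UA(2) e by (simp add: emeasure_eq_ennreal_measure ennreal_less_iff)
  finally have "L2_norm (\<lambda>x. complex_of_real (indicat_real A x) - complex_of_real (indicat_real U x)) < e"
    by (rule power2_less_imp_less) (use e in simp)
  then show "\<exists>g\<in>L2. heat_limit g \<and> L2_norm (\<lambda>x. complex_of_real (indicat_real A x) - g x) < e"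
    using heat_limit_open[OF U(1) Uf] indicator_L2(1)[OF _ Uf] U(1) by auto
qed

text \<open>The measurable induction rule ranges over all nonnegative functions, so membership in
  \<open>L2\<close> is carried along as a premise and recovered for the pieces by domination. The
  monotone limit is taken in \<open>L2\<close> by dominated convergence.\<close>

lemma heat_limit_nonneg:
  fixes h :: "real^'n::finite \<Rightarrow> real"
  assumes h: "h \<in> borel_measurable lborel" "\<And>x. 0 \<le> h x" and L2: "(\<lambda>x. complex_of_real (h x)) \<in> L2"
  shows "heat_limit (\<lambda>x. complex_of_real (h x))"
proof -
  have "(\<lambda>x. complex_of_real (h x)) \<in> L2 \<longrightarrow> heat_limit (\<lambda>x. complex_of_real (h x))"
    using h
  proof (induction h rule: borel_measurable_induct_real)
    case (set A)
    show ?case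
    proof
      assume "(\<lambda>x. complex_of_real (indicat_real A x)) \<in> L2"
      moreover have "(\<lambda>x. (norm (complex_of_real (indicat_real A x)))\<^sup>2) = indicat_real A" by (auto simp: indicator_def)
      ultimately have "integrable lborel (indicat_real A)" by (simp only: L2_iff)
      then show "heat_limit (\<lambda>x. complex_of_real (indicat_real A x))"
        using set by (intro heat_limit_indicator) (auto simp: integrable_indicator_iff)
    qed
  next
    case (mult u c)
    show ?case
    proof
      assume cu: "(\<lambda>x. complex_of_real (c * u x)) \<in> L2"
      show "heat_limit (\<lambda>x. complex_of_real (c * u x))"
      proof (cases "c = 0")
        case True
        then show ?thesis by (simp add: heat_limit_def conv_def L2_norm_def)
      next
        case False
        then have "(\<lambda>x. complex_of_real (u x)) = (\<lambda>x. inverse (complex_of_real c) * complex_of_real (c * u x))" by auto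
        then have "(\<lambda>x. complex_of_real (u x)) \<in> L2" using L2_cmult[OF cu] by simp
        then show ?thesis using heat_limit_cmult[of "\<lambda>x. complex_of_real (u x)" "of_real c"] mult.IH by simp
      qed
    qed
  next
    case (add u v)
    show ?case
    proof
      assume *: "(\<lambda>x. complex_of_real (v x + u x)) \<in> L2"
      have le: "(u x)\<^sup>2 \<le> (norm (complex_of_real (v x + u x)))\<^sup>2" "(v x)\<^sup>2 \<le> (norm (complex_of_real (v x + u x)))\<^sup>2" for x
        unfolding norm_of_real using add.hyps(2,4) by (auto intro!: power_mono simp: abs_of_nonneg)
      have u: "(\<lambda>x. complex_of_real (u x)) \<in> L2" "(\<lambda>x. complex_of_real (v x)) \<in> L2"
        by (rule L2_dominated[OF _ L2_integrable[OF *]]; use add.hyps le in simp)+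
      then show "heat_limit (\<lambda>x. complex_of_real (v x + u x))"
        using heat_limit_add[OF u(2,1)] add.IH by simp
    qed
  next
    case (seq U)
    show ?case
    proof
      assume *: "(\<lambda>x. complex_of_real (h x)) \<in> L2"
      note [measurable] = seq.hyps(1)
      have hm [measurable]: "h \<in> borel_measurable borel"
        using borel_measurable_LIMSEQ_real[of lborel "\<lambda>i x. U i x" h] seq.hyps by simp
      have h2: "integrable lborel (\<lambda>x. (h x)\<^sup>2)" using L2_integrable[OF *] by simp
      have Uh: "U i x \<le> h x" for i x
        by (rule incseq_le[of "\<lambda>i. U i x"]) (use seq.hyps(3,4) in \<open>auto simp: incseq_def le_fun_def\<close>)
      have U: "(\<lambda>x. complex_of_real (U i x)) \<in> L2" for i
        by (rule L2_dominated[OF _ h2]) (use Uh seq.hyps(2) in \<open>auto intro: power_mono\<close>)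
      have "(\<lambda>i. \<integral>x. (h x - U i x)\<^sup>2 \<partial>lborel) \<longlonglongrightarrow> (\<integral>x. 0 \<partial>(lborel :: (real^'n) measure))"
      proof (rule integral_dominated_convergence[OF _ _ h2])
        show "AE x in lborel. (\<lambda>i. (h x - U i x)\<^sup>2) \<longlonglongrightarrow> 0"
        proof (rule AE_I2)
          fix x
          have "(\<lambda>i. (h x - U i x)\<^sup>2) \<longlonglongrightarrow> (h x - h x)\<^sup>2" by (intro tendsto_intros seq.hyps) simp
          then show "(\<lambda>i. (h x - U i x)\<^sup>2) \<longlonglongrightarrow> 0" by simp
        qed
        show "AE x in lborel. norm ((h x - U i x)\<^sup>2) \<le> (h x)\<^sup>2" for i
          using Uh seq.hyps(2) by (intro AE_I2) (auto intro!: power_mono)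
      qed simp_all
      from tendsto_real_sqrt[OF this]
      have lim: "(\<lambda>i. L2_norm (\<lambda>x. complex_of_real (h x) - complex_of_real (U i x))) \<longlonglongrightarrow> 0"
        unfolding L2_norm_def of_real_diff[symmetric] norm_of_real by simp
      show "heat_limit (\<lambda>x. complex_of_real (h x))"
      proof (rule heat_limit_closed[OF *])
        fix e :: real assume "e > 0"
        then obtain i where "L2_norm (\<lambda>x. complex_of_real (h x) - complex_of_real (U i x)) < e"
          using order_tendstoD(2)[OF lim] by (auto simp: eventually_sequentially)
        then show "\<exists>g\<in>L2. heat_limit g \<and> L2_norm (\<lambda>x. complex_of_real (h x) - g x) < e"
          using U[of i] seq.IH[of i] by blast
      qed
    qed
  qed
  with L2 show ?thesis by blast
qed

lemma heat_limit_L2: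
  assumes f: "f \<in> L2" shows "heat_limit f"
proof -
  have real: "heat_limit (\<lambda>x. complex_of_real (h x)) \<and> (\<lambda>x. complex_of_real (h x)) \<in> L2"
    if h: "h \<in> borel_measurable borel" "\<And>x. \<bar>h x\<bar> \<le> norm (f x)" for h
  proof -
    have L2: "(\<lambda>x. complex_of_real (g x)) \<in> L2" if "g \<in> borel_measurable borel" "\<And>x. \<bar>g x\<bar> \<le> norm (f x)" for g
    proof (rule L2_dominated[OF _ L2_integrable[OF f]])
      show "(\<lambda>x. complex_of_real (g x)) \<in> borel_measurable lborel" using that(1) by simp
      show "(norm (complex_of_real (g x)))\<^sup>2 \<le> (norm (f x))\<^sup>2" for x
        unfolding norm_of_real by (intro power_mono that) simp
    qed
    let ?p = "\<lambda>x. max (h x) 0" and ?n = "\<lambda>x. max (- h x) 0"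
    have p: "(\<lambda>x. complex_of_real (?p x)) \<in> L2" "(\<lambda>x. complex_of_real (?n x)) \<in> L2"
      by (rule L2; use h in \<open>auto simp: max_def abs_le_iff\<close>)+
    have "heat_limit (\<lambda>x. complex_of_real (?p x))" "heat_limit (\<lambda>x. complex_of_real (?n x))"
      by (rule heat_limit_nonneg; use h p in simp)+
    then have "heat_limit (\<lambda>x. complex_of_real (?p x) + (-1) * complex_of_real (?n x))"
      by (intro heat_limit_add[OF p(1) L2_cmult[OF p(2)]] heat_limit_cmult)
    moreover have "(\<lambda>x. complex_of_real (?p x) + (-1) * complex_of_real (?n x)) = (\<lambda>x. complex_of_real (h x))"
      by (auto simp: max_def)
    ultimately show ?thesis using L2[OF h] by simp
  qed
  have re: "heat_limit (\<lambda>x. complex_of_real (Re (f x))) \<and> (\<lambda>x. complex_of_real (Re (f x))) \<in> L2"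
    and im: "heat_limit (\<lambda>x. complex_of_real (Im (f x))) \<and> (\<lambda>x. complex_of_real (Im (f x))) \<in> L2"
    by (rule real; use L2_measurable[OF f] abs_Re_le_cmod abs_Im_le_cmod in simp)+
  have "heat_limit (\<lambda>x. complex_of_real (Re (f x)) + \<i> * complex_of_real (Im (f x)))"
    using heat_limit_add[OF conjunct2[OF re] L2_cmult[OF conjunct2[OF im]] conjunct1[OF re]
      heat_limit_cmult[OF conjunct1[OF im]]] .
  moreover have "(\<lambda>x. complex_of_real (Re (f x)) + \<i> * complex_of_real (Im (f x))) = f"
    by (rule ext) (simp add: complex_eq_iff)
  ultimately show ?thesis by simp
qed

text \<open>The energy method only ever estimates smoothed functions; this removes the auxiliary
  smoothing at the end.\<close>

lemma L2_norm_le_of_heat: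
  assumes f: "f \<in> L2" and B: "\<And>r. r > 0 \<Longrightarrow> L2_norm (conv (heat r ord0) f) \<le> B"
  shows "L2_norm f \<le> B"
proof (rule tendsto_upperbound)
  show "(\<lambda>m. L2_norm (conv (heat (vanish m) ord0) f)) \<longlonglongrightarrow> L2_norm f"
    by (rule L2_norm_tendsto[OF always_eventually f])
      (use heat_limit_L2[OF f] in \<open>auto simp: heat_limit_def intro!: conv_L2 kernel_heat f\<close>)
  show "\<forall>\<^sub>F m in sequentially. L2_norm (conv (heat (vanish m) ord0) f) \<le> B"
    by (intro always_eventually allI B) simp
qed simp

section \<open>Stability\<close>

lemma gronwall_upper:
  fixes f :: "real \<Rightarrow> real"
  assumes ab: "a \<le> b" and d: "\<And>s. s \<in> {a..b} \<Longrightarrow> (f has_real_derivative f' s) (at s within {a..b})"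
    and le: "\<And>s. s \<in> {a..b} \<Longrightarrow> f' s \<le> K * f s"
  shows "f b \<le> exp (K * (b - a)) * f a"
proof -
  define g where "g s = exp (- K * s) * f s" for s
  have g: "(g has_real_derivative exp (- K * s) * (f' s - K * f s)) (at s within {a..b})" if "s \<in> {a..b}" for s
  proof -
    have "((\<lambda>s. exp (- K * s)) has_real_derivative - K * exp (- K * s)) (at s within {a..b})"
      by (auto intro!: derivative_eq_intros)
    from DERIV_mult[OF this d[OF that]] show ?thesis unfolding g_def[abs_def] by (simp add: algebra_simps)
  qed
  have "g b \<le> g a"
  proof (rule DERIV_nonpos_imp_decreasing_open[OF ab])
    fix s assume s: "a < s" "s < b"
    then have "(g has_real_derivative exp (- K * s) * (f' s - K * f s)) (at s)"
      using g[of s] at_within_Icc_at[of a s b] by simp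
    moreover have "exp (- K * s) * (f' s - K * f s) \<le> 0"
      using le[of s] s by (intro mult_nonneg_nonpos) auto
    ultimately show "\<exists>y. (g has_real_derivative y) (at s) \<and> y \<le> 0" by blast
  next
    show "continuous_on {a..b} g" using g by (rule DERIV_continuous_on)
  qed
  then have "exp (K * b) * (exp (- K * b) * f b) \<le> exp (K * b) * (exp (- K * a) * f a)"
    unfolding g_def by (intro mult_left_mono) auto
  then have "exp (K * b + - K * b) * f b \<le> exp (K * b + - K * a) * f a"
    unfolding exp_add by (simp only: mult.assoc)
  then show ?thesis by (simp add: right_diff_distrib)
qed

lemma gronwall_lower:
  fixes f :: "real \<Rightarrow> real"
  assumes ab: "a \<le> b" and d: "\<And>s. s \<in> {a..b} \<Longrightarrow> (f has_real_derivative f' s) (at s within {a..b})"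
    and le: "\<And>s. s \<in> {a..b} \<Longrightarrow> - (K * f s) \<le> f' s"
  shows "f a \<le> exp (K * (b - a)) * f b"
proof -
  \<comment> \<open>The upper bound applied to \<open>- f\<close> with rate \<open>- K\<close>,
    since it requires no sign of the function or of the rate.\<close>
  have "- f b \<le> exp (- K * (b - a)) * (- f a)"
    by (rule gronwall_upper[OF ab, of _ "\<lambda>s. - f' s"]) (intro DERIV_minus d, assumption, use le in fastforce)
  then have "exp (K * (b - a)) * (exp (- K * (b - a)) * f a) \<le> exp (K * (b - a)) * f b"
    by (intro mult_left_mono) auto
  then show ?thesis by (simp add: mult.assoc[symmetric] flip: exp_add)
qed

text \<open>The energy identity before the equation is used: the moving smoothing time contributes
  \<open>m\<close> times the Laplacian, which \<open>ip_heat_lap\<close> turns into minus the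
  Dirichlet energy.\<close>

lemma heat_flow_derivative:
  fixes u :: "real \<Rightarrow> real^'n::finite \<Rightarrow> complex"
  assumes u: "has_L2_derivative_on u v {0..<T}" and ab: "{a..b} \<subseteq> {0..<T}" and s: "s \<in> {a..b}"
    and \<sigma>: "\<And>s. s \<in> {a..b} \<Longrightarrow> c + m * s > 0" "m > 0"
  shows "((\<lambda>s. (L2_norm (conv (heat (c + m * s) ord0) (u s)))\<^sup>2) has_real_derivative
     2 * (Re (ip (conv (heat (c + m * s) ord0) (u s)) (conv (heat (c + m * s) ord0) (v s))) - m * dirichlet (c + m * s) (u s)))
     (at s within {a..b})"
proof -
  let ?r = "c + m * s"
  have r: "?r > 0" by (rule \<sigma>(1)[OF s])
  have L2: "u t \<in> L2" "v t \<in> L2" if "t \<in> {a..b}" for t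
    using u ab that by (auto simp: has_L2_derivative_on_def)
  have lim: "((\<lambda>t. L2_norm (\<lambda>x. (u t x - u s x) / complex_of_real (t - s) - v s x)) \<longlongrightarrow> 0) (at s within {a..b})"
    by (rule tendsto_within_subset[OF _ ab]) (use u s ab in \<open>auto simp: has_L2_derivative_on_def\<close>)
  let ?w' = "\<lambda>x. conv (heat ?r ord0) (v s) x + of_real m * conv (heat_lap ?r) (u s) x"
  have L2s: "conv (heat ?r ord0) (v s) \<in> L2" "conv (heat_lap ?r) (u s) \<in> L2" "conv (heat ?r ord0) (u s) \<in> L2"
    by (intro conv_L2 kernel_heat kernel_heat_lap r L2 s)+
  have "((\<lambda>s. (L2_norm (conv (heat (c + m * s) ord0) (u s)))\<^sup>2) has_real_derivative
      2 * Re (ip ?w' (conv (heat ?r ord0) (u s)))) (at s within {a..b})"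
  proof (rule norm_sq_has_derivative[OF s])
    show "conv (heat (c + m * t) ord0) (u t) \<in> L2" if "t \<in> {a..b}" for t
      by (intro conv_L2 kernel_heat \<sigma> L2 that)
    show "?w' \<in> L2" by (intro L2_add L2_cmult L2s)
    show "((\<lambda>t. L2_norm (\<lambda>x. (conv (heat (c + m * t) ord0) (u t) x - conv (heat ?r ord0) (u s) x) / complex_of_real (t - s) - ?w' x))
        \<longlongrightarrow> 0) (at s within {a..b})"
      by (rule heat_curve_has_derivative[OF s _ L2(2)[OF s] lim, of "\<lambda>t. c + m * t" c m]) (use L2 \<sigma> in auto)
  qed
  moreover have "Re (ip ?w' (conv (heat ?r ord0) (u s)))
      = Re (ip (conv (heat ?r ord0) (u s)) (conv (heat ?r ord0) (v s))) - m * dirichlet ?r (u s)"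
  proof -
    have "ip ?w' (conv (heat ?r ord0) (u s)) = ip (conv (heat ?r ord0) (v s)) (conv (heat ?r ord0) (u s))
        + of_real m * ip (conv (heat_lap ?r) (u s)) (conv (heat ?r ord0) (u s))"
      by (simp only: ip_add_left[OF L2s(1) L2_cmult[OF L2s(2)] L2s(3)] ip_cmult_left)
    then show ?thesis
      using ip_heat_lap[OF r L2(1)[OF s]] ip_commute[of "conv (heat ?r ord0) (v s)" "conv (heat ?r ord0) (u s)"]
      by (simp add: dirichlet_def)
  qed
  ultimately show ?thesis by simp
qed

lemma growth_const_nonneg: "0 < k \<Longrightarrow> 0 \<le> M \<Longrightarrow> 0 \<le> growth_const t k M"
  by (simp add: growth_const_def)

text \<open>The slope \<open>m\<close> is chosen so that the Dirichlet term of the energy inequality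
  cancels exactly: \<open>2 / k\<close> against its upper bound, \<open>k / 2\<close> against its
  lower bound. A linear differential inequality with rate \<open>2 * C\<close> for the squared norm
  remains, hence rate \<open>C\<close> for the norm.\<close>

lemma solution_heat_bounds:
  fixes u :: "real \<Rightarrow> real^'n::finite \<Rightarrow> complex"
  assumes k: "0 < k" "k < 1" and ell: "backward_parabolic T k a"
    and b: "\<And>j. Linfty_norm T (b j) \<le> ereal M" and c: "Linfty_norm T c \<le> ereal M"
    and u: "u \<in> H0_space T" and sol: "is_solution T a b c u"
    and st: "0 \<le> s" "s \<le> t" "t < T" and e: "e > 0"
  defines "C \<equiv> growth_const TYPE('n) k \<bar>M\<bar>"
  shows "L2_norm (conv (heat (e + 2 / k * (t - s)) ord0) (u t)) \<le> exp (C * (t - s)) * L2_norm (conv (heat e ord0) (u s))" (is ?upper)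
    and "L2_norm (conv (heat e ord0) (u s)) \<le> exp (C * (t - s)) * L2_norm (conv (heat (e + k / 2 * (t - s)) ord0) (u t))" (is ?lower)
proof -
  obtain v where v: "has_L2_derivative_on u v {0..<T}"
    "\<And>t r. t \<in> {0..<T} \<Longrightarrow> r > 0 \<Longrightarrow>
       k / 2 * dirichlet r (u t) - C * (L2_norm (conv (heat r ord0) (u t)))\<^sup>2
         \<le> Re (ip (conv (heat r ord0) (u t)) (conv (heat r ord0) (v t)))"
    "\<And>t r. t \<in> {0..<T} \<Longrightarrow> r > 0 \<Longrightarrow>
       Re (ip (conv (heat r ord0) (u t)) (conv (heat r ord0) (v t)))
         \<le> 2 / k * dirichlet r (u t) + C * (L2_norm (conv (heat r ord0) (u t)))\<^sup>2"
    unfolding C_def by (rule solution_energy_inequality[OF k ell b c u sol]) blast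
  have sub: "{s..t} \<subseteq> {0..<T}" using st by auto
  have pos: "e - m * s + m * x > 0" if "m > 0" "x \<in> {s..t}" for m x
  proof -
    have "m * s \<le> m * x" using that by simp
    then show ?thesis using e by linarith
  qed
  \<comment> \<open>The smoothing time is \<open>e\<close> at time \<open>s\<close> and grows with
    slope \<open>m\<close>. The positive start \<open>e\<close> keeps the kernel defined
    there.\<close>
  define f where "f m x = (L2_norm (conv (heat (e - m * s + m * x) ord0) (u x)))\<^sup>2" for m x
  define f' where "f' m x = 2 * (Re (ip (conv (heat (e - m * s + m * x) ord0) (u x)) (conv (heat (e - m * s + m * x) ord0) (v x)))
      - m * dirichlet (e - m * s + m * x) (u x))" for m x
  have d: "(f m has_real_derivative f' m x) (at x within {s..t})" if "m > 0" "x \<in> {s..t}" for m x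
    unfolding f_def f'_def by (rule heat_flow_derivative[OF v(1) sub that(2) pos[OF that(1)] that(1)])
  have m: "2 / k > 0" "k / 2 > 0" using k by auto
  have sq: "exp (2 * C * (t - s)) * z\<^sup>2 = (exp (C * (t - s)) * z)\<^sup>2" for z
    by (simp add: power_mult_distrib exp_double[symmetric] mult.assoc)
  have ends: "f m s = (L2_norm (conv (heat e ord0) (u s)))\<^sup>2" "f m t = (L2_norm (conv (heat (e + m * (t - s)) ord0) (u t)))\<^sup>2" for m
    by (simp_all add: f_def algebra_simps)
  have "f (2 / k) t \<le> exp (2 * C * (t - s)) * f (2 / k) s"
  proof (rule gronwall_upper[OF st(2) d[OF m(1)]])
    fix x assume x: "x \<in> {s..t}"
    then show "f' (2 / k) x \<le> 2 * C * f (2 / k) x"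
      using v(3)[of x, OF _ pos[OF m(1) x]] sub by (auto simp: f_def f'_def)
  qed
  then show ?upper unfolding ends sq by (rule power2_le_imp_le) simp
  have "f (k / 2) s \<le> exp (2 * C * (t - s)) * f (k / 2) t"
  proof (rule gronwall_lower[OF st(2) d[OF m(2)]])
    fix x assume x: "x \<in> {s..t}"
    then show "- (2 * C * f (k / 2) x) \<le> f' (k / 2) x"
      using v(2)[of x, OF _ pos[OF m(2) x]] sub by (auto simp: f_def f'_def)
  qed
  then show ?lower unfolding ends sq by (rule power2_le_imp_le) simp
qed

text \<open>The hypothesis on \<open>m\<close> says that \<open>m\<close> doublings of the smoothing
  gained between \<open>T'\<close> and \<open>T1\<close> exceed the smoothing spent by the upper
  bound on the whole interval up to \<open>T1\<close>. \<open>E\<close> bounds the exponential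
  growth over every subinterval of that interval.\<close>

lemma solution_hoelder_stability:
  fixes u :: "real \<Rightarrow> real^'n::finite \<Rightarrow> complex"
  assumes k: "0 < k" "k < 1" and ell: "backward_parabolic T k a"
    and b: "\<And>j. Linfty_norm T (b j) \<le> ereal M" and c: "Linfty_norm T c \<le> ereal M"
    and u: "u \<in> H0_space T" and sol: "is_solution T a b c u"
    and D: "\<And>t. t \<in> {0..T} \<Longrightarrow> L2_norm (u t) \<le> D"
    and T': "0 < T'" "T' < T1" "T1 < T" and m: "2 / k * T1 < 2 ^ m * (k / 2 * (T1 - T'))"
    and t: "t \<in> {0..T'}"
  defines "E \<equiv> exp (growth_const TYPE('n) k \<bar>M\<bar> * T1)"
  shows "L2_norm (u t) \<le> E * root (2 ^ m) (D ^ (2 ^ m - 1) * E * L2_norm (u 0))"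
proof -
  define C where "C = growth_const TYPE('n) k \<bar>M\<bar>"
  have C: "0 \<le> C" unfolding C_def by (rule growth_const_nonneg) (use k in auto)
  \<comment> \<open>The least smoothing gained on the way to \<open>T1\<close> by any
    \<open>t\<close> up to \<open>T'\<close>; by \<open>heat_antimono\<close> this single value
    serves for all of them.\<close>
  define r where "r = k / 2 * (T1 - T')"
  have r: "r > 0" using k T' by (simp add: r_def)
  have L2: "u s \<in> L2" if "s \<in> {0..T}" for s
    using u that by (auto simp: H0_space_def continuous_into_def)
  have E: "exp (C * s) \<le> E" if "s \<le> T1" for s
    unfolding E_def C_def[symmetric] using C that by (simp add: mult_left_mono)
  note bounds = solution_heat_bounds[OF k ell b c u sol, folded C_def]
  define X where "X = L2_norm (conv (heat r ord0) (u T1))"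
  have "L2_norm (u t) \<le> E * X"
  proof (rule L2_norm_le_of_heat)
    show "u t \<in> L2" using L2 t T' by simp
    fix e :: real assume e: "e > 0"
    have "L2_norm (conv (heat e ord0) (u t)) \<le> exp (C * (T1 - t)) * L2_norm (conv (heat (e + k / 2 * (T1 - t)) ord0) (u T1))"
      by (rule bounds(2)) (use t T' e in auto)
    also have "\<dots> \<le> E * X"
      unfolding X_def
    proof (intro mult_mono E heat_antimono r)
      have "k / 2 * (T1 - T') \<le> k / 2 * (T1 - t)" using t k by (intro mult_left_mono) auto
      then show "r \<le> e + k / 2 * (T1 - t)" using e by (simp add: r_def)
    qed (use t T' L2 in \<open>auto simp: E_def\<close>)
    finally show "L2_norm (conv (heat e ord0) (u t)) \<le> E * X" .
  qed
  moreover have "X \<le> root (2 ^ m) (D ^ (2 ^ m - 1) * E * L2_norm (u 0))"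
  proof -
    have D0: "0 \<le> D" using D[of 0] L2_norm_nonneg[of "u 0"] T' by (simp del: L2_norm_nonneg)
    \<comment> \<open>The surplus of the doubled smoothing time: starting the upper curve at
      \<open>e\<close> makes it arrive at exactly \<open>2 ^ m * r\<close>. Positivity is the
      hypothesis on \<open>m\<close>.\<close>
    define e where "e = 2 ^ m * r - 2 / k * T1"
    have e: "e > 0" using m by (simp add: e_def r_def)
    have "L2_norm (conv (heat (2 ^ m * r) ord0) (u T1)) \<le> exp (C * (T1 - 0)) * L2_norm (conv (heat e ord0) (u 0))"
      using bounds(1)[of 0 T1 e] e T' by (simp add: e_def)
    also have "\<dots> \<le> E * L2_norm (u 0)"
      by (intro mult_mono E heat_contraction e L2) (use T' in \<open>auto simp: E_def\<close>)
    finally have "L2_norm (conv (heat (2 ^ m * r) ord0) (u T1)) \<le> E * L2_norm (u 0)" .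
    then have "D ^ (2 ^ m - 1) * L2_norm (conv (heat (2 ^ m * r) ord0) (u T1)) \<le> D ^ (2 ^ m - 1) * (E * L2_norm (u 0))"
      by (intro mult_left_mono) (use D0 in auto)
    moreover have "X ^ (2 ^ m) \<le> D ^ (2 ^ m - 1) * L2_norm (conv (heat (2 ^ m * r) ord0) (u T1))"
      unfolding X_def by (rule heat_interpolation[OF r L2 D]) (use T' in auto)
    ultimately have "X ^ (2 ^ m) \<le> D ^ (2 ^ m - 1) * E * L2_norm (u 0)" by (simp add: mult.assoc)
    then have "root (2 ^ m) (X ^ (2 ^ m)) \<le> root (2 ^ m) (D ^ (2 ^ m - 1) * E * L2_norm (u 0))"
      by (intro real_root_le_mono) auto
    then show ?thesis by (simp add: real_root_power_cancel X_def)
  qed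
  then have "E * X \<le> E * root (2 ^ m) (D ^ (2 ^ m - 1) * E * L2_norm (u 0))"
    by (intro mult_left_mono) (auto simp: E_def)
  ultimately show ?thesis by linarith
qed

theorem theorem3p3:
  fixes T :: real and \<mu> :: "real \<Rightarrow> real"
  assumes "T > 0" and "modulus_of_continuity \<mu>" and "osgood_condition \<mu>"
  shows "\<forall>T'\<in>{0<..<T}. \<forall>D>0. \<forall>k\<in>{0<..<1}. \<forall>A M K :: real.
    \<exists>\<rho>>0. \<exists>\<Psi> :: real \<Rightarrow> real.
      continuous_on {0..} \<Psi> \<and> strict_mono_on {0..} \<Psi> \<and> \<Psi> ` {0..} \<subseteq> {0..} \<and> \<Psi> 0 = 0 \<and>
      (\<forall>(a :: 'n::finite \<Rightarrow> 'n \<Rightarrow> real \<Rightarrow> real) (b :: 'n \<Rightarrow> real \<Rightarrow> complex) (c :: real \<Rightarrow> complex)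
        (u :: real \<Rightarrow> real^'n \<Rightarrow> complex).
        backward_parabolic T k a \<longrightarrow>
        (\<forall>i j. \<forall>t\<in>{0..T}. a i j t = a j i t) \<longrightarrow>
        (\<forall>i j. a i j \<in> Linfty T \<and> Linfty_norm T (a i j) \<le> ereal A) \<longrightarrow>
        (\<forall>j. b j \<in> Linfty T \<and> Linfty_norm T (b j) \<le> ereal M) \<longrightarrow>
        c \<in> Linfty T \<and> Linfty_norm T c \<le> ereal M \<longrightarrow>
        (\<forall>i j. osgood_constant T \<mu> (a i j) \<le> ennreal K) \<longrightarrow>
        u \<in> H0_space T \<longrightarrow>
        is_solution T a b c u \<longrightarrow>
        (\<forall>t\<in>{0..T}. L2_norm (u t) \<le> D) \<longrightarrow>
        L2_norm (u 0) \<le> \<rho> \<longrightarrow>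
        (SUP t\<in>{0..T'}. L2_norm (u t)) \<le> \<Psi> (L2_norm (u 0)))"
proof (intro ballI allI impI)
  fix T' D k A M K :: real
  assume T': "T' \<in> {0<..<T}" and D: "D > 0" and k: "k \<in> {0<..<1}"
  \<comment> \<open>Any time strictly between \<open>T'\<close> and \<open>T\<close> would do; the
    midpoint makes it depend on these two alone.\<close>
  define T1 where "T1 = (T + T') / 2"
  have T1: "0 < T'" "T' < T1" "T1 < T" using T' by (auto simp: T1_def)
  have "0 < k / 2 * (T1 - T')" using k T1 by simp
  from reals_Archimedean3[OF this, rule_format, of "2 / k * T1"]
  obtain n :: nat where n: "2 / k * T1 < real n * (k / 2 * (T1 - T'))" by blast
  \<comment> \<open>The Archimedean multiple \<open>n\<close> also serves as the number of
    doublings.\<close>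
  have "real n \<le> 2 ^ n" using of_nat_less_two_power[of n, where 'a=real] by simp
  then have "real n * (k / 2 * (T1 - T')) \<le> 2 ^ n * (k / 2 * (T1 - T'))"
    using \<open>0 < k / 2 * (T1 - T')\<close> by (intro mult_right_mono) auto
  with n have n: "2 / k * T1 < 2 ^ n * (k / 2 * (T1 - T'))" by linarith
  define E where "E = exp (growth_const TYPE('n) k \<bar>M\<bar> * T1)"
  define F where "F = D ^ (2 ^ n - 1) * E"
  have E: "E > 0" and F: "F > 0" using D by (auto simp: E_def F_def)
  \<comment> \<open>All constants are fixed before the coefficients and \<open>u\<close> are
    introduced, so the same function serves for the whole class. \<open>F > 0\<close> makes it
    strictly increasing.\<close>
  define \<Psi> where "\<Psi> s = E * root (2 ^ n) (F * s)" for s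
  have "continuous_on {0..} \<Psi>" unfolding \<Psi>_def by (intro continuous_intros)
  moreover have "strict_mono_on {0..} \<Psi>"
    unfolding \<Psi>_def using E F by (intro strict_mono_onI mult_strict_left_mono real_root_less_mono) auto
  moreover have "\<Psi> ` {0..} \<subseteq> {0..}" using E F by (auto simp: \<Psi>_def)
  moreover have "\<Psi> 0 = 0" by (simp add: \<Psi>_def)
  moreover have "(SUP t\<in>{0..T'}. L2_norm (u t)) \<le> \<Psi> (L2_norm (u 0))"
    if "backward_parabolic T k a" "\<forall>j. b j \<in> Linfty T \<and> Linfty_norm T (b j) \<le> ereal M"
      "c \<in> Linfty T \<and> Linfty_norm T c \<le> ereal M" "u \<in> H0_space T" "is_solution T a b c u"
      "\<forall>t\<in>{0..T}. L2_norm (u t) \<le> D"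
    for a :: "'n \<Rightarrow> 'n \<Rightarrow> real \<Rightarrow> real" and b c and u :: "real \<Rightarrow> real^'n \<Rightarrow> complex"
  proof (rule cSUP_least)
    show "{0..T'} \<noteq> {}" using T' by simp
    fix t assume t: "t \<in> {0..T'}"
    show "L2_norm (u t) \<le> \<Psi> (L2_norm (u 0))"
      unfolding \<Psi>_def F_def E_def
      by (rule solution_hoelder_stability[OF _ _ that(1) _ _ that(4,5) _ T1 n t]) (use k that in auto)
  qed
  ultimately show "\<exists>\<rho>>0. \<exists>\<Psi> :: real \<Rightarrow> real.
      continuous_on {0..} \<Psi> \<and> strict_mono_on {0..} \<Psi> \<and> \<Psi> ` {0..} \<subseteq> {0..} \<and> \<Psi> 0 = 0 \<and>
      (\<forall>(a :: 'n::finite \<Rightarrow> 'n \<Rightarrow> real \<Rightarrow> real) (b :: 'n \<Rightarrow> real \<Rightarrow> complex) (c :: real \<Rightarrow> complex)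
        (u :: real \<Rightarrow> real^'n \<Rightarrow> complex).
        backward_parabolic T k a \<longrightarrow>
        (\<forall>i j. \<forall>t\<in>{0..T}. a i j t = a j i t) \<longrightarrow>
        (\<forall>i j. a i j \<in> Linfty T \<and> Linfty_norm T (a i j) \<le> ereal A) \<longrightarrow>
        (\<forall>j. b j \<in> Linfty T \<and> Linfty_norm T (b j) \<le> ereal M) \<longrightarrow>
        c \<in> Linfty T \<and> Linfty_norm T c \<le> ereal M \<longrightarrow>
        (\<forall>i j. osgood_constant T \<mu> (a i j) \<le> ennreal K) \<longrightarrow>
        u \<in> H0_space T \<longrightarrow>
        is_solution T a b c u \<longrightarrow>
        (\<forall>t\<in>{0..T}. L2_norm (u t) \<le> D) \<longrightarrow>
        L2_norm (u 0) \<le> \<rho> \<longrightarrow>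
        (SUP t\<in>{0..T'}. L2_norm (u t)) \<le> \<Psi> (L2_norm (u 0)))"
    by (intro exI[of _ "1::real"] conjI exI[of _ \<Psi>] allI impI) auto
qed

end
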